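(* Let $\mathcal{Q}$ be an infinite hereditary class of graphs. Then $$\lim_{n\to\infty}\frac{\log_2|\mathcal{Q}_n|}{\binom n2}=\max_{\Gamma\in\widehat{\mathcal{Q}}}\operatorname{Ent}(\Gamma).$$
   Context: All graphs are finite and simple; $|G|$ is the number of vertices of $G$. $\mathcal{U}$ is the set of unlabelled graphs (isomorphism classes), and $\mathcal{U}_n$ is the set of those with exactly $n\ge 1$ vertices. A graph class is a subset $\mathcal{Q}\subseteq\mathcal{U}$; $\mathcal{Q}_n:=\mathcal{Q}\cap\mathcal{U}_n$. A class $\mathcal{Q}$ is hereditary if whenever $G\in\mathcal{Q}$, every induced subgraph of $G$ belongs to $\mathcal{Q}$. For graphs $H,G$ with $|H|\le|G|$, $p(H;G)$ is the probability that a uniformly random injective map $\phi:V(H)\to V(G)$ satisfies $uv\in E(H)\iff\phi(u)\phi(v)\in E(G)$ for all $u\ne v$. A graphon is a symmetric measurable function $W:[0,1]^2\to[0,1]$ (functions equal a.e. are identified). For a graphon $W$ and a graph $H$, $$p(H;W):=\mathbb{E}\Big[\prod_{uv\in E(H)}W(X_u,X_v)\prod_{uv\in E(H)^c}(1-W(X_u,X_v))\Big],$$ where $(X_u)_{u\in V(H)}$ are i.i.d. uniform on $[0,1]$ and $E(H)^c=\{uv:u\ne v,\ uv\notin E(H)\}$. Two graphons $W,W'$ are equivalent if $p(H;W)=p(H;W')$ for all graphs $H$; a graph limit $\Gamma$ is an equivalence class of graphons, and $p(H;\Gamma):=p(H;W)$ for any representing $W$. A sequence of graphs $G_i$ converges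 to $\Gamma$ if $|G_i|\to\infty$ and $p(H;G_i)\to p(H;\Gamma)$ for every graph $H$. $\widehat{\mathcal{Q}}$ is the set of graph limits that are limits of sequences of graphs in $\mathcal{Q}$. With $h(x)=-x\log_2x-(1-x)\log_2(1-x)$ on $[0,1]$ ($h(0)=h(1)=0$), the entropy of a graphon is $\operatorname{Ent}(W):=\int_0^1\int_0^1h(W(x,y))\,dx\,dy$. It depends only on the graph limit represented by $W$, so $\operatorname{Ent}(\Gamma)$ is defined as $\operatorname{Ent}(W)$ for any representing $W$. The statement includes that the limit exists and the maximum is attained. *)

theory Defs
  imports "HOL-Probability.Probability" "HOL-Library.Ramsey"
begin

section \<open>Graphs and unlabelled graphs\<close>

text \<open>
  Since all graphs are finite, it suffices to take vertices from \<^typ>\<open>nat\<close>: every isomorphism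
  class has a representative of this form.  The null graph is excluded.
\<close>

typedef simple_graph =
  "{(V :: nat set, E :: nat set set). finite V \<and> V \<noteq> {} \<and> E \<subseteq> [V]\<^bsup>2\<^esup>}"
  by (rule exI[of _ "({0}, {})"]) simp

definition verts :: "simple_graph \<Rightarrow> nat set" where
  "verts G = fst (Rep_simple_graph G)"

definition edges :: "simple_graph \<Rightarrow> nat set set" where
  "edges G = snd (Rep_simple_graph G)"

definition induced_subgraph :: "simple_graph \<Rightarrow> simple_graph \<Rightarrow> bool" where
  "induced_subgraph H G \<longleftrightarrow>
     verts H \<subseteq> verts G \<and> edges H = {e \<in> edges G. e \<subseteq> verts H}"

definition preserves_adjacency :: "simple_graph \<Rightarrow> simple_graph \<Rightarrow> (nat \<Rightarrow> nat) \<Rightarrow> bool" where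
  "preserves_adjacency H G f \<longleftrightarrow>
     (\<forall>u\<in>verts H. \<forall>v\<in>verts H. u \<noteq> v \<longrightarrow> ({u, v} \<in> edges H \<longleftrightarrow> {f u, f v} \<in> edges G))"

definition graph_iso :: "simple_graph \<Rightarrow> simple_graph \<Rightarrow> bool" where
  "graph_iso H G \<longleftrightarrow> (\<exists>f. bij_betw f (verts H) (verts G) \<and> preserves_adjacency H G f)"

lemma graph_iso_refl: "graph_iso G G"
  unfolding graph_iso_def preserves_adjacency_def
  by (rule exI[of _ id]) auto

lemma graph_iso_sym:
  assumes "graph_iso H G"
  shows "graph_iso G H"
proof -
  obtain f where f: "bij_betw f (verts H) (verts G)"
    and adj: "preserves_adjacency H G f"
    using assms unfolding graph_iso_def by blast
  let ?g = "inv_into (verts H) f"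
  have g: "bij_betw ?g (verts G) (verts H)"
    by (rule bij_betw_inv_into[OF f])
  have "preserves_adjacency G H ?g"
    unfolding preserves_adjacency_def
  proof (intro ballI impI)
    fix u v assume uv: "u \<in> verts G" "v \<in> verts G" "u \<noteq> v"
    have "?g u \<in> verts H" "?g v \<in> verts H"
      using g uv by (auto dest: bij_betwE)
    moreover have "f (?g u) = u" "f (?g v) = v"
      using f uv by (simp_all add: bij_betw_inv_into_right)
    moreover from this have "?g u \<noteq> ?g v" using uv by metis
    ultimately show "{u, v} \<in> edges G \<longleftrightarrow> {?g u, ?g v} \<in> edges H"
      using adj unfolding preserves_adjacency_def by metis
  qed
  with g show ?thesis unfolding graph_iso_def by blast
qed

lemma graph_iso_trans:
  assumes "graph_iso G H" "graph_iso H K"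
  shows "graph_iso G K"
proof -
  obtain f g where f: "bij_betw f (verts G) (verts H)" "preserves_adjacency G H f"
    and g: "bij_betw g (verts H) (verts K)" "preserves_adjacency H K g"
    using assms unfolding graph_iso_def by blast
  have "preserves_adjacency G K (g \<circ> f)"
    unfolding preserves_adjacency_def
  proof (intro ballI impI)
    fix u v assume uv: "u \<in> verts G" "v \<in> verts G" "u \<noteq> v"
    have "f u \<in> verts H" "f v \<in> verts H" "f u \<noteq> f v"
      using f(1) uv by (auto simp: bij_betw_def inj_on_def)
    then show "{u, v} \<in> edges G \<longleftrightarrow> {(g \<circ> f) u, (g \<circ> f) v} \<in> edges K"
      using f(2) g(2) uv unfolding preserves_adjacency_def by simp
  qed
  with bij_betw_trans[OF f(1) g(1)] show ?thesis unfolding graph_iso_def by blast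
qed

quotient_type unlabelled_graph = simple_graph / graph_iso
  by (rule equivpI)
    (auto intro!: reflpI sympI transpI intro: graph_iso_refl graph_iso_sym graph_iso_trans)

lift_definition unlabelled_order :: "unlabelled_graph \<Rightarrow> nat" is "\<lambda>G. card (verts G)"
  by (auto simp: graph_iso_def dest: bij_betw_same_card)

definition of_order :: "unlabelled_graph set \<Rightarrow> nat \<Rightarrow> unlabelled_graph set" where
  "of_order Q n = {G \<in> Q. unlabelled_order G = n}"

definition hereditary :: "unlabelled_graph set \<Rightarrow> bool" where
  "hereditary Q \<longleftrightarrow>
     (\<forall>G H. abs_unlabelled_graph G \<in> Q \<and> induced_subgraph H G \<longrightarrow> abs_unlabelled_graph H \<in> Q)"

text \<open>
  Only meaningful if \<open>card (verts H) \<le> card (verts G)\<close>, as otherwise there are no injections;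
  in a sequence of graphs whose orders tend to infinity this excludes finitely many terms.
\<close>

definition induced_density :: "simple_graph \<Rightarrow> simple_graph \<Rightarrow> real" where
  "induced_density H G =
     measure_pmf.prob (pmf_of_set {\<phi> \<in> verts H \<rightarrow>\<^sub>E verts G. inj_on \<phi> (verts H)})
       {\<phi>. preserves_adjacency H G \<phi>}"


section \<open>Graphons and graph limits\<close>

definition unit_interval :: "real measure" where
  "unit_interval = restrict_space lborel {0..1}"

text \<open>
  Values outside the unit square are irrelevant.  Measurability is Borel measurability; every
  Lebesgue measurable graphon agrees almost everywhere with a Borel measurable one.  Functions
  that are equal almost everywhere are identified below, when passing to graph limits.
\<close>

typedef graphon =
  "{W :: real \<Rightarrow> real \<Rightarrow> real.
      (\<lambda>(x, y). W x y) \<in> borel_measurable (unit_interval \<Otimes>\<^sub>M unit_interval) \<and>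
      (\<forall>x\<in>{0..1}. \<forall>y\<in>{0..1}. W x y = W y x \<and> W x y \<in> {0..1})}"
  by (rule exI[of _ "\<lambda>_ _. 0"]) simp

text \<open>
  The condition \<open>u < v\<close> selects each unordered pair of vertices once; by symmetry of the graphon
  the choice of order is immaterial.
\<close>

definition graphon_density :: "simple_graph \<Rightarrow> graphon \<Rightarrow> real" where
  "graphon_density H W =
     (LINT x | PiM (verts H) (\<lambda>_. unit_interval).
        (\<Prod>(u, v) \<in> {(u, v) \<in> verts H \<times> verts H. u < v \<and> {u, v} \<in> edges H}.
           Rep_graphon W (x u) (x v)) *
        (\<Prod>(u, v) \<in> {(u, v) \<in> verts H \<times> verts H. u < v \<and> {u, v} \<notin> edges H}.
           1 - Rep_graphon W (x u) (x v)))"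

definition graphon_equiv :: "graphon \<Rightarrow> graphon \<Rightarrow> bool" where
  "graphon_equiv W W' \<longleftrightarrow> (\<forall>H. graphon_density H W = graphon_density H W')"

quotient_type graph_limit = graphon / graphon_equiv
  by (rule equivpI) (auto intro!: reflpI sympI transpI simp: graphon_equiv_def)

lift_definition limit_density :: "simple_graph \<Rightarrow> graph_limit \<Rightarrow> real" is graphon_density
  by (simp add: graphon_equiv_def)

definition converges_to_limit :: "(nat \<Rightarrow> simple_graph) \<Rightarrow> graph_limit \<Rightarrow> bool" where
  "converges_to_limit G \<Gamma> \<longleftrightarrow>
     filterlim (\<lambda>i. card (verts (G i))) at_top sequentially \<and>
     (\<forall>H. (\<lambda>i. induced_density H (G i)) \<longlonglongrightarrow> limit_density H \<Gamma>)"

definition class_limits :: "unlabelled_graph set \<Rightarrow> graph_limit set" where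
  "class_limits Q =
     {\<Gamma>. \<exists>G. (\<forall>i. abs_unlabelled_graph (G i) \<in> Q) \<and> converges_to_limit G \<Gamma>}"


section \<open>Entropy\<close>

definition binary_entropy :: "real \<Rightarrow> real" where
  "binary_entropy x = - x * log 2 x - (1 - x) * log 2 (1 - x)"

lemma binary_entropy_0_1: "binary_entropy 0 = 0" "binary_entropy 1 = 0"
  by (simp_all add: binary_entropy_def)

definition graphon_entropy :: "graphon \<Rightarrow> real" where
  "graphon_entropy W =
     (LINT y | unit_interval. LINT x | unit_interval. binary_entropy (Rep_graphon W x y))"

text \<open>
  The entropy of a graphon depends only on the graph limit it represents.  As this is a theorem
  rather than immediate from the definitions, the entropy of a graph limit is defined via
  \<^const>\<open>rep_graph_limit\<close>, which chooses some representing graphon.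
\<close>

definition graph_limit_entropy :: "graph_limit \<Rightarrow> real" where
  "graph_limit_entropy \<Gamma> = graphon_entropy (rep_graph_limit \<Gamma>)"

end

theory Submission
  imports Defs "HOL-Library.Diagonal_Subsequence" "HOL-Real_Asymp.Real_Asymp"
begin

section \<open>Entropy of hereditary graph classes\<close>

text \<open>
  Lower bound: if a graphon \<open>W\<close> represents a limit of graphs in \<open>Q\<close>, then the \<open>W\<close>-random graph on
  \<open>n\<close> vertices almost surely belongs to \<open>Q\<close>.  Given the sampled points its edges are independent with
  total entropy \<open>\<Sum> h(W(x\<^sub>i, x\<^sub>j))\<close>, which is therefore at most the logarithm of the number of labelled
  graphs in \<open>Q\<close>; averaging over the points gives \<open>(n choose 2) Ent(W)\<close>.

  Upper bound: there are few graphs which have, for some colouring of the vertices with boundedly many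
  colours, block densities of small entropy.  So if \<open>c\<close> is the upper limit of the growth rates, \<open>Q\<close>
  contains arbitrarily large graphs \<open>G\<close> with entropy at least \<open>c - \<epsilon>\<close> for every such colouring.  In each
  \<open>G\<close> choose vertices \<open>u\<^sub>0, u\<^sub>1, \<dots>\<close> and colour a vertex by its adjacencies to the first \<open>s\<close> of them,
  in such a way that at suitable levels \<open>s\<close> (independent of \<open>G\<close>) adding any few further vertices hardly
  increases the mean square of the block densities.  At such levels the block densities determine the
  subgraph densities of \<open>G\<close> approximately.  Along a subsequence all colour frequencies and block densities
  converge; laying out the colours as nested intervals gives step functions that converge in \<open>L\<^sup>2\<close>, and
  their limit is a graphon \<open>W\<close> which represents a limit of the graphs \<open>G\<close> and satisfies \<open>c \<le> Ent(W)\<close>.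

  Finally, equivalent graphons have the same entropy: the entropy of the \<open>W\<close>-random graph on \<open>k\<close> vertices
  is at least \<open>(k choose 2) Ent(W)\<close>, whereas coding it by a mixture of block models approximating an
  equivalent graphon \<open>W'\<close> shows that it is at most \<open>(k choose 2) Ent(W') + o(k\<^sup>2)\<close>.
\<close>

subsection \<open>Independent edges and Gibbs' inequality\<close>

definition upairs :: "nat set \<Rightarrow> (nat \<times> nat) set" where
  "upairs I = {(u, v). u \<in> I \<and> v \<in> I \<and> u < v}"

lemma finite_upairs [simp]: "finite I \<Longrightarrow> finite (upairs I)"
  by (rule finite_subset[of _ "I \<times> I"]) (auto simp: upairs_def)

definition bern :: "'a set \<Rightarrow> ('a \<Rightarrow> real) \<Rightarrow> 'a set \<Rightarrow> real" where
  "bern P w A = (\<Prod>p\<in>P. if p \<in> A then w p else 1 - w p)"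

lemma bern_nonneg: "(\<And>p. p \<in> P \<Longrightarrow> w p \<in> {0..1}) \<Longrightarrow> 0 \<le> bern P w A"
  unfolding bern_def by (rule prod_nonneg) auto

lemma bern_le_1: "(\<And>p. p \<in> P \<Longrightarrow> w p \<in> {0..1}) \<Longrightarrow> bern P w A \<le> 1"
  unfolding bern_def by (rule prod_le_1) auto

lemma bern_insert:
  assumes "finite P" "p \<notin> P" "A \<subseteq> P"
  shows "bern (insert p P) w A = (1 - w p) * bern P w A"
    "bern (insert p P) w (insert p A) = w p * bern P w A"
proof -
  have "p \<notin> A" using assms by auto
  then show "bern (insert p P) w A = (1 - w p) * bern P w A"
    using assms by (simp add: bern_def)
  have "(\<Prod>x\<in>P. if x \<in> insert p A then w x else 1 - w x) = (\<Prod>x\<in>P. if x \<in> A then w x else 1 - w x)"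
    using assms by (intro prod.cong) auto
  then show "bern (insert p P) w (insert p A) = w p * bern P w A"
    using assms by (simp add: bern_def)
qed

lemma sum_Pow_insert:
  fixes F :: "'a set \<Rightarrow> 'b::comm_monoid_add"
  assumes "finite P" "p \<notin> P"
  shows "(\<Sum>A\<in>Pow (insert p P). F A) = (\<Sum>A\<in>Pow P. F A + F (insert p A))"
proof -
  have inj: "inj_on (insert p) (Pow P)"
    using assms by (auto simp: inj_on_def)
  have "(\<Sum>A\<in>Pow (insert p P). F A) = (\<Sum>A\<in>Pow P. F A) + (\<Sum>A\<in>insert p ` Pow P. F A)"
    unfolding Pow_insert using assms by (intro sum.union_disjoint) auto
  also have "\<dots> = (\<Sum>A\<in>Pow P. F A + F (insert p A))"
    using inj by (simp add: sum.reindex sum.distrib)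
  finally show ?thesis .
qed

lemma sum_bern: "finite P \<Longrightarrow> (\<Sum>A\<in>Pow P. bern P w A) = 1"
proof (induction P rule: finite_induct)
  case empty
  then show ?case by (simp add: bern_def)
next
  case (insert p P)
  have "(\<Sum>A\<in>Pow (insert p P). bern (insert p P) w A) = (\<Sum>A\<in>Pow P. bern P w A)"
    unfolding sum_Pow_insert[OF insert(1,2)]
    using insert by (intro sum.cong) (auto simp: bern_insert algebra_simps)
  then show ?case using insert by simp
qed

lemma sum_bern_additive:
  assumes "finite P"
  shows "(\<Sum>A\<in>Pow P. bern P w A * (\<Sum>p\<in>P. if p \<in> A then \<alpha> p else \<beta> p))
    = (\<Sum>p\<in>P. w p * \<alpha> p + (1 - w p) * \<beta> p)"
  using assms
proof (induction P rule: finite_induct)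
  case empty
  then show ?case by simp
next
  case (insert p P)
  let ?S = "\<lambda>A. \<Sum>q\<in>P. if q \<in> A then \<alpha> q else \<beta> q"
  have S: "(\<Sum>q\<in>insert p P. if q \<in> A then \<alpha> q else \<beta> q) = \<beta> p + ?S A"
    "(\<Sum>q\<in>insert p P. if q \<in> insert p A then \<alpha> q else \<beta> q) = \<alpha> p + ?S A" if "A \<subseteq> P" for A
  proof -
    have "(\<Sum>q\<in>P. if q \<in> insert p A then \<alpha> q else \<beta> q) = ?S A"
      using insert by (intro sum.cong) auto
    then show "(\<Sum>q\<in>insert p P. if q \<in> insert p A then \<alpha> q else \<beta> q) = \<alpha> p + ?S A"
      using insert by simp
    show "(\<Sum>q\<in>insert p P. if q \<in> A then \<alpha> q else \<beta> q) = \<beta> p + ?S A"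
      using insert that by auto
  qed
  have "(\<Sum>A\<in>Pow (insert p P). bern (insert p P) w A * (\<Sum>q\<in>insert p P. if q \<in> A then \<alpha> q else \<beta> q))
     = (\<Sum>A\<in>Pow P. (w p * \<alpha> p + (1 - w p) * \<beta> p) * bern P w A + bern P w A * ?S A)"
    unfolding sum_Pow_insert[OF insert(1,2)]
  proof (intro sum.cong refl)
    fix A assume "A \<in> Pow P"
    then have A: "A \<subseteq> P" by simp
    show "bern (insert p P) w A * (\<Sum>q\<in>insert p P. if q \<in> A then \<alpha> q else \<beta> q) +
         bern (insert p P) w (insert p A) * (\<Sum>q\<in>insert p P. if q \<in> insert p A then \<alpha> q else \<beta> q) =
         (w p * \<alpha> p + (1 - w p) * \<beta> p) * bern P w A + bern P w A * ?S A"
      unfolding S[OF A] bern_insert[OF insert(1,2) A] by (simp add: algebra_simps)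
  qed
  also have "\<dots> = (w p * \<alpha> p + (1 - w p) * \<beta> p) * (\<Sum>A\<in>Pow P. bern P w A) + (\<Sum>A\<in>Pow P. bern P w A * ?S A)"
    by (simp add: sum.distrib sum_distrib_left)
  also have "\<dots> = (w p * \<alpha> p + (1 - w p) * \<beta> p) + (\<Sum>p\<in>P. w p * \<alpha> p + (1 - w p) * \<beta> p)"
    using insert by (simp add: sum_bern)
  finally show ?case using insert by simp
qed

lemma log_bern:
  assumes "finite P" "bern P w A \<noteq> 0" "\<And>p. p \<in> P \<Longrightarrow> w p \<in> {0..1}"
  shows "log 2 (bern P w A) = (\<Sum>p\<in>P. if p \<in> A then log 2 (w p) else log 2 (1 - w p))"
proof -
  have pos: "0 < (if p \<in> A then w p else 1 - w p)" if "p \<in> P" for p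
  proof -
    have "(if p \<in> A then w p else 1 - w p) \<noteq> 0"
      using assms(1,2) that unfolding bern_def prod_zero_iff[OF assms(1)] by blast
    then show ?thesis using assms(3)[OF that] by (cases "p \<in> A") auto
  qed
  have "ln (bern P w A) = (\<Sum>p\<in>P. ln (if p \<in> A then w p else 1 - w p))"
    unfolding bern_def by (intro ln_prod assms(1)) (metis less_irrefl pos)
  also have "\<dots> / ln 2 = (\<Sum>p\<in>P. if p \<in> A then log 2 (w p) else log 2 (1 - w p))"
    unfolding sum_divide_distrib by (intro sum.cong refl) (simp add: log_def)
  finally show ?thesis by (simp add: log_def)
qed

lemma gibbs_inequality:
  fixes b q :: "'a \<Rightarrow> real"
  assumes "finite F" "\<And>A. A \<in> F \<Longrightarrow> 0 \<le> b A" "\<And>A. A \<in> F \<Longrightarrow> 0 < q A"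
    and "(\<Sum>A\<in>F. b A) = 1" "(\<Sum>A\<in>F. q A) \<le> 1"
  shows "(\<Sum>A\<in>F. b A * log 2 (q A)) \<le> (\<Sum>A\<in>F. b A * log 2 (b A))"
proof -
  have "b A * ln (q A) - b A * ln (b A) \<le> q A - b A" if "A \<in> F" for A
  proof (cases "b A = 0")
    case True
    then show ?thesis using assms(3)[OF that] by simp
  next
    case False
    then have bp: "0 < b A" using assms(2)[OF that] by simp
    have qp: "0 < q A" using assms(3)[OF that] .
    have "ln (q A / b A) \<le> q A / b A - 1"
      using bp qp by (intro ln_le_minus_one) simp
    then have "b A * (ln (q A) - ln (b A)) \<le> b A * (q A / b A - 1)"
      using bp qp by (simp add: ln_div)
    then show ?thesis using bp by (simp add: algebra_simps)
  qed
  then have "(\<Sum>A\<in>F. b A * ln (q A) - b A * ln (b A)) \<le> (\<Sum>A\<in>F. q A - b A)"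
    by (rule sum_mono)
  then have "(\<Sum>A\<in>F. b A * ln (q A)) \<le> (\<Sum>A\<in>F. b A * ln (b A))"
    using assms(4,5) by (simp add: sum_subtractf)
  then have "(\<Sum>A\<in>F. b A * ln (q A)) / ln 2 \<le> (\<Sum>A\<in>F. b A * ln (b A)) / ln 2"
    by (simp add: divide_right_mono)
  then show ?thesis by (simp add: log_def sum_divide_distrib)
qed

lemma bern_entropy:
  assumes "finite P" "\<And>p. p \<in> P \<Longrightarrow> w p \<in> {0..1}"
  shows "(\<Sum>A\<in>Pow P. bern P w A * log 2 (bern P w A)) = - (\<Sum>p\<in>P. binary_entropy (w p))"
proof -
  have "(\<Sum>A\<in>Pow P. bern P w A * log 2 (bern P w A))
    = (\<Sum>A\<in>Pow P. bern P w A * (\<Sum>p\<in>P. if p \<in> A then log 2 (w p) else log 2 (1 - w p)))"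
  proof (rule sum.cong[OF refl])
    fix A
    show "bern P w A * log 2 (bern P w A)
        = bern P w A * (\<Sum>p\<in>P. if p \<in> A then log 2 (w p) else log 2 (1 - w p))"
    proof (cases "bern P w A = 0")
      case False
      then have "log 2 (bern P w A) = (\<Sum>p\<in>P. if p \<in> A then log 2 (w p) else log 2 (1 - w p))"
        using assms by (intro log_bern)
      then show ?thesis by (rule arg_cong)
    qed simp
  qed
  also have "\<dots> = (\<Sum>p\<in>P. w p * log 2 (w p) + (1 - w p) * log 2 (1 - w p))"
    using assms by (intro sum_bern_additive)
  also have "\<dots> = - (\<Sum>p\<in>P. binary_entropy (w p))"
    unfolding sum_negf[symmetric] by (intro sum.cong refl) (simp add: binary_entropy_def)
  finally show ?thesis .
qed

subsection \<open>Colourings and block densities\<close>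

definition colour_class :: "'v set \<Rightarrow> ('v \<Rightarrow> nat) \<Rightarrow> nat \<Rightarrow> 'v set" where
  "colour_class V \<kappa> t = {v \<in> V. \<kappa> v = t}"

definition block_density :: "'v set \<Rightarrow> ('v \<Rightarrow> 'v \<Rightarrow> bool) \<Rightarrow> ('v \<Rightarrow> nat) \<Rightarrow> nat \<Rightarrow> nat \<Rightarrow> real" where
  "block_density V E \<kappa> s t =
     (\<Sum>v\<in>colour_class V \<kappa> s. \<Sum>w\<in>colour_class V \<kappa> t. of_bool (E v w)) /
     (real (card (colour_class V \<kappa> s)) * real (card (colour_class V \<kappa> t)))"

abbreviation block_avg :: "'v set \<Rightarrow> ('v \<Rightarrow> 'v \<Rightarrow> bool) \<Rightarrow> ('v \<Rightarrow> nat) \<Rightarrow> 'v \<Rightarrow> 'v \<Rightarrow> real" where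
  "block_avg V E \<kappa> v w \<equiv> block_density V E \<kappa> (\<kappa> v) (\<kappa> w)"

definition block_const :: "'v set \<Rightarrow> ('v \<Rightarrow> nat) \<Rightarrow> ('v \<Rightarrow> 'v \<Rightarrow> real) \<Rightarrow> bool" where
  "block_const V \<kappa> f \<longleftrightarrow>
     (\<forall>v\<in>V. \<forall>v'\<in>V. \<forall>w\<in>V. \<forall>w'\<in>V. \<kappa> v = \<kappa> v' \<longrightarrow> \<kappa> w = \<kappa> w' \<longrightarrow> f v w = f v' w')"

definition refines :: "'v set \<Rightarrow> ('v \<Rightarrow> nat) \<Rightarrow> ('v \<Rightarrow> nat) \<Rightarrow> bool" where
  "refines V \<kappa>' \<kappa> \<longleftrightarrow> (\<forall>v\<in>V. \<forall>w\<in>V. \<kappa>' v = \<kappa>' w \<longrightarrow> \<kappa> v = \<kappa> w)"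

definition energy :: "'v set \<Rightarrow> ('v \<Rightarrow> 'v \<Rightarrow> bool) \<Rightarrow> ('v \<Rightarrow> nat) \<Rightarrow> real" where
  "energy V E \<kappa> = (\<Sum>v\<in>V. \<Sum>w\<in>V. (block_avg V E \<kappa> v w)\<^sup>2) / (real (card V))\<^sup>2"

lemma finite_colour_class [simp]: "finite V \<Longrightarrow> finite (colour_class V \<kappa> t)"
  by (simp add: colour_class_def)

lemma block_density_bounds: "0 \<le> block_density V E \<kappa> s t" "block_density V E \<kappa> s t \<le> 1"
proof -
  have *: "(\<Sum>v\<in>A. \<Sum>w\<in>B. of_bool (E v w)) \<le> real (card A) * real (card B)" for A B :: "'a set"
  proof -
    have "(\<Sum>v\<in>A. \<Sum>w\<in>B. (of_bool (E v w) :: real)) \<le> (\<Sum>v\<in>A. \<Sum>w\<in>B. 1)"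
      by (intro sum_mono) auto
    then show ?thesis by simp
  qed
  show "0 \<le> block_density V E \<kappa> s t"
    unfolding block_density_def by (intro divide_nonneg_nonneg sum_nonneg) auto
  show "block_density V E \<kappa> s t \<le> 1"
    unfolding block_density_def by (rule divide_le_eq_1[THEN iffD2]) (use * in \<open>auto simp: zero_less_mult_iff\<close>)
qed

lemma block_density_sym:
  assumes "\<And>v w. E v w = E w v"
  shows "block_density V E \<kappa> s t = block_density V E \<kappa> t s"
  unfolding block_density_def
  by (subst sum.swap) (simp add: assms mult.commute)

lemma sum_blocks:
  fixes g :: "'v \<Rightarrow> 'v \<Rightarrow> real"
  assumes "finite V"
  shows "(\<Sum>v\<in>V. \<Sum>w\<in>V. g v w) =
    (\<Sum>s\<in>\<kappa> ` V. \<Sum>t\<in>\<kappa> ` V. \<Sum>v\<in>colour_class V \<kappa> s. \<Sum>w\<in>colour_class V \<kappa> t. g v w)"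
proof -
  have "(\<Sum>v\<in>V. \<Sum>w\<in>V. g v w) = (\<Sum>s\<in>\<kappa> ` V. \<Sum>v\<in>colour_class V \<kappa> s. \<Sum>w\<in>V. g v w)"
    unfolding colour_class_def using assms by (rule sum.image_gen)
  also have "\<dots> = (\<Sum>s\<in>\<kappa> ` V. \<Sum>v\<in>colour_class V \<kappa> s. \<Sum>t\<in>\<kappa> ` V. \<Sum>w\<in>colour_class V \<kappa> t. g v w)"
    unfolding colour_class_def by (intro sum.cong refl sum.image_gen assms)
  also have "\<dots> = (\<Sum>s\<in>\<kappa> ` V. \<Sum>t\<in>\<kappa> ` V. \<Sum>v\<in>colour_class V \<kappa> s. \<Sum>w\<in>colour_class V \<kappa> t. g v w)"
    by (intro sum.cong refl sum.swap)
  finally show ?thesis .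
qed

lemma sum_block_avg:
  assumes "finite V" "block_const V \<kappa> f"
  shows "(\<Sum>v\<in>V. \<Sum>w\<in>V. f v w * of_bool (E v w)) = (\<Sum>v\<in>V. \<Sum>w\<in>V. f v w * block_avg V E \<kappa> v w)"
  unfolding sum_blocks[OF assms(1), of _ \<kappa>]
proof (rule sum.cong[OF refl], rule sum.cong[OF refl])
  fix s t assume "s \<in> \<kappa> ` V" "t \<in> \<kappa> ` V"
  then obtain v0 w0 where vw: "v0 \<in> V" "\<kappa> v0 = s" "w0 \<in> V" "\<kappa> w0 = t" by auto
  let ?A = "colour_class V \<kappa> s" and ?B = "colour_class V \<kappa> t"
  have ne: "card ?A \<noteq> 0" "card ?B \<noteq> 0"
    using vw assms(1) by (auto simp: colour_class_def)
  have f: "f v w = f v0 w0" if "v \<in> ?A" "w \<in> ?B" for v w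
    using assms(2) vw that unfolding block_const_def colour_class_def by blast
  have "(\<Sum>v\<in>?A. \<Sum>w\<in>?B. f v w * of_bool (E v w)) = f v0 w0 * (\<Sum>v\<in>?A. \<Sum>w\<in>?B. of_bool (E v w))"
    by (simp add: sum_distrib_left f)
  also have "\<dots> = f v0 w0 * (real (card ?A) * real (card ?B) * block_density V E \<kappa> s t)"
    using ne by (simp add: block_density_def)
  also have "\<dots> = (\<Sum>v\<in>?A. \<Sum>w\<in>?B. f v0 w0 * block_density V E \<kappa> s t)"
    by simp
  also have "\<dots> = (\<Sum>v\<in>?A. \<Sum>w\<in>?B. f v w * block_avg V E \<kappa> v w)"
    by (intro sum.cong refl) (simp add: f[symmetric], simp add: colour_class_def)
  finally show "(\<Sum>v\<in>?A. \<Sum>w\<in>?B. f v w * of_bool (E v w)) = (\<Sum>v\<in>?A. \<Sum>w\<in>?B. f v w * block_avg V E \<kappa> v w)" .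
qed

lemma block_const_block_avg: "refines V \<kappa>' \<kappa> \<Longrightarrow> block_const V \<kappa>' (\<lambda>v w. F (\<kappa> v) (\<kappa> w))"
  unfolding block_const_def refines_def by (intro ballI impI arg_cong2[of _ _ _ _ F]) blast+

lemma refines_refl: "refines V \<kappa> \<kappa>"
  by (simp add: refines_def)

lemma energy_diff:
  assumes "finite V" "refines V \<kappa>' \<kappa>"
  shows "(\<Sum>v\<in>V. \<Sum>w\<in>V. (block_avg V E \<kappa>' v w - block_avg V E \<kappa> v w)\<^sup>2)
    = (real (card V))\<^sup>2 * (energy V E \<kappa>' - energy V E \<kappa>)"
proof (cases "card V = 0")
  case True
  then show ?thesis using assms(1) by simp
next
  case False
  have "(\<Sum>v\<in>V. \<Sum>w\<in>V. block_avg V E \<kappa> v w * block_avg V E \<kappa>' v w)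
      = (\<Sum>v\<in>V. \<Sum>w\<in>V. block_avg V E \<kappa> v w * of_bool (E v w))"
    by (rule sum_block_avg[symmetric, OF assms(1) block_const_block_avg[OF assms(2)]])
  also have "\<dots> = (\<Sum>v\<in>V. \<Sum>w\<in>V. block_avg V E \<kappa> v w * block_avg V E \<kappa> v w)"
    by (rule sum_block_avg[OF assms(1) block_const_block_avg[OF refines_refl]])
  finally have *: "(\<Sum>v\<in>V. \<Sum>w\<in>V. block_avg V E \<kappa> v w * block_avg V E \<kappa>' v w)
      = (\<Sum>v\<in>V. \<Sum>w\<in>V. (block_avg V E \<kappa> v w)\<^sup>2)"
    by (simp add: power2_eq_square)
  have "(\<Sum>v\<in>V. \<Sum>w\<in>V. (block_avg V E \<kappa>' v w - block_avg V E \<kappa> v w)\<^sup>2)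
    = (\<Sum>v\<in>V. \<Sum>w\<in>V. (block_avg V E \<kappa>' v w)\<^sup>2) + (\<Sum>v\<in>V. \<Sum>w\<in>V. (block_avg V E \<kappa> v w)\<^sup>2)
      - 2 * (\<Sum>v\<in>V. \<Sum>w\<in>V. block_avg V E \<kappa> v w * block_avg V E \<kappa>' v w)"
    by (simp add: power2_diff sum.distrib sum_subtractf sum_distrib_left algebra_simps)
  also have "\<dots> = (\<Sum>v\<in>V. \<Sum>w\<in>V. (block_avg V E \<kappa>' v w)\<^sup>2) - (\<Sum>v\<in>V. \<Sum>w\<in>V. (block_avg V E \<kappa> v w)\<^sup>2)"
    unfolding * by simp
  also have "\<dots> = (real (card V))\<^sup>2 * (energy V E \<kappa>' - energy V E \<kappa>)"
    using False by (simp add: energy_def right_diff_distrib)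
  finally show ?thesis .
qed

lemma energy_mono:
  assumes "finite V" "V \<noteq> {}" "refines V \<kappa>' \<kappa>"
  shows "energy V E \<kappa> \<le> energy V E \<kappa>'"
proof -
  have "0 \<le> (real (card V))\<^sup>2 * (energy V E \<kappa>' - energy V E \<kappa>)"
    unfolding energy_diff[OF assms(1,3), symmetric] by (intro sum_nonneg) auto
  then show ?thesis using assms by (simp add: zero_le_mult_iff)
qed

lemma energy_bounds:
  assumes "finite V" "V \<noteq> {}"
  shows "0 \<le> energy V E \<kappa>" "energy V E \<kappa> \<le> 1"
proof -
  show "0 \<le> energy V E \<kappa>"
    unfolding energy_def by (intro divide_nonneg_nonneg sum_nonneg) auto
  have "(\<Sum>v\<in>V. \<Sum>w\<in>V. (block_avg V E \<kappa> v w)\<^sup>2) \<le> (\<Sum>v\<in>V. \<Sum>w\<in>V. 1)"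
    by (intro sum_mono) (simp add: block_density_bounds power_le_one)
  then show "energy V E \<kappa> \<le> 1"
    using assms by (simp add: energy_def divide_le_eq_1 power2_eq_square zero_less_mult_iff card_gt_0_iff)
qed

subsection \<open>Regularity by neighbourhoods\<close>

text \<open>
  The adjacencies of \<open>v\<close> to the vertices \<open>us\<close>, read as a binary number with most significant bit
  first; dropping the last vertices of \<open>us\<close> is thus division by a power of two.
\<close>

definition code :: "('v \<Rightarrow> 'v \<Rightarrow> bool) \<Rightarrow> 'v list \<Rightarrow> 'v \<Rightarrow> nat" where
  "code E us v = foldl (\<lambda>a u. 2 * a + of_bool (E u v)) 0 us"

lemma code_Nil [simp]: "code E [] v = 0"
  and code_snoc [simp]: "code E (us @ [u]) v = 2 * code E us v + of_bool (E u v)"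
  by (simp_all add: code_def)

lemma code_less: "code E us v < 2 ^ length us"
  by (induction us rule: rev_induct) auto

lemma code_append_div: "code E (us @ ws) v div 2 ^ length ws = code E us v"
proof (induction ws rule: rev_induct)
  case (snoc w ws)
  have "code E (us @ ws @ [w]) v div 2 = code E (us @ ws) v"
  proof -
    have "code E (us @ ws @ [w]) v = 2 * code E (us @ ws) v + of_bool (E w v)"
      using code_snoc[of E "us @ ws" w v] by (simp only: append_assoc)
    moreover have "(2 * x + of_bool b) div 2 = x" for x :: nat and b
      by (cases b) simp_all
    ultimately show ?thesis by (simp only:)
  qed
  then have "code E (us @ ws @ [w]) v div (2 * 2 ^ length ws) = code E (us @ ws) v div 2 ^ length ws"
    by (simp only: div_mult2_eq)
  then show ?case using snoc by (simp only: length_append_singleton power_Suc)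
qed simp

lemma code_eq_iff: "code E us v = code E us w \<longleftrightarrow> (\<forall>u\<in>set us. E u v = E u w)"
proof (induction us rule: rev_induct)
  case (snoc u us)
  have *: "2 * x + of_bool a = 2 * y + of_bool b \<longleftrightarrow> x = y \<and> a = b" for x y :: nat and a b
    by (cases a; cases b; simp; presburger)
  show ?case unfolding code_snoc * snoc by auto
qed simp

lemma refines_code: "set us \<subseteq> set us' \<Longrightarrow> refines V (code E us') (code E us)"
  unfolding refines_def code_eq_iff by (intro ballI impI) blast

lemma energy_code_cong:
  assumes "finite V" "V \<noteq> {}" "set us = set us'"
  shows "energy V E (code E us) = energy V E (code E us')"
  using assms by (intro antisym energy_mono refines_code) auto

definition regular :: "'v set \<Rightarrow> ('v \<Rightarrow> 'v \<Rightarrow> bool) \<Rightarrow> nat \<Rightarrow> real \<Rightarrow> 'v list \<Rightarrow> bool" where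
  "regular V E k \<epsilon> us \<longleftrightarrow> (\<forall>ws. set ws \<subseteq> V \<and> length ws \<le> k \<longrightarrow>
     energy V E (code E (us @ ws)) \<le> energy V E (code E us) + \<epsilon>)"

lemma ex_regular:
  assumes V: "finite V" "V \<noteq> {}" and us: "set us \<subseteq> V" "us \<noteq> []" and N: "N > 0"
  shows "\<exists>us'. set us' \<subseteq> V \<and> length us' = k * N \<and> regular V E k (1 / real N) (us @ us')"
proof -
  let ?q = "\<lambda>us. energy V E (code E us)"
  let ?r = "\<lambda>us. regular V E k (1 / real N) us"
  have "\<exists>us'. set us' \<subseteq> V \<and> length us' \<le> k * i \<and> (?r (us @ us') \<or> real i / real N \<le> ?q (us @ us'))" for i
  proof (induction i)
    case 0
    show ?case by (rule exI[of _ "[]"]) (simp add: energy_bounds V)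
  next
    case (Suc i)
    then obtain us' where u: "set us' \<subseteq> V" "length us' \<le> k * i"
      "?r (us @ us') \<or> real i / real N \<le> ?q (us @ us')" by blast
    show ?case
    proof (cases "?r (us @ us')")
      case True
      then show ?thesis using u by (intro exI[of _ us']) auto
    next
      case False
      then obtain ws where w: "set ws \<subseteq> V" "length ws \<le> k"
        "?q (us @ us' @ ws) > ?q (us @ us') + 1 / real N"
        unfolding regular_def by fastforce
      have "real (Suc i) / real N \<le> ?q (us @ us' @ ws)"
        using w(3) u(3) False by (simp add: add_divide_distrib)
      then show ?thesis using u w by (intro exI[of _ "us' @ ws"]) auto
    qed
  qed
  from this[of N] obtain us' where u: "set us' \<subseteq> V" "length us' \<le> k * N"
      "?r (us @ us') \<or> real N / real N \<le> ?q (us @ us')" by blast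
  have r: "?r (us @ us')"
  proof (rule disjE[OF u(3)])
    assume "real N / real N \<le> ?q (us @ us')"
    then have "1 \<le> ?q (us @ us')" using N by simp
    moreover have "?q ws \<le> 1" for ws by (simp add: energy_bounds V)
    moreover have "0 \<le> 1 / real N" by simp
    ultimately show ?thesis unfolding regular_def
      by (metis add_increasing2 order_trans)
  qed
  define ps where "ps = us' @ replicate (k * N - length us') (hd us)"
  have ps: "set ps \<subseteq> V" "length ps = k * N" "set (us @ ps) = set (us @ us')"
    using u us by (auto simp: ps_def)
  have "?q ((us @ ps) @ ws) = ?q ((us @ us') @ ws)" for ws
    using ps(3) by (intro energy_code_cong V) auto
  moreover have "?q (us @ ps) = ?q (us @ us')"
    using ps(3) by (intro energy_code_cong V) auto
  ultimately have "?r (us @ ps)" using r unfolding regular_def by simp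
  then show ?thesis using ps by blast
qed

lemma sum_PiE_insert:
  fixes F :: "('a \<Rightarrow> 'b) \<Rightarrow> real"
  assumes "a \<notin> J"
  shows "(\<Sum>x\<in>PiE (insert a J) (\<lambda>_. V). F x) = (\<Sum>z\<in>PiE J (\<lambda>_. V). \<Sum>s\<in>V. F (z(a := s)))"
proof -
  have inj: "inj_on (\<lambda>(y, g). g(a := y)) (V \<times> PiE J (\<lambda>_. V))"
  proof (rule inj_onI, clarify)
    fix y g y' g'
    assume *: "g \<in> PiE J (\<lambda>_. V)" "g' \<in> PiE J (\<lambda>_. V)" "g(a := y) = g'(a := y')"
    have "y = y'" using fun_cong[OF *(3), of a] by simp
    moreover have "g i = g' i" for i
    proof (cases "i = a")
      case True
      then show ?thesis using *(1,2) assms by (metis PiE_arb)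
    next
      case False
      then show ?thesis using fun_cong[OF *(3), of i] by simp
    qed
    ultimately show "y = y' \<and> g = g'" by auto
  qed
  have "(\<Sum>x\<in>PiE (insert a J) (\<lambda>_. V). F x) = (\<Sum>(y, g)\<in>V \<times> PiE J (\<lambda>_. V). F (g(a := y)))"
    unfolding PiE_insert_eq sum.reindex[OF inj] by (simp add: case_prod_unfold comp_def)
  also have "\<dots> = (\<Sum>z\<in>PiE J (\<lambda>_. V). \<Sum>s\<in>V. F (z(a := s)))"
    by (simp add: sum.cartesian_product[symmetric] sum.swap[of _ V])
  finally show ?thesis .
qed

lemma sum_abs_le_sqrt:
  fixes f :: "'v \<Rightarrow> 'v \<Rightarrow> real"
  assumes "finite V" "(\<Sum>v\<in>V. \<Sum>w\<in>V. (f v w)\<^sup>2) \<le> (real (card V))\<^sup>2 * \<epsilon>"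
  shows "(\<Sum>v\<in>V. \<Sum>w\<in>V. \<bar>f v w\<bar>) \<le> (real (card V))\<^sup>2 * sqrt \<epsilon>"
proof -
  let ?n = "real (card V)"
  have "(\<Sum>p\<in>V \<times> V. \<bar>f (fst p) (snd p)\<bar>)\<^sup>2 \<le> real (card (V \<times> V)) * (\<Sum>p\<in>V \<times> V. \<bar>f (fst p) (snd p)\<bar>\<^sup>2)"
    using sum_squared_le_sum_of_squares[where I = "V \<times> V" and f = "\<lambda>p. \<bar>f (fst p) (snd p)\<bar>"] assms(1)
    by (simp add: mult.commute)
  also have "(\<Sum>p\<in>V \<times> V. \<bar>f (fst p) (snd p)\<bar>\<^sup>2) = (\<Sum>v\<in>V. \<Sum>w\<in>V. (f v w)\<^sup>2)"
    by (simp add: sum.cartesian_product case_prod_unfold)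
  also have "real (card (V \<times> V)) * \<dots> \<le> ?n\<^sup>2 * (?n\<^sup>2 * \<epsilon>)"
    using assms(2) by (auto simp: card_cartesian_product power2_eq_square intro!: mult_left_mono)
  finally have "sqrt ((\<Sum>p\<in>V \<times> V. \<bar>f (fst p) (snd p)\<bar>)\<^sup>2) \<le> sqrt (?n\<^sup>2 * (?n\<^sup>2 * \<epsilon>))"
    by (rule real_sqrt_le_mono)
  then have "(\<Sum>p\<in>V \<times> V. \<bar>f (fst p) (snd p)\<bar>) \<le> ?n\<^sup>2 * sqrt \<epsilon>"
    by (simp add: real_sqrt_mult power2_eq_square sum_nonneg)
  then show ?thesis by (simp add: sum.cartesian_product case_prod_unfold)
qed

text \<open>
  A function that is constant on the blocks of the finer colouring does not distinguish adjacency
  from its block averages for that colouring, and by regularity these are \<open>L\<^sup>2\<close>-close to the coarser ones.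
\<close>

lemma replace_edge_by_average:
  fixes \<Psi> :: "nat \<Rightarrow> nat \<Rightarrow> real"
  assumes V: "finite V" "V \<noteq> {}" and reg: "regular V E k \<epsilon> us"
    and ws: "set ws \<subseteq> V" "length ws \<le> k"
    and const: "block_const V (code E (us @ ws)) \<Psi>" and bound: "\<And>v w. \<bar>\<Psi> v w\<bar> \<le> 1"
  shows "\<bar>\<Sum>v\<in>V. \<Sum>w\<in>V. (of_bool (E v w) - block_avg V E (code E us) v w) * \<Psi> v w\<bar>
    \<le> (real (card V))\<^sup>2 * sqrt \<epsilon>"
proof -
  let ?f = "\<lambda>v w. block_avg V E (code E (us @ ws)) v w - block_avg V E (code E us) v w"
  have ref: "refines V (code E (us @ ws)) (code E us)" by (intro refines_code) auto
  have "(\<Sum>v\<in>V. \<Sum>w\<in>V. (of_bool (E v w) - block_avg V E (code E us) v w) * \<Psi> v w)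
    = (\<Sum>v\<in>V. \<Sum>w\<in>V. \<Psi> v w * of_bool (E v w)) - (\<Sum>v\<in>V. \<Sum>w\<in>V. \<Psi> v w * block_avg V E (code E us) v w)"
    by (simp add: algebra_simps sum_subtractf)
  also have "\<dots> = (\<Sum>v\<in>V. \<Sum>w\<in>V. ?f v w * \<Psi> v w)"
    unfolding sum_block_avg[OF V(1) const]
    by (simp add: algebra_simps sum_subtractf)
  finally have eq: "(\<Sum>v\<in>V. \<Sum>w\<in>V. (of_bool (E v w) - block_avg V E (code E us) v w) * \<Psi> v w)
    = (\<Sum>v\<in>V. \<Sum>w\<in>V. ?f v w * \<Psi> v w)" .
  have "\<bar>\<Sum>v\<in>V. \<Sum>w\<in>V. ?f v w * \<Psi> v w\<bar> \<le> (\<Sum>v\<in>V. \<Sum>w\<in>V. \<bar>?f v w\<bar>)"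
  proof (rule order_trans[OF sum_abs], rule sum_mono, rule order_trans[OF sum_abs], rule sum_mono)
    fix v w
    show "\<bar>?f v w * \<Psi> v w\<bar> \<le> \<bar>?f v w\<bar>"
      unfolding abs_mult by (rule mult_left_le[OF bound abs_ge_zero])
  qed
  also have "\<dots> \<le> (real (card V))\<^sup>2 * sqrt \<epsilon>"
  proof (rule sum_abs_le_sqrt[of V ?f, OF V(1)])
    have "energy V E (code E (us @ ws)) \<le> energy V E (code E us) + \<epsilon>"
      by (rule reg[unfolded regular_def, rule_format, OF conjI[OF ws]])
    then have "energy V E (code E (us @ ws)) - energy V E (code E us) \<le> \<epsilon>"
      by linarith
    then show "(\<Sum>v\<in>V. \<Sum>w\<in>V. (?f v w)\<^sup>2) \<le> (real (card V))\<^sup>2 * \<epsilon>"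
      unfolding energy_diff[OF V(1) ref] by (rule mult_left_mono[OF _ zero_le_power2])
  qed
  finally show ?thesis unfolding eq .
qed

definition map_density :: "nat set \<Rightarrow> 'v set \<Rightarrow> ('v \<Rightarrow> 'v \<Rightarrow> real) \<Rightarrow> (nat \<times> nat) set \<Rightarrow> real" where
  "map_density I V f B =
    (\<Sum>x\<in>PiE I (\<lambda>_. V). bern (upairs I) (\<lambda>(u, v). f (x u) (x v)) B) / real (card V) ^ card I"

text \<open>
  When all vertices of \<open>I\<close> other than \<open>a\<close> and \<open>b\<close> are placed, the remaining factors depend on the
  images of \<open>a\<close> and \<open>b\<close> only through their adjacencies to \<open>us\<close> and to the placed vertices.
\<close>

lemma replace_edge_in_bern:
  fixes V :: "nat set" and E :: "nat \<Rightarrow> nat \<Rightarrow> bool" and us :: "nat list"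
  defines "\<phi> \<equiv> block_avg V E (code E us)"
  defines "w \<equiv> \<lambda>R x p. if p \<in> R then \<phi> (x (fst p)) (x (snd p)) else of_bool (E (x (fst p)) (x (snd p)))"
  assumes V: "finite V" "V \<noteq> {}" and sym: "\<And>v w. E v w = E w v"
    and I: "finite I" "card I \<le> k" and reg: "regular V E k \<epsilon> us"
    and p: "p \<in> upairs I" "p \<notin> R"
  shows "\<bar>(\<Sum>x\<in>PiE I (\<lambda>_. V). bern (upairs I) (w R x) B) -
      (\<Sum>x\<in>PiE I (\<lambda>_. V). bern (upairs I) (w (insert p R) x) B)\<bar> \<le> real (card V) ^ card I * sqrt \<epsilon>"
proof -
  obtain a b where ab: "p = (a, b)" "a \<in> I" "b \<in> I" "a < b"
    using p(1) by (auto simp: upairs_def)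
  define J where "J = I - {a, b}"
  have J: "finite J" "a \<notin> insert b J" "b \<notin> J" "I = insert a (insert b J)"
    using ab I by (auto simp: J_def)
  have Jcard: "card I = card J + 2"
    unfolding J(4) using J(1-3) by simp
  define sg where "sg = (if p \<in> B then 1 else - 1 :: real)"
  define \<Psi> where "\<Psi> x = (\<Prod>q\<in>upairs I - {p}. if q \<in> B then w R x q else 1 - w R x q)" for x
  have w01: "w R x q \<in> {0..1}" for R x q
    by (auto simp: w_def \<phi>_def block_density_bounds)
  have \<Psi>: "\<bar>\<Psi> x\<bar> \<le> 1" for x
  proof -
    have "\<Psi> x = bern (upairs I - {p}) (w R x) B"
      by (simp add: \<Psi>_def bern_def)
    then have "0 \<le> \<Psi> x" "\<Psi> x \<le> 1"
      using w01 by (simp_all only: bern_nonneg bern_le_1)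
    then show ?thesis by simp
  qed
  have diff: "bern (upairs I) (w R x) B - bern (upairs I) (w (insert p R) x) B
      = sg * ((of_bool (E (x a) (x b)) - \<phi> (x a) (x b)) * \<Psi> x)" for x
  proof -
    have 1: "bern (upairs I) (w S x) B = (if p \<in> B then w S x p else 1 - w S x p) *
        (\<Prod>q\<in>upairs I - {p}. if q \<in> B then w S x q else 1 - w S x q)" for S
      unfolding bern_def using I p by (intro prod.remove) auto
    have 2: "(\<Prod>q\<in>upairs I - {p}. if q \<in> B then w (insert p R) x q else 1 - w (insert p R) x q) = \<Psi> x"
      unfolding \<Psi>_def by (intro prod.cong refl) (auto simp: w_def)
    have 3: "w R x p = of_bool (E (x a) (x b))" "w (insert p R) x p = \<phi> (x a) (x b)"
      using p(2) ab by (simp_all add: w_def)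
    show ?thesis unfolding 1 2 3 \<Psi>_def[symmetric] by (simp add: sg_def algebra_simps)
  qed
  have "\<bar>\<Sum>x\<in>PiE I (\<lambda>_. V). (of_bool (E (x a) (x b)) - \<phi> (x a) (x b)) * \<Psi> x\<bar>
      \<le> (\<Sum>z\<in>PiE J (\<lambda>_. V). (real (card V))\<^sup>2 * sqrt \<epsilon>)"
  proof -
    have "(\<Sum>x\<in>PiE I (\<lambda>_. V). (of_bool (E (x a) (x b)) - \<phi> (x a) (x b)) * \<Psi> x)
      = (\<Sum>z\<in>PiE J (\<lambda>_. V). \<Sum>t\<in>V. \<Sum>s\<in>V. (of_bool (E s t) - \<phi> s t) * \<Psi> (z(b := t, a := s)))"
      unfolding J(4) sum_PiE_insert[OF J(2)] sum_PiE_insert[OF J(3)] using ab by simp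
    also have "\<dots> = (\<Sum>z\<in>PiE J (\<lambda>_. V). \<Sum>s\<in>V. \<Sum>t\<in>V. (of_bool (E s t) - \<phi> s t) * \<Psi> (z(b := t, a := s)))"
      by (intro sum.cong refl sum.swap)
    finally have eq: "(\<Sum>x\<in>PiE I (\<lambda>_. V). (of_bool (E (x a) (x b)) - \<phi> (x a) (x b)) * \<Psi> x)
      = (\<Sum>z\<in>PiE J (\<lambda>_. V). \<Sum>s\<in>V. \<Sum>t\<in>V. (of_bool (E s t) - \<phi> s t) * \<Psi> (z(b := t, a := s)))" .
    have "\<bar>\<Sum>z\<in>PiE J (\<lambda>_. V). \<Sum>s\<in>V. \<Sum>t\<in>V. (of_bool (E s t) - \<phi> s t) * \<Psi> (z(b := t, a := s))\<bar>
        \<le> (\<Sum>z\<in>PiE J (\<lambda>_. V). (real (card V))\<^sup>2 * sqrt \<epsilon>)"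
    proof (rule order_trans[OF sum_abs], rule sum_mono)
      fix z assume z: "z \<in> PiE J (\<lambda>_. V)"
      define ws where "ws = map z (sorted_list_of_set J)"
      have ws: "set ws = z ` J" "length ws = card J" using J(1) by (auto simp: ws_def)
      have wsV: "set ws \<subseteq> V" "length ws \<le> k" using z ws J(1) Jcard I(2) by auto
      show "\<bar>\<Sum>s\<in>V. \<Sum>t\<in>V. (of_bool (E s t) - \<phi> s t) * \<Psi> (z(b := t, a := s))\<bar>
        \<le> (real (card V))\<^sup>2 * sqrt \<epsilon>"
        unfolding \<phi>_def
      proof (rule replace_edge_by_average[OF V reg wsV _ \<Psi>])
        show "block_const V (code E (us @ ws)) (\<lambda>s t. \<Psi> (z(b := t, a := s)))"
          unfolding block_const_def
        proof (intro ballI impI)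
          fix s s' t t'
          assume st: "code E (us @ ws) s = code E (us @ ws) s'" "code E (us @ ws) t = code E (us @ ws) t'"
          let ?x = "z(b := t, a := s)" and ?x' = "z(b := t', a := s')"
          have c: "code E us s = code E us s'" "code E us t = code E us t'"
            using st unfolding code_eq_iff by auto
          then have cx: "code E us (?x i) = code E us (?x' i)" for i by auto
          have e: "E (z i) s = E (z i) s'" "E (z i) t = E (z i) t'" if "i \<in> J" for i
            using st that unfolding code_eq_iff ws set_append by auto
          have e': "E s (z i) = E s' (z i)" "E t (z i) = E t' (z i)" if "i \<in> J" for i
            using e[OF that] sym by auto
          have "w R ?x q = w R ?x' q" if q: "q \<in> upairs I - {p}" for q
          proof -
            obtain u v where uv: "q = (u, v)" "u \<in> I" "v \<in> I" "u < v" "(u, v) \<noteq> (a, b)"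
              using q ab by (auto simp: upairs_def)
            have "E (?x u) (?x v) = E (?x' u) (?x' v)"
            proof -
              consider "u = a" "v \<in> J" | "v = a" "u \<in> J" | "u = b" "v \<in> J" | "v = b" "u \<in> J"
                | "u \<in> J" "v \<in> J"
                using uv ab unfolding J_def by fastforce
              then show ?thesis
                using ab J e e' by cases auto
            qed
            moreover have "\<phi> (?x u) (?x v) = \<phi> (?x' u) (?x' v)"
              unfolding \<phi>_def cx ..
            ultimately show ?thesis by (simp only: w_def uv fst_conv snd_conv)
          qed
          then show "\<Psi> ?x = \<Psi> ?x'"
            unfolding \<Psi>_def by (intro prod.cong refl) simp
        qed
      qed
    qed
    then show ?thesis unfolding eq .
  qed
  also have "\<dots> = real (card V) ^ card I * sqrt \<epsilon>"
    using J(1) Jcard by (simp add: card_PiE power_add power2_eq_square)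
  finally have *: "\<bar>\<Sum>x\<in>PiE I (\<lambda>_. V). (of_bool (E (x a) (x b)) - \<phi> (x a) (x b)) * \<Psi> x\<bar>
      \<le> real (card V) ^ card I * sqrt \<epsilon>" .
  have eq: "(\<Sum>x\<in>PiE I (\<lambda>_. V). bern (upairs I) (w R x) B) - (\<Sum>x\<in>PiE I (\<lambda>_. V). bern (upairs I) (w (insert p R) x) B)
     = sg * (\<Sum>x\<in>PiE I (\<lambda>_. V). (of_bool (E (x a) (x b)) - \<phi> (x a) (x b)) * \<Psi> x)"
    unfolding sum_subtractf[symmetric] diff sum_distrib_left ..
  show ?thesis
    unfolding eq using * by (simp add: sg_def)
qed

lemma counting_lemma:
  fixes E :: "nat \<Rightarrow> nat \<Rightarrow> bool" and us :: "nat list"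
  assumes V: "finite V" "V \<noteq> {}" and sym: "\<And>v w. E v w = E w v"
    and I: "finite I" "card I \<le> k" and reg: "regular V E k \<epsilon> us"
  shows "\<bar>map_density I V (\<lambda>v w. of_bool (E v w)) B - map_density I V (block_avg V E (code E us)) B\<bar>
    \<le> real (card (upairs I)) * sqrt \<epsilon>"
proof -
  define \<phi> where "\<phi> = block_avg V E (code E us)"
  define w where "w = (\<lambda>R (x :: nat \<Rightarrow> nat) p. if p \<in> R then \<phi> (x (fst p)) (x (snd p)) else of_bool (E (x (fst p)) (x (snd p))))"
  let ?S = "\<lambda>R. \<Sum>x\<in>PiE I (\<lambda>_. V). bern (upairs I) (w R x) B"
  have "\<bar>?S {} - ?S R\<bar> \<le> real (card R) * (real (card V) ^ card I * sqrt \<epsilon>)"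
    if "finite R" "R \<subseteq> upairs I" for R
    using that
  proof (induction R rule: finite_induct)
    case (insert p R)
    have "\<bar>?S R - ?S (insert p R)\<bar> \<le> real (card V) ^ card I * sqrt \<epsilon>"
      unfolding w_def \<phi>_def
      by (rule replace_edge_in_bern[OF V sym I reg]) (use insert in auto)
    then show ?case using insert by (simp add: algebra_simps)
  qed simp
  from this[of "upairs I"] have "\<bar>?S {} - ?S (upairs I)\<bar> \<le> real (card (upairs I)) * (real (card V) ^ card I * sqrt \<epsilon>)"
    using I by simp
  moreover have "?S {} = (\<Sum>x\<in>PiE I (\<lambda>_. V). bern (upairs I) (\<lambda>(u, v). of_bool (E (x u) (x v))) B)"
    by (simp add: w_def case_prod_unfold)
  moreover have "?S (upairs I) = (\<Sum>x\<in>PiE I (\<lambda>_. V). bern (upairs I) (\<lambda>(u, v). \<phi> (x u) (x v)) B)"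
    unfolding bern_def by (intro sum.cong prod.cong refl) (auto simp: w_def)
  ultimately have *: "\<bar>(\<Sum>x\<in>PiE I (\<lambda>_. V). bern (upairs I) (\<lambda>(u, v). of_bool (E (x u) (x v))) B) -
     (\<Sum>x\<in>PiE I (\<lambda>_. V). bern (upairs I) (\<lambda>(u, v). \<phi> (x u) (x v)) B)\<bar>
     \<le> real (card (upairs I)) * sqrt \<epsilon> * real (card V) ^ card I"
    by (simp add: mult_ac)
  have pos: "real (card V) ^ card I > 0" using V by (simp add: card_gt_0_iff)
  show ?thesis
    unfolding map_density_def \<phi>_def[symmetric] diff_divide_distrib[symmetric] abs_divide
    using * pos by (simp add: pos_divide_le_eq)
qed

subsection \<open>Labelled graphs\<close>

abbreviation adj :: "simple_graph \<Rightarrow> nat \<Rightarrow> nat \<Rightarrow> bool" where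
  "adj G v w \<equiv> {v, w} \<in> edges G"

lemma finite_verts [simp]: "finite (verts G)"
  and verts_nonempty [simp]: "verts G \<noteq> {}"
  and edges_subset: "edges G \<subseteq> [verts G]\<^bsup>2\<^esup>"
  using Rep_simple_graph[of G] by (auto simp: verts_def edges_def)

lemma adj_sym: "adj G v w = adj G w v"
  by (simp add: insert_commute)

lemma adj_irrefl: "\<not> adj G v v"
  using edges_subset[of G] by (auto simp: nsets_def)

definition edge_pairs :: "simple_graph \<Rightarrow> (nat \<times> nat) set" where
  "edge_pairs G = {(u, v) \<in> upairs (verts G). adj G u v}"

definition labelled_graph :: "nat \<Rightarrow> (nat \<times> nat) set \<Rightarrow> simple_graph" where
  "labelled_graph n A = Abs_simple_graph ({..<n}, (\<lambda>(u, v). {u, v}) ` A)"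

lemma
  assumes "n > 0" "A \<subseteq> upairs {..<n}"
  shows verts_labelled: "verts (labelled_graph n A) = {..<n}"
    and edges_labelled: "edges (labelled_graph n A) = (\<lambda>(u, v). {u, v}) ` A"
proof -
  have "(\<lambda>(u, v). {u, v}) ` A \<subseteq> [{..<n}]\<^bsup>2\<^esup>"
    using assms(2) by (auto simp: upairs_def nsets_def card_insert_if)
  then have "Rep_simple_graph (labelled_graph n A) = ({..<n}, (\<lambda>(u, v). {u, v}) ` A)"
    unfolding labelled_graph_def using assms by (intro Abs_simple_graph_inverse) auto
  then show "verts (labelled_graph n A) = {..<n}" "edges (labelled_graph n A) = (\<lambda>(u, v). {u, v}) ` A"
    by (simp_all add: verts_def edges_def)
qed

lemma adj_labelled:
  assumes "n > 0" "A \<subseteq> upairs {..<n}" "u < v"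
  shows "adj (labelled_graph n A) u v \<longleftrightarrow> (u, v) \<in> A"
  unfolding edges_labelled[OF assms(1,2)] using assms(2,3)
  by (force simp: upairs_def doubleton_eq_iff image_iff)

lemma edge_pairs_labelled:
  assumes "n > 0" "A \<subseteq> upairs {..<n}"
  shows "edge_pairs (labelled_graph n A) = A"
proof -
  have "(u, v) \<in> edge_pairs (labelled_graph n A) \<longleftrightarrow> (u, v) \<in> A" for u v
    using adj_labelled[OF assms, of u v] assms(2)
    by (auto simp: edge_pairs_def verts_labelled[OF assms] upairs_def)
  then show ?thesis by auto
qed

definition pullback :: "nat \<Rightarrow> simple_graph \<Rightarrow> (nat \<Rightarrow> nat) \<Rightarrow> (nat \<times> nat) set" where
  "pullback n G f = {(u, v) \<in> upairs {..<n}. adj G (f u) (f v)}"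

lemma pullback_subset: "pullback n G f \<subseteq> upairs {..<n}"
  by (auto simp: pullback_def)

lemma adj_pullback:
  assumes "n > 0" "u < n" "v < n" "u \<noteq> v"
  shows "adj (labelled_graph n (pullback n G f)) u v \<longleftrightarrow> adj G (f u) (f v)"
proof (cases "u < v")
  case True
  then show ?thesis using adj_labelled[OF assms(1) pullback_subset True] assms
    by (simp add: pullback_def upairs_def)
next
  case False
  then have "v < u" using assms by simp
  then show ?thesis using adj_labelled[OF assms(1) pullback_subset \<open>v < u\<close>, of G f] assms
    by (simp add: pullback_def upairs_def adj_sym)
qed

lemma graph_iso_pullback:
  assumes "n > 0" "bij_betw f {..<n} (verts G)"
  shows "graph_iso (labelled_graph n (pullback n G f)) G"
  unfolding graph_iso_def preserves_adjacency_def verts_labelled[OF assms(1) pullback_subset]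
  using assms adj_pullback by (intro exI[of _ f]) auto

lemma pullback_mem:
  assumes "hereditary Q" "abs_unlabelled_graph G \<in> Q" "n > 0" "inj_on f {..<n}" "f ` {..<n} \<subseteq> verts G"
  shows "abs_unlabelled_graph (labelled_graph n (pullback n G f)) \<in> Q"
proof -
  let ?V = "f ` {..<n}" and ?E = "{e \<in> edges G. e \<subseteq> f ` {..<n}}"
  define H where "H = Abs_simple_graph (?V, ?E)"
  have "?E \<subseteq> [?V]\<^bsup>2\<^esup>"
    using edges_subset[of G] by (auto simp: nsets_def)
  then have "Rep_simple_graph H = (?V, ?E)"
    unfolding H_def using assms(3) by (intro Abs_simple_graph_inverse) auto
  then have H: "verts H = ?V" "edges H = ?E"
    by (simp_all add: verts_def edges_def)
  have "induced_subgraph H G"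
    using assms(5) by (simp add: induced_subgraph_def H)
  then have HQ: "abs_unlabelled_graph H \<in> Q"
    using assms(1,2) unfolding hereditary_def by blast
  have "pullback n G f = pullback n H f"
    by (auto simp: pullback_def H upairs_def)
  moreover have "bij_betw f {..<n} (verts H)"
    using assms(4) by (simp add: H bij_betw_def)
  ultimately have "graph_iso (labelled_graph n (pullback n G f)) H"
    using graph_iso_pullback[OF assms(3)] by metis
  then show ?thesis using HQ by (metis unlabelled_graph.abs_eq_iff)
qed

definition labelled :: "unlabelled_graph set \<Rightarrow> nat \<Rightarrow> (nat \<times> nat) set set" where
  "labelled Q n = {A \<in> Pow (upairs {..<n}). abs_unlabelled_graph (labelled_graph n A) \<in> Q}"

lemma finite_labelled [simp]: "finite (labelled Q n)"
  by (rule finite_subset[of _ "Pow (upairs {..<n})"]) (auto simp: labelled_def)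

lemma of_order_eq:
  assumes "n > 0"
  shows "of_order Q n = (\<lambda>A. abs_unlabelled_graph (labelled_graph n A)) ` labelled Q n"
proof (intro equalityI subsetI)
  fix g assume g: "g \<in> of_order Q n"
  obtain G where G: "g = abs_unlabelled_graph G"
    by (metis Quotient_unlabelled_graph Quotient_abs_rep)
  then have "card (verts G) = n"
    using g by (simp add: of_order_def unlabelled_order.abs_eq)
  then obtain f where f: "bij_betw f {..<n} (verts G)"
    by (metis ex_bij_betw_nat_finite finite_verts lessThan_atLeast0)
  have *: "abs_unlabelled_graph (labelled_graph n (pullback n G f)) = g"
    unfolding G unlabelled_graph.abs_eq_iff using graph_iso_pullback[OF assms f] .
  moreover have "pullback n G f \<in> labelled Q n"
    using g pullback_subset * by (simp add: labelled_def of_order_def)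
  ultimately show "g \<in> (\<lambda>A. abs_unlabelled_graph (labelled_graph n A)) ` labelled Q n"
    by blast
next
  fix g assume "g \<in> (\<lambda>A. abs_unlabelled_graph (labelled_graph n A)) ` labelled Q n"
  then show "g \<in> of_order Q n"
    using assms by (auto simp: labelled_def of_order_def unlabelled_order.abs_eq verts_labelled)
qed

lemma finite_of_order: "n > 0 \<Longrightarrow> finite (of_order Q n)"
  by (simp add: of_order_eq)

lemma card_of_order_le: "n > 0 \<Longrightarrow> card (of_order Q n) \<le> card (labelled Q n)"
  by (simp add: of_order_eq card_image_le)

lemma card_labelled_le:
  assumes n: "n > 0"
  shows "card (labelled Q n) \<le> fact n * card (of_order Q n)"
proof -
  let ?g = "\<lambda>A. abs_unlabelled_graph (labelled_graph n A)"
  have fib: "card {A \<in> labelled Q n. ?g A = x} \<le> fact n" if x: "x \<in> of_order Q n" for x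
  proof -
    obtain A0 where "A0 \<in> labelled Q n" "x = ?g A0"
      using x unfolding of_order_eq[OF n] by blast
    then have A0: "A0 \<subseteq> upairs {..<n}" "?g A0 = x"
      by (simp_all add: labelled_def)
    have "{A \<in> labelled Q n. ?g A = x} \<subseteq> (\<lambda>f. pullback n (labelled_graph n A0) f) ` {f. f permutes {..<n}}"
    proof
      fix A assume "A \<in> {A \<in> labelled Q n. ?g A = x}"
      then have A: "A \<subseteq> upairs {..<n}" "graph_iso (labelled_graph n A) (labelled_graph n A0)"
        using A0 unlabelled_graph.abs_eq_iff by (auto simp: labelled_def)
      then obtain f where f: "bij_betw f {..<n} {..<n}"
        "preserves_adjacency (labelled_graph n A) (labelled_graph n A0) f"
        unfolding graph_iso_def verts_labelled[OF n A(1)] verts_labelled[OF n A0(1)] by blast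
      define f' where "f' u = (if u < n then f u else u)" for u
      have "bij_betw f' {..<n} {..<n}"
        using f(1) by (subst bij_betw_cong[of _ _ f]) (auto simp: f'_def)
      then have "f' permutes {..<n}"
        by (intro bij_imp_permutes) (auto simp: f'_def)
      moreover have "A = pullback n (labelled_graph n A0) f'"
      proof -
        have "(u, v) \<in> A \<longleftrightarrow> (u, v) \<in> pullback n (labelled_graph n A0) f'" if uv: "(u, v) \<in> upairs {..<n}" for u v
        proof -
          have "(u, v) \<in> A \<longleftrightarrow> adj (labelled_graph n A) u v"
            using uv adj_labelled[OF n A(1)] by (simp add: upairs_def)
          also have "\<dots> \<longleftrightarrow> adj (labelled_graph n A0) (f u) (f v)"
            using f(2) uv unfolding preserves_adjacency_def verts_labelled[OF n A(1)]
            by (auto simp: upairs_def)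
          finally show ?thesis using uv by (simp add: pullback_def f'_def upairs_def)
        qed
        then show ?thesis using A(1) pullback_subset[of n "labelled_graph n A0" f'] by auto
      qed
      ultimately show "A \<in> (\<lambda>f. pullback n (labelled_graph n A0) f) ` {f. f permutes {..<n}}" by blast
    qed
    then have "card {A \<in> labelled Q n. ?g A = x} \<le> card {f. f permutes {..<n}}"
      by (rule surj_card_le[rotated]) (simp add: finite_permutations)
    then show ?thesis by (simp add: card_permutations)
  qed
  have "card (labelled Q n) = (\<Sum>x\<in>of_order Q n. card {A \<in> labelled Q n. ?g A = x})"
    unfolding of_order_eq[OF n] using sum.image_gen[of "labelled Q n" "\<lambda>_. 1::nat" ?g] by simp
  also have "\<dots> \<le> (\<Sum>x\<in>of_order Q n. fact n)"
    by (intro sum_mono fib)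
  finally show ?thesis by (simp add: mult.commute)
qed

lemma of_order_nonempty:
  assumes "infinite Q" "hereditary Q" "n > 0"
  shows "of_order Q n \<noteq> {}"
proof -
  have "\<exists>g\<in>Q. n \<le> unlabelled_order g"
  proof (rule ccontr)
    assume "\<not> ?thesis"
    moreover have "unlabelled_order g > 0" for g
    proof -
      obtain G where "g = abs_unlabelled_graph G"
        by (metis Quotient_unlabelled_graph Quotient_abs_rep)
      then show ?thesis by (simp add: unlabelled_order.abs_eq card_gt_0_iff)
    qed
    ultimately have "Q \<subseteq> (\<Union>k\<in>{1..<n}. of_order Q k)"
      by (force simp: of_order_def Suc_le_eq)
    moreover have "finite (\<Union>k\<in>{1..<n}. of_order Q k)"
      by (auto intro: finite_of_order)
    ultimately show False using assms(1) finite_subset by blast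
  qed
  then obtain g where g: "g \<in> Q" "n \<le> unlabelled_order g" by blast
  obtain G where G: "g = abs_unlabelled_graph G"
    by (metis Quotient_unlabelled_graph Quotient_abs_rep)
  then have c: "n \<le> card (verts G)" using g by (simp add: unlabelled_order.abs_eq)
  obtain f where f: "bij_betw f {..<card (verts G)} (verts G)"
    by (metis ex_bij_betw_nat_finite finite_verts lessThan_atLeast0)
  have "inj_on f {..<n}" "f ` {..<n} \<subseteq> verts G"
    using f c by (auto simp: bij_betw_def inj_on_def)
  then have "abs_unlabelled_graph (labelled_graph n (pullback n G f)) \<in> Q"
    using assms g G by (intro pullback_mem) auto
  then have "pullback n G f \<in> labelled Q n"
    using pullback_subset by (auto simp: labelled_def)
  then show ?thesis unfolding of_order_eq[OF assms(3)] by auto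
qed

subsection \<open>Graphs of low entropy are rare\<close>

lemma real_choose_two: "real (n choose 2) = real n * (real n - 1) / 2"
  by (induction n) (simp_all add: numeral_2_eq_2 field_simps)

lemma sum_square_upairs:
  fixes g :: "nat \<Rightarrow> nat \<Rightarrow> real"
  assumes "finite V" "\<And>u v. g u v = g v u"
  shows "(\<Sum>u\<in>V. \<Sum>v\<in>V. g u v) = 2 * (\<Sum>(u, v)\<in>upairs V. g u v) + (\<Sum>v\<in>V. g v v)"
proof -
  have fin: "finite (upairs V)" "finite (prod.swap ` upairs V)" "finite ((\<lambda>v. (v, v)) ` V)"
    using assms(1) by auto
  have "V \<times> V = upairs V \<union> (prod.swap ` upairs V \<union> (\<lambda>v. (v, v)) ` V)"
    by (auto simp: upairs_def image_iff)
  then have "(\<Sum>u\<in>V. \<Sum>v\<in>V. g u v)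
    = (\<Sum>(u, v)\<in>upairs V \<union> (prod.swap ` upairs V \<union> (\<lambda>v. (v, v)) ` V). g u v)"
    by (simp add: sum.cartesian_product)
  also have "\<dots> = (\<Sum>(u, v)\<in>upairs V. g u v) + (\<Sum>(u, v)\<in>prod.swap ` upairs V \<union> (\<lambda>v. (v, v)) ` V. g u v)"
    using fin by (intro sum.union_disjoint) (auto simp: upairs_def)
  also have "(\<Sum>(u, v)\<in>prod.swap ` upairs V \<union> (\<lambda>v. (v, v)) ` V. g u v)
      = (\<Sum>(u, v)\<in>prod.swap ` upairs V. g u v) + (\<Sum>(u, v)\<in>(\<lambda>v. (v, v)) ` V. g u v)"
    using fin by (intro sum.union_disjoint) (auto simp: upairs_def)
  also have "(\<Sum>(u, v)\<in>prod.swap ` upairs V. g u v) = (\<Sum>(u, v)\<in>upairs V. g u v)"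
    by (subst sum.reindex) (auto simp: inj_on_def case_prod_unfold assms(2) intro!: sum.cong)
  also have "(\<Sum>(u, v)\<in>(\<lambda>v. (v, v)) ` V. g u v) = (\<Sum>v\<in>V. g v v)"
    by (subst sum.reindex) (auto simp: inj_on_def)
  finally show ?thesis by simp
qed

definition colouring_entropy :: "'v set \<Rightarrow> ('v \<Rightarrow> 'v \<Rightarrow> bool) \<Rightarrow> ('v \<Rightarrow> nat) \<Rightarrow> real" where
  "colouring_entropy V E \<kappa> = (\<Sum>v\<in>V. \<Sum>w\<in>V. binary_entropy (block_avg V E \<kappa> v w)) / (real (card V))\<^sup>2"

lemma block_avg_pos:
  assumes "finite V" "v \<in> V" "w \<in> V" "E v w"
  shows "0 < block_avg V E \<kappa> v w"
proof -
  let ?A = "colour_class V \<kappa> (\<kappa> v)" and ?B = "colour_class V \<kappa> (\<kappa> w)"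
  have m: "v \<in> ?A" "w \<in> ?B" using assms by (auto simp: colour_class_def)
  have "0 < (\<Sum>y\<in>?B. of_bool (E v y) :: real)"
    using assms by (intro sum_pos2[OF _ m(2)]) auto
  then have "0 < (\<Sum>x\<in>?A. \<Sum>y\<in>?B. of_bool (E x y) :: real)"
    using assms(1) by (intro sum_pos2[OF _ m(1), where f = "\<lambda>x. \<Sum>y\<in>?B. of_bool (E x y)"] sum_nonneg)
      (simp_all only: finite_colour_class zero_less_eq_of_bool)
  then show ?thesis
    using m assms unfolding block_density_def by (intro divide_pos_pos mult_pos_pos) (auto simp: card_gt_0_iff)
qed

lemma block_avg_less_1:
  assumes "finite V" "v \<in> V" "w \<in> V" "\<not> E v w"
  shows "block_avg V E \<kappa> v w < 1"
proof -
  let ?A = "colour_class V \<kappa> (\<kappa> v)" and ?B = "colour_class V \<kappa> (\<kappa> w)"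
  have m: "v \<in> ?A" "w \<in> ?B" using assms by (auto simp: colour_class_def)
  have "(\<Sum>y\<in>?B. of_bool (E v y) :: real) < (\<Sum>y\<in>?B. 1)"
    using assms m by (intro sum_strict_mono_ex1) auto
  then have "(\<Sum>x\<in>?A. \<Sum>y\<in>?B. of_bool (E x y) :: real) < (\<Sum>x\<in>?A. \<Sum>y\<in>?B. 1)"
    using assms(1) m(1)
    by (intro sum_strict_mono_ex1[of ?A "\<lambda>x. \<Sum>y\<in>?B. of_bool (E x y)" "\<lambda>x. \<Sum>y\<in>?B. 1"] ballI sum_mono bexI[of _ v])
      (simp_all only: finite_colour_class of_bool_less_eq_one)
  then show ?thesis
    using m assms unfolding block_density_def
    by (subst divide_less_eq_1_pos) (auto simp: card_gt_0_iff zero_less_mult_iff)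
qed

lemma log_bern_block_ge:
  fixes V :: "nat set" and E :: "nat \<Rightarrow> nat \<Rightarrow> bool" and \<kappa> :: "nat \<Rightarrow> nat"
  assumes V: "finite V" "V \<noteq> {}" and sym: "\<And>v w. E v w = E w v"
    and A: "A = {(u, v) \<in> upairs V. E u v}"
  defines "b \<equiv> bern (upairs V) (\<lambda>(u, v). block_avg V E \<kappa> u v) A"
  shows "0 < b" "- (real (card V))\<^sup>2 * colouring_entropy V E \<kappa> / 2 \<le> log 2 b"
proof -
  let ?\<phi> = "block_avg V E \<kappa>"
  let ?g = "\<lambda>u v. of_bool (E u v) * (log 2 (?\<phi> u v) - log 2 (1 - ?\<phi> u v)) + log 2 (1 - ?\<phi> u v)"
  have g_eq: "?g u v = (if E u v then log 2 (?\<phi> u v) else log 2 (1 - ?\<phi> u v))" for u v by simp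
  show bpos: "0 < b"
    unfolding b_def bern_def
  proof (rule prod_pos, clarify)
    fix u v assume "(u, v) \<in> upairs V"
    then show "0 < (if (u, v) \<in> A then ?\<phi> u v else 1 - ?\<phi> u v)"
      using block_avg_pos[OF V(1), of u v E \<kappa>] block_avg_less_1[OF V(1), of u v E \<kappa>]
      by (cases "E u v") (simp_all add: A upairs_def)
  qed
  have "log 2 b = (\<Sum>p\<in>upairs V. if p \<in> A then log 2 (case p of (u, v) \<Rightarrow> ?\<phi> u v) else log 2 (1 - (case p of (u, v) \<Rightarrow> ?\<phi> u v)))"
    unfolding b_def using bpos V by (intro log_bern) (auto simp: b_def block_density_bounds)
  also have "\<dots> = (\<Sum>(u, v)\<in>upairs V. ?g u v)"
    unfolding g_eq by (intro sum.cong refl) (auto simp: A split: if_splits)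
  finally have 1: "log 2 b = (\<Sum>(u, v)\<in>upairs V. ?g u v)" .
  have 2: "(\<Sum>u\<in>V. \<Sum>v\<in>V. ?g u v) = 2 * (\<Sum>(u, v)\<in>upairs V. ?g u v) + (\<Sum>v\<in>V. ?g v v)"
    by (rule sum_square_upairs[OF V(1)]) (simp add: sym block_density_sym[OF sym])
  have 3: "(\<Sum>v\<in>V. ?g v v) \<le> 0"
  proof (rule sum_nonpos)
    fix v assume v: "v \<in> V"
    show "?g v v \<le> 0"
      using block_avg_pos[OF V(1) v v] block_avg_less_1[OF V(1) v v] block_density_bounds[of V E \<kappa> "\<kappa> v" "\<kappa> v"]
      by (cases "E v v") auto
  qed
  have "(\<Sum>u\<in>V. \<Sum>v\<in>V. ?g u v)
     = (\<Sum>u\<in>V. \<Sum>v\<in>V. (log 2 (?\<phi> u v) - log 2 (1 - ?\<phi> u v)) * of_bool (E u v)) + (\<Sum>u\<in>V. \<Sum>v\<in>V. log 2 (1 - ?\<phi> u v))"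
    by (simp add: sum.distrib mult.commute)
  also have "(\<Sum>u\<in>V. \<Sum>v\<in>V. (log 2 (?\<phi> u v) - log 2 (1 - ?\<phi> u v)) * of_bool (E u v))
     = (\<Sum>u\<in>V. \<Sum>v\<in>V. (log 2 (?\<phi> u v) - log 2 (1 - ?\<phi> u v)) * ?\<phi> u v)"
    by (rule sum_block_avg[OF V(1) block_const_block_avg[OF refines_refl]])
  also have "\<dots> + (\<Sum>u\<in>V. \<Sum>v\<in>V. log 2 (1 - ?\<phi> u v)) = (\<Sum>u\<in>V. \<Sum>v\<in>V. - binary_entropy (?\<phi> u v))"
    unfolding sum.distrib[symmetric]
    by (intro sum.cong refl) (simp add: binary_entropy_def algebra_simps)
  also have "\<dots> = - (real (card V))\<^sup>2 * colouring_entropy V E \<kappa>"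
    using V by (simp add: colouring_entropy_def sum_negf card_gt_0_iff)
  finally have "(\<Sum>u\<in>V. \<Sum>v\<in>V. ?g u v) = - (real (card V))\<^sup>2 * colouring_entropy V E \<kappa>" .
  then show "- (real (card V))\<^sup>2 * colouring_entropy V E \<kappa> / 2 \<le> log 2 b"
    using 1 2 3 by simp
qed

lemma card_low_entropy:
  fixes x :: real
  assumes n: "n > 0"
  defines "V \<equiv> {..<n}"
  shows "real (card {A \<in> Pow (upairs V). \<exists>\<kappa>\<in>V \<rightarrow> {..<m}.
      colouring_entropy V (\<lambda>v w. (v, w) \<in> A \<or> (w, v) \<in> A) \<kappa> \<le> x})
    \<le> real m ^ n * (real n ^ 2 + 1) ^ (m ^ 2) * 2 powr (x * real n ^ 2 / 2)"
proof -
  let ?E = "\<lambda>A v w. (v, w) \<in> A \<or> (w, v) \<in> A"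
  let ?K = "PiE V (\<lambda>_. {..<m})" and ?D = "PiE ({..<m} \<times> {..<m}) (\<lambda>_. {..n\<^sup>2})"
  define b where "b = 2 powr (- (x * real n ^ 2 / 2))"
  define w where "w = (\<lambda>\<kappa> (e :: nat \<times> nat \<Rightarrow> nat) (u, v). min 1 (real (e (\<kappa> u, \<kappa> v)) /
     (real (card (colour_class V \<kappa> (\<kappa> u))) * real (card (colour_class V \<kappa> (\<kappa> v))))))"
  define S where "S = (\<lambda>(\<kappa>, e). {A \<in> Pow (upairs V). b \<le> bern (upairs V) (w \<kappa> e) A})"
  have fin: "finite V" "finite ?K" "finite ?D"
    by (auto simp: V_def intro!: finite_PiE)
  have bpos: "b > 0" by (simp add: b_def)
  have S: "real (card (S p)) \<le> 2 powr (x * real n ^ 2 / 2)" for p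
  proof -
    obtain \<kappa> e where p: "p = (\<kappa>, e)" by force
    have w01: "w \<kappa> e q \<in> {0..1}" for q by (auto simp: w_def split: prod.split)
    have "real (card (S p)) * b = (\<Sum>A\<in>S p. b)" by simp
    also have "\<dots> \<le> (\<Sum>A\<in>S p. bern (upairs V) (w \<kappa> e) A)"
      by (intro sum_mono) (auto simp: S_def p)
    also have "\<dots> \<le> (\<Sum>A\<in>Pow (upairs V). bern (upairs V) (w \<kappa> e) A)"
      using fin w01 by (intro sum_mono2 bern_nonneg) (auto simp: S_def p)
    also have "\<dots> = 1" using fin by (simp add: sum_bern)
    finally show ?thesis using bpos by (simp add: b_def powr_minus field_simps)
  qed
  have "{A \<in> Pow (upairs V). \<exists>\<kappa>\<in>V \<rightarrow> {..<m}. colouring_entropy V (?E A) \<kappa> \<le> x} \<subseteq> (\<Union>p\<in>?K \<times> ?D. S p)"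
  proof
    fix A assume "A \<in> {A \<in> Pow (upairs V). \<exists>\<kappa>\<in>V \<rightarrow> {..<m}. colouring_entropy V (?E A) \<kappa> \<le> x}"
    then obtain \<kappa>0 where A: "A \<subseteq> upairs V" and \<kappa>0: "\<kappa>0 \<in> V \<rightarrow> {..<m}" "colouring_entropy V (?E A) \<kappa>0 \<le> x"
      by blast
    define \<kappa> where "\<kappa> = restrict \<kappa>0 V"
    define e where "e = restrict (\<lambda>(s, t). card {(v, w) \<in> colour_class V \<kappa> s \<times> colour_class V \<kappa> t. ?E A v w}) ({..<m} \<times> {..<m})"
    have cc: "colour_class V \<kappa> = colour_class V \<kappa>0"
      by (auto simp: colour_class_def \<kappa>_def fun_eq_iff)
    have "colouring_entropy V (?E A) \<kappa> = colouring_entropy V (?E A) \<kappa>0"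
      unfolding colouring_entropy_def block_density_def cc by (simp add: \<kappa>_def)
    with \<kappa>0 have le: "colouring_entropy V (?E A) \<kappa> \<le> x" by simp
    have \<kappa>: "\<kappa> \<in> ?K" using \<kappa>0 by (auto simp: \<kappa>_def)
    have "e \<in> ?D"
    proof -
      have "card {(v, w) \<in> colour_class V \<kappa> s \<times> colour_class V \<kappa> t. ?E A v w} \<le> n\<^sup>2" for s t
      proof -
        have "card {(v, w) \<in> colour_class V \<kappa> s \<times> colour_class V \<kappa> t. ?E A v w} \<le> card (V \<times> V)"
          using fin by (intro card_mono) (auto simp: colour_class_def)
        then show ?thesis by (simp add: V_def card_cartesian_product power2_eq_square)
      qed
      then show ?thesis by (auto simp: e_def)
    qed
    moreover have "A \<in> S (\<kappa>, e)"
    proof -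
      have "w \<kappa> e p = (case p of (u, v) \<Rightarrow> block_avg V (?E A) \<kappa> u v)" if "p \<in> upairs V" for p
      proof -
        obtain u v where p: "p = (u, v)" "u \<in> V" "v \<in> V" using \<open>p \<in> upairs V\<close> by (auto simp: upairs_def)
        have lt: "\<kappa> u < m" "\<kappa> v < m" using \<kappa> p by auto
        have "(\<Sum>v\<in>X. \<Sum>w\<in>Y. of_bool (?E A v w)) = real (card {(v, w) \<in> X \<times> Y. ?E A v w})"
          if "finite X" "finite Y" for X Y
        proof -
          have "(\<Sum>v\<in>X. \<Sum>w\<in>Y. of_bool (?E A v w)) = (\<Sum>p\<in>X \<times> Y. of_bool (case p of (v, w) \<Rightarrow> ?E A v w) :: real)"
            by (simp add: sum.cartesian_product case_prod_unfold)
          also have "\<dots> = real (card ((X \<times> Y) \<inter> {p. case p of (v, w) \<Rightarrow> ?E A v w}))"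
            using that by (simp add: sum_of_bool_eq)
          also have "(X \<times> Y) \<inter> {p. case p of (v, w) \<Rightarrow> ?E A v w} = {(v, w) \<in> X \<times> Y. ?E A v w}" by auto
          finally show ?thesis .
        qed
        then have "block_avg V (?E A) \<kappa> u v = real (e (\<kappa> u, \<kappa> v)) /
           (real (card (colour_class V \<kappa> (\<kappa> u))) * real (card (colour_class V \<kappa> (\<kappa> v))))"
          using fin lt by (simp add: block_density_def e_def)
        then show ?thesis
          using block_density_bounds(2)[of V "?E A" \<kappa> "\<kappa> u" "\<kappa> v"] by (simp add: w_def p)
      qed
      then have eq: "bern (upairs V) (w \<kappa> e) A = bern (upairs V) (\<lambda>(u, v). block_avg V (?E A) \<kappa> u v) A"
        unfolding bern_def by (intro prod.cong refl) simp
      have A_eq: "A = {(u, v) \<in> upairs V. ?E A u v}"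
        using A by (auto simp: upairs_def)
      have V: "V \<noteq> {}" using n by (auto simp: V_def)
      have "log 2 b \<le> - (real (card V))\<^sup>2 * colouring_entropy V (?E A) \<kappa> / 2"
        using mult_right_mono[OF le, of "real n ^ 2"] by (simp add: b_def V_def mult.commute)
      also have "\<dots> \<le> log 2 (bern (upairs V) (w \<kappa> e) A)"
        unfolding eq by (rule log_bern_block_ge(2)[OF fin(1) V _ A_eq]) auto
      finally have "b \<le> bern (upairs V) (w \<kappa> e) A"
        using log_bern_block_ge(1)[OF fin(1) V _ A_eq] bpos by (subst (asm) log_le_cancel_iff) (auto simp: eq)
      then show ?thesis using A by (simp add: S_def)
    qed
    ultimately show "A \<in> (\<Union>p\<in>?K \<times> ?D. S p)" using \<kappa> by blast
  qed
  then have "card {A \<in> Pow (upairs V). \<exists>\<kappa>\<in>V \<rightarrow> {..<m}. colouring_entropy V (?E A) \<kappa> \<le> x} \<le> card (\<Union>p\<in>?K \<times> ?D. S p)"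
    using fin by (intro card_mono) (auto simp: S_def)
  also have "\<dots> \<le> (\<Sum>p\<in>?K \<times> ?D. card (S p))"
    using fin by (intro card_UN_le) auto
  finally have "real (card {A \<in> Pow (upairs V). \<exists>\<kappa>\<in>V \<rightarrow> {..<m}. colouring_entropy V (?E A) \<kappa> \<le> x})
      \<le> (\<Sum>p\<in>?K \<times> ?D. real (card (S p)))"
    unfolding of_nat_sum[symmetric] of_nat_le_iff .
  also have "\<dots> \<le> (\<Sum>p\<in>?K \<times> ?D. 2 powr (x * real n ^ 2 / 2))"
    by (intro sum_mono S)
  also have "\<dots> = real (card ?K) * real (card ?D) * 2 powr (x * real n ^ 2 / 2)"
    by (simp add: card_cartesian_product)
  also have "real (card ?K) = real m ^ n" by (simp add: card_PiE V_def)
  also have "real (card ?D) = (real n ^ 2 + 1) ^ (m ^ 2)"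
    by (simp add: card_PiE card_cartesian_product power2_eq_square add.commute)
  finally show ?thesis .
qed

definition entropy_rich :: "nat \<Rightarrow> real \<Rightarrow> simple_graph \<Rightarrow> bool" where
  "entropy_rich m x G \<longleftrightarrow> (\<forall>\<kappa>\<in>verts G \<rightarrow> {..<m}. x \<le> colouring_entropy (verts G) (adj G) \<kappa>)"

lemma eventually_ex_entropy_rich:
  assumes \<epsilon>: "\<epsilon> > 0" and m: "m > 0"
  shows "\<forall>\<^sub>F n in sequentially. of_order Q n \<noteq> {} \<longrightarrow>
      c - \<epsilon> \<le> log 2 (real (card (of_order Q n))) / real (n choose 2) \<longrightarrow>
      (\<exists>A\<in>labelled Q n. entropy_rich m (c - 2 * \<epsilon>) (labelled_graph n A))"
proof -
  have "(\<lambda>n. log 2 (real m) * (real n / real n ^ 2) + real (m^2) * (log 2 (real n ^ 2 + 1) / real n ^ 2)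
     + (c - \<epsilon>) / 2 * (real n / real n ^ 2)) \<longlonglongrightarrow> log 2 (real m) * 0 + real (m^2) * 0 + (c - \<epsilon>) / 2 * 0"
    by (intro tendsto_add tendsto_mult tendsto_const; real_asymp)
  then have "\<forall>\<^sub>F n in sequentially. log 2 (real m) * (real n / real n ^ 2) + real (m^2) * (log 2 (real n ^ 2 + 1) / real n ^ 2)
     + (c - \<epsilon>) / 2 * (real n / real n ^ 2) < \<epsilon> / 2"
    using \<epsilon> by (intro order_tendstoD(2)) auto
  moreover have "\<forall>\<^sub>F n in sequentially. n \<ge> (2::nat)" by (rule eventually_ge_at_top)
  ultimately show ?thesis
  proof eventually_elim
    case (elim n)
    show ?case
    proof (intro impI, rule ccontr)
      assume ne: "of_order Q n \<noteq> {}"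
        and le: "c - \<epsilon> \<le> log 2 (real (card (of_order Q n))) / real (n choose 2)"
        and neg: "\<not> (\<exists>A\<in>labelled Q n. entropy_rich m (c - 2 * \<epsilon>) (labelled_graph n A))"
      let ?V = "{..<n}" and ?x = "c - 2 * \<epsilon>"
      let ?bad = "{A \<in> Pow (upairs ?V). \<exists>\<kappa>\<in>?V \<rightarrow> {..<m}.
          colouring_entropy ?V (\<lambda>v w. (v, w) \<in> A \<or> (w, v) \<in> A) \<kappa> \<le> ?x}"
      have n: "n > 0" using elim by simp
      have "labelled Q n \<subseteq> ?bad"
      proof
        fix A assume A: "A \<in> labelled Q n"
        then have As: "A \<subseteq> upairs ?V" by (simp add: labelled_def)
        obtain \<kappa> where \<kappa>: "\<kappa> \<in> ?V \<rightarrow> {..<m}"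
          "colouring_entropy ?V (adj (labelled_graph n A)) \<kappa> < ?x"
          using neg A unfolding entropy_rich_def by (auto simp: verts_labelled[OF n As] not_le)
        have "adj (labelled_graph n A) = (\<lambda>v w. (v, w) \<in> A \<or> (w, v) \<in> A)"
        proof (intro ext)
          fix v w
          show "adj (labelled_graph n A) v w = ((v, w) \<in> A \<or> (w, v) \<in> A)"
            using adj_labelled[OF n As, of v w] adj_labelled[OF n As, of w v]
              adj_irrefl[where G = "labelled_graph n A" and v = v]
              adj_sym[where G = "labelled_graph n A" and v = v and w = w] As
            by (cases v w rule: linorder_cases) (auto simp: upairs_def)
        qed
        then show "A \<in> ?bad" using As \<kappa> by (auto intro!: bexI[of _ \<kappa>])
      qed
      then have "real (card (labelled Q n)) \<le> real (card ?bad)"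
        by (intro of_nat_mono card_mono) auto
      also have "\<dots> \<le> real m ^ n * (real n ^ 2 + 1) ^ (m ^ 2) * 2 powr (?x * real n ^ 2 / 2)"
        by (rule card_low_entropy[OF n])
      finally have "real (card (of_order Q n)) \<le> real m ^ n * (real n ^ 2 + 1) ^ (m ^ 2) * 2 powr (?x * real n ^ 2 / 2)"
        using card_of_order_le[OF n, of Q] by linarith
      then have "log 2 (real (card (of_order Q n))) \<le> log 2 (real m ^ n * (real n ^ 2 + 1) ^ (m ^ 2) * 2 powr (?x * real n ^ 2 / 2))"
        using ne finite_of_order[OF n, of Q] by (subst log_le_cancel_iff) (auto simp: card_gt_0_iff m n intro!: mult_pos_pos zero_less_power add_nonneg_pos)
      also have "\<dots> = real n * log 2 (real m) + real (m^2) * log 2 (real n ^ 2 + 1) + ?x * real n ^ 2 / 2"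
      proof -
        have "real n ^ 2 + 1 > 0" by (intro add_nonneg_pos) auto
        then show ?thesis using m n by (simp add: log_mult log_nat_power)
      qed
      finally have "log 2 (real (card (of_order Q n)))
         \<le> real n * log 2 (real m) + real (m^2) * log 2 (real n ^ 2 + 1) + ?x * real n ^ 2 / 2" .
      moreover have "(c - \<epsilon>) * (real n * (real n - 1) / 2) \<le> log 2 (real (card (of_order Q n)))"
      proof -
        have "real (n choose 2) = real n * (real n - 1) / 2"
          by (rule real_choose_two)
        moreover have "real (n choose 2) > 0" using elim by (simp add: binomial_eq_0_iff)
        then have "(c - \<epsilon>) * real (n choose 2) \<le> log 2 (real (card (of_order Q n)))"
          using le by (simp add: pos_le_divide_eq)
        ultimately show ?thesis by (simp only:)
      qed
      moreover have "log 2 (real m) * real n + real (m^2) * log 2 (real n ^ 2 + 1)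
          + (c - \<epsilon>) / 2 * real n < \<epsilon> / 2 * real n ^ 2"
      proof -
        have "(log 2 (real m) * (real n / real n ^ 2) + real (m^2) * (log 2 (real n ^ 2 + 1) / real n ^ 2)
           + (c - \<epsilon>) / 2 * (real n / real n ^ 2)) * real n ^ 2 < \<epsilon> / 2 * real n ^ 2"
          using elim n by (intro mult_strict_right_mono) auto
        then show ?thesis using n by (simp add: distrib_right)
      qed
      ultimately show False
        by (simp add: algebra_simps power2_eq_square) argo
    qed
  qed
qed

subsection \<open>Sampling from a graphon\<close>

lemma space_unit_interval [simp]: "space unit_interval = {0..1}"
  by (simp add: unit_interval_def space_restrict_space)

lemma sets_unit_interval: "sets unit_interval = sets (restrict_space borel {0..1})"
  unfolding unit_interval_def by (rule sets_restrict_space_cong) simp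

lemma emeasure_unit_interval:
  "A \<in> sets borel \<Longrightarrow> A \<subseteq> {0..1} \<Longrightarrow> emeasure unit_interval A = emeasure lborel A"
  unfolding unit_interval_def by (intro emeasure_restrict_space) auto

lemma prob_space_unit_interval: "prob_space unit_interval"
  by (rule prob_spaceI) (simp add: emeasure_unit_interval)

interpretation unit_interval: prob_space unit_interval
  by (rule prob_space_unit_interval)

interpretation unit_cube: product_prob_space "\<lambda>_. unit_interval" UNIV
  by unfold_locales

interpretation unit_square: pair_prob_space unit_interval unit_interval
  by unfold_locales

abbreviation cube :: "nat set \<Rightarrow> (nat \<Rightarrow> real) measure" where
  "cube I \<equiv> PiM I (\<lambda>_. unit_interval)"

abbreviation square :: "(real \<times> real) measure" where
  "square \<equiv> unit_interval \<Otimes>\<^sub>M unit_interval"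

lemma prob_space_cube: "prob_space (cube I)"
  by (rule prob_space_PiM) unfold_locales

lemma measurable_cube_pair:
  "a \<in> I \<Longrightarrow> b \<in> I \<Longrightarrow> (\<lambda>x. (x a, x b)) \<in> measurable (cube I) square"
  by (intro measurable_Pair measurable_component_singleton)

lemma distr_cube_pair:
  assumes "finite I" "a \<in> I" "b \<in> I" "a \<noteq> b"
  shows "distr (cube I) square (\<lambda>x. (x a, x b)) = square"
proof (rule pair_measure_eqI[symmetric])
  fix A B assume AB: "A \<in> sets unit_interval" "B \<in> sets unit_interval"
  interpret P: product_prob_space "\<lambda>_. unit_interval" I by unfold_locales
  have "(\<lambda>x. (x a, x b)) -` (A \<times> B) \<inter> space (cube I)
      = {x \<in> space (cube I). \<forall>i\<in>{a, b}. x i \<in> (if i = a then A else B)}"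
    using assms by auto
  then have "emeasure (distr (cube I) square (\<lambda>x. (x a, x b))) (A \<times> B)
    = emeasure (cube I) {x \<in> space (cube I). \<forall>i\<in>{a, b}. x i \<in> (if i = a then A else B)}"
    using AB assms by (subst emeasure_distr[OF measurable_cube_pair]) auto
  also have "\<dots> = (\<Prod>i\<in>{a, b}. emeasure unit_interval (if i = a then A else B))"
    using AB assms by (intro P.emeasure_PiM_Collect) auto
  also have "\<dots> = emeasure unit_interval A * emeasure unit_interval B"
    using assms by simp
  finally show "emeasure unit_interval A * emeasure unit_interval B
    = emeasure (distr (cube I) square (\<lambda>x. (x a, x b))) (A \<times> B)" ..
qed (auto intro: unit_interval.sigma_finite_measure_axioms)

lemma AE_cube_pair:
  assumes "finite I" "a \<in> I" "b \<in> I" "a \<noteq> b" "AE p in square. P p"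
  shows "AE x in cube I. P (x a, x b)"
  using AE_distrD[OF measurable_cube_pair[OF assms(2,3)], unfolded distr_cube_pair[OF assms(1-4)], OF assms(5)] .

lemma integral_cube_pair:
  fixes f :: "real \<times> real \<Rightarrow> real"
  assumes "finite I" "a \<in> I" "b \<in> I" "a \<noteq> b" "f \<in> borel_measurable square"
  shows "(\<integral>x. f (x a, x b) \<partial>cube I) = (\<integral>p. f p \<partial>square)"
  using integral_distr[OF measurable_cube_pair[OF assms(2,3)] assms(5)]
  by (simp add: distr_cube_pair[OF assms(1-4)])

lemma sum_upairs_integral:
  fixes f :: "real \<times> real \<Rightarrow> real"
  assumes I: "finite I" and f: "f \<in> borel_measurable square"
    and B: "\<And>p. p \<in> space square \<Longrightarrow> \<bar>f p\<bar> \<le> B"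
  shows "integrable (cube I) (\<lambda>x. \<Sum>(u, v)\<in>upairs I. f (x u, x v))"
    and "(\<integral>x. (\<Sum>(u, v)\<in>upairs I. f (x u, x v)) \<partial>cube I) = real (card (upairs I)) * (\<integral>p. f p \<partial>square)"
proof -
  interpret P: prob_space "cube I" by (rule prob_space_cube)
  have int: "integrable (cube I) (\<lambda>x. f (x u, x v))" if "u \<in> I" "v \<in> I" for u v
  proof (rule P.integrable_const_bound[of _ B])
    show "AE x in cube I. norm (f (x u, x v)) \<le> B"
    proof (rule AE_I2)
      fix x assume x: "x \<in> space (cube I)"
      show "norm (f (x u, x v)) \<le> B"
        using measurable_space[OF measurable_cube_pair[OF that] x] B by simp
    qed
    show "(\<lambda>x. f (x u, x v)) \<in> borel_measurable (cube I)"
      using measurable_compose[OF measurable_cube_pair[OF that] f] .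
  qed
  show "integrable (cube I) (\<lambda>x. \<Sum>(u, v)\<in>upairs I. f (x u, x v))"
    unfolding case_prod_unfold by (intro Bochner_Integration.integrable_sum int) (auto simp: upairs_def)
  have "(\<integral>x. (\<Sum>(u, v)\<in>upairs I. f (x u, x v)) \<partial>cube I) = (\<Sum>(u, v)\<in>upairs I. \<integral>x. f (x u, x v) \<partial>cube I)"
    unfolding case_prod_unfold by (intro Bochner_Integration.integral_sum int) (auto simp: upairs_def)
  also have "\<dots> = (\<Sum>(u, v)\<in>upairs I. \<integral>p. f p \<partial>square)"
    using I f by (intro sum.cong refl) (auto simp: upairs_def intro!: integral_cube_pair)
  finally show "(\<integral>x. (\<Sum>(u, v)\<in>upairs I. f (x u, x v)) \<partial>cube I) = real (card (upairs I)) * (\<integral>p. f p \<partial>square)"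
    by (simp add: case_prod_unfold)
qed

lemma card_upairs: "card (upairs {..<n}) = n choose 2"
proof -
  have "real n * real n = 2 * real (card (upairs {..<n})) + real n"
    using sum_square_upairs[of "{..<n}" "\<lambda>_ _. 1"] by simp
  then have "real (card (upairs {..<n})) = real (n choose 2)"
    unfolding real_choose_two by (simp add: algebra_simps)
  then show ?thesis by simp
qed

lemma measurable_graphon: "(\<lambda>p. Rep_graphon W (fst p) (snd p)) \<in> borel_measurable square"
  using Rep_graphon[of W] by (simp add: case_prod_unfold)

lemma graphon_bounds: "x \<in> {0..1} \<Longrightarrow> y \<in> {0..1} \<Longrightarrow> Rep_graphon W x y \<in> {0..1}"
  using Rep_graphon[of W] by blast

definition graphon_bern :: "nat set \<Rightarrow> graphon \<Rightarrow> (nat \<times> nat) set \<Rightarrow> (nat \<Rightarrow> real) \<Rightarrow> real" where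
  "graphon_bern I W A x = bern (upairs I) (\<lambda>(u, v). Rep_graphon W (x u) (x v)) A"

lemma cube_coord: "x \<in> space (cube I) \<Longrightarrow> u \<in> I \<Longrightarrow> x u \<in> {0..1}"
  using PiE_mem[of x I "\<lambda>_. {0..1}" u] by (simp add: space_PiM)

lemma graphon_pair_bounds:
  assumes "x \<in> space (cube I)" "p \<in> upairs I"
  shows "(case p of (u, v) \<Rightarrow> Rep_graphon W (x u) (x v)) \<in> {0..1}"
proof -
  obtain u v where "p = (u, v)" "u \<in> I" "v \<in> I" using assms(2) by (auto simp: upairs_def)
  then show ?thesis using graphon_bounds[OF cube_coord[OF assms(1)] cube_coord[OF assms(1)]] by simp
qed

lemma graphon_bern_bounds:
  assumes "x \<in> space (cube I)"
  shows "0 \<le> graphon_bern I W A x" "graphon_bern I W A x \<le> 1"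
  unfolding graphon_bern_def
  using graphon_pair_bounds[OF assms] by (intro bern_nonneg bern_le_1; blast)+

lemma measurable_graphon_bern: "graphon_bern I W A \<in> borel_measurable (cube I)"
  unfolding graphon_bern_def bern_def
proof (intro borel_measurable_prod)
  fix p assume "p \<in> upairs I"
  then have p: "fst p \<in> I" "snd p \<in> I" by (auto simp: upairs_def)
  have [measurable]: "(\<lambda>x. Rep_graphon W (x (fst p)) (x (snd p))) \<in> borel_measurable (cube I)"
    using measurable_compose[OF measurable_cube_pair[OF p] measurable_graphon[of W]] by simp
  show "(\<lambda>x. if p \<in> A then case p of (u, v) \<Rightarrow> Rep_graphon W (x u) (x v)
      else 1 - (case p of (u, v) \<Rightarrow> Rep_graphon W (x u) (x v))) \<in> borel_measurable (cube I)"
    unfolding case_prod_unfold by (cases "p \<in> A") simp_all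
qed

lemma integrable_graphon_bern: "integrable (cube I) (graphon_bern I W A)"
proof -
  interpret P: prob_space "cube I" by (rule prob_space_cube)
  show ?thesis
    by (rule P.integrable_const_bound[of _ 1])
      (auto intro!: AE_I2 measurable_graphon_bern simp: graphon_bern_bounds)
qed

lemma bern_split:
  assumes "finite P"
  shows "bern P w A = (\<Prod>p\<in>{p \<in> P. p \<in> A}. w p) * (\<Prod>p\<in>{p \<in> P. p \<notin> A}. 1 - w p)"
  unfolding bern_def prod.If_cases[OF assms]
  by (intro arg_cong2[of _ _ _ _ "(*)"] prod.cong) auto

lemma graphon_density_eq:
  "graphon_density H W = (\<integral>x. graphon_bern (verts H) W (edge_pairs H) x \<partial>cube (verts H))"
proof -
  have "{(u, v) \<in> verts H \<times> verts H. u < v \<and> {u, v} \<in> edges H} = {p \<in> upairs (verts H). p \<in> edge_pairs H}"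
    "{(u, v) \<in> verts H \<times> verts H. u < v \<and> {u, v} \<notin> edges H} = {p \<in> upairs (verts H). p \<notin> edge_pairs H}"
    by (auto simp: upairs_def edge_pairs_def)
  then show ?thesis
    unfolding graphon_density_def graphon_bern_def bern_split[OF finite_upairs[OF finite_verts]]
    by (simp add: case_prod_unfold)
qed

lemma graphon_density_labelled:
  assumes "n > 0" "A \<subseteq> upairs {..<n}"
  shows "graphon_density (labelled_graph n A) W = (\<integral>x. graphon_bern {..<n} W A x \<partial>cube {..<n})"
  by (simp add: graphon_density_eq verts_labelled[OF assms] edge_pairs_labelled[OF assms])

lemma neg_mult_ln_bounds:
  assumes "0 \<le> x" "x \<le> (1::real)"
  shows "x * ln x \<le> 0" "x - 1 \<le> x * ln x"
proof -
  show "x * ln x \<le> 0"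
    using assms by (cases "x = 0") (auto intro!: mult_nonneg_nonpos)
  show "x - 1 \<le> x * ln x"
  proof (cases "x = 0")
    case False
    then have x: "x > 0" using assms by simp
    have "ln (1 / x) \<le> 1 / x - 1" using x by (intro ln_le_minus_one) simp
    then have "x * (- ln x) \<le> x * (1 / x - 1)"
      using x by (intro mult_left_mono) (auto simp: ln_div)
    then show ?thesis using x by (simp add: right_diff_distrib)
  qed (use assms in simp)
qed

lemma binary_entropy_bounds:
  assumes "0 \<le> x" "x \<le> 1"
  shows "0 \<le> binary_entropy x" "binary_entropy x \<le> 1 / ln 2"
proof -
  have *: "binary_entropy x = (- (x * ln x) - (1 - x) * ln (1 - x)) / ln 2"
    by (simp add: binary_entropy_def log_def diff_divide_distrib)
  show "0 \<le> binary_entropy x"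
    unfolding * using neg_mult_ln_bounds(1)[of x] neg_mult_ln_bounds(1)[of "1 - x"] assms
    by (intro divide_nonneg_pos) auto
  show "binary_entropy x \<le> 1 / ln 2"
    unfolding * using neg_mult_ln_bounds(2)[of x] neg_mult_ln_bounds(2)[of "1 - x"] assms
    by (intro divide_right_mono) auto
qed

lemma continuous_on_binary_entropy: "continuous_on {0..1} binary_entropy"
proof -
  have *: "continuous_on {0..1} (\<lambda>x::real. x * ln x)"
    unfolding continuous_on_eq_continuous_within
  proof
    fix x :: real assume x: "x \<in> {0..1}"
    show "continuous (at x within {0..1}) (\<lambda>x. x * ln x)"
    proof (cases "x = 0")
      case True
      have "((\<lambda>x::real. x * ln x) \<longlongrightarrow> 0) (at_right 0)" by real_asymp
      moreover have "at 0 within {0..1::real} \<le> at_right 0"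
        by (simp add: at_within_Icc_at_right)
      ultimately show ?thesis
        using True by (auto simp: continuous_within intro: tendsto_mono)
    next
      case False
      then have "isCont (\<lambda>x. x * ln x) x"
        using x by (auto intro!: isCont_mult isCont_ln)
      then show ?thesis by (rule continuous_at_imp_continuous_at_within)
    qed
  qed
  have "continuous_on {0..1} (\<lambda>x::real. (1 - x) * ln (1 - x))"
    by (rule continuous_on_compose2[OF *]) (auto intro!: continuous_intros)
  with * have "continuous_on {0..1} (\<lambda>x::real. (- (x * ln x) - (1 - x) * ln (1 - x)) / ln 2)"
    by (intro continuous_on_divide continuous_on_diff continuous_on_minus continuous_on_const) auto
  then show ?thesis
    by (rule continuous_on_eq) (simp add: binary_entropy_def log_def diff_divide_distrib)
qed

lemma measurable_binary_entropy [measurable]: "binary_entropy \<in> borel_measurable borel"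
  unfolding binary_entropy_def[abs_def] log_def by measurable

lemma measurable_entropy_graphon:
  "(\<lambda>p. binary_entropy (Rep_graphon W (fst p) (snd p))) \<in> borel_measurable square"
  using measurable_compose[OF measurable_graphon measurable_binary_entropy] .

lemma entropy_graphon_bound:
  "p \<in> space square \<Longrightarrow> \<bar>binary_entropy (Rep_graphon W (fst p) (snd p))\<bar> \<le> 1 / ln 2"
  using graphon_bounds[of "fst p" "snd p" W] binary_entropy_bounds
  by (auto simp: space_pair_measure)

lemma graphon_entropy_eq: "graphon_entropy W = (\<integral>p. binary_entropy (Rep_graphon W (fst p) (snd p)) \<partial>square)"
proof -
  have "integrable square (\<lambda>(x, y). binary_entropy (Rep_graphon W x y))"
    using entropy_graphon_bound measurable_entropy_graphon
    by (intro unit_square.P.integrable_const_bound[of _ "1 / ln 2"] AE_I2) (auto simp: case_prod_unfold)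
  from unit_square.integral_snd[OF this] show ?thesis
    unfolding graphon_entropy_def by (simp add: case_prod_unfold)
qed

lemma entropy_sum_upairs:
  assumes "finite I"
  shows "integrable (cube I) (\<lambda>x. \<Sum>(u, v)\<in>upairs I. binary_entropy (Rep_graphon W (x u) (x v)))"
    and "(\<integral>x. (\<Sum>(u, v)\<in>upairs I. binary_entropy (Rep_graphon W (x u) (x v))) \<partial>cube I)
      = real (card (upairs I)) * graphon_entropy W"
  using sum_upairs_integral[OF assms measurable_entropy_graphon entropy_graphon_bound, of W]
  by (simp_all add: graphon_entropy_eq)

lemma bern_entropy_gibbs:
  assumes P: "finite P" "\<And>p. p \<in> P \<Longrightarrow> w p \<in> {0..1}"
    and F: "F \<subseteq> Pow P" "\<And>A. A \<in> Pow P - F \<Longrightarrow> bern P w A = 0"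
    and q: "\<And>A. A \<in> F \<Longrightarrow> 0 < q A" "(\<Sum>A\<in>F. q A) \<le> 1"
  shows "(\<Sum>p\<in>P. binary_entropy (w p)) \<le> (\<Sum>A\<in>F. bern P w A * - log 2 (q A))"
proof -
  have fin: "finite (Pow P)" "finite F" using P F finite_subset[of F "Pow P"] by simp_all
  have "(\<Sum>A\<in>F. bern P w A * log 2 (q A)) \<le> (\<Sum>A\<in>F. bern P w A * log 2 (bern P w A))"
  proof (rule gibbs_inequality[OF fin(2) _ q(1) _ q(2)])
    have "(\<Sum>A\<in>F. bern P w A) = (\<Sum>A\<in>Pow P. bern P w A)"
      using F fin by (intro sum.mono_neutral_left) auto
    then show "(\<Sum>A\<in>F. bern P w A) = 1" using P by (simp add: sum_bern)
  qed (use P in \<open>auto intro: bern_nonneg\<close>)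
  also have "\<dots> = (\<Sum>A\<in>Pow P. bern P w A * log 2 (bern P w A))"
    using F fin by (intro sum.mono_neutral_left) auto
  also have "\<dots> = - (\<Sum>p\<in>P. binary_entropy (w p))"
    by (rule bern_entropy[OF P])
  finally show ?thesis by (simp add: sum_negf)
qed

lemma graphon_entropy_le_log_support:
  assumes n: "n > 0" and F: "F \<subseteq> Pow (upairs {..<n})"
    and zero: "\<And>A. A \<in> Pow (upairs {..<n}) - F \<Longrightarrow> graphon_density (labelled_graph n A) W = 0"
  shows "real (n choose 2) * graphon_entropy W \<le> log 2 (real (card F))"
proof -
  let ?P = "upairs {..<n}" and ?M = "cube {..<n}"
  interpret P: prob_space ?M by (rule prob_space_cube)
  have fin: "finite F" using F by (rule finite_subset) simp
  have "AE x in ?M. graphon_bern {..<n} W A x = 0" if "A \<in> Pow ?P - F" for A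
  proof -
    have "(\<integral>x. graphon_bern {..<n} W A x \<partial>?M) = 0"
      using zero[OF that] that n by (simp add: graphon_density_labelled)
    then show ?thesis
      by (subst (asm) integral_nonneg_eq_0_iff_AE[OF integrable_graphon_bern])
        (auto intro!: AE_I2 graphon_bern_bounds)
  qed
  then have "AE x in ?M. \<forall>A\<in>Pow ?P - F. graphon_bern {..<n} W A x = 0"
    by (intro AE_finite_allI) auto
  then have "AE x in ?M. (\<Sum>(u, v)\<in>?P. binary_entropy (Rep_graphon W (x u) (x v))) \<le> log 2 (real (card F))"
    using AE_space
  proof eventually_elim
    case (elim x)
    let ?w = "\<lambda>(u, v). Rep_graphon W (x u) (x v)"
    have w: "?w p \<in> {0..1}" if "p \<in> ?P" for p
      by (rule graphon_pair_bounds[OF elim(2) that])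
    have zero': "bern ?P ?w A = 0" if "A \<in> Pow ?P - F" for A
      using elim(1) that by (simp add: graphon_bern_def)
    have "(\<Sum>A\<in>F. bern ?P ?w A) = (\<Sum>A\<in>Pow ?P. bern ?P ?w A)"
      using F zero' by (intro sum.mono_neutral_left) auto
    then have one: "(\<Sum>A\<in>F. bern ?P ?w A) = 1" by (simp add: sum_bern)
    then have pos: "real (card F) > 0" using fin by (cases "F = {}") (auto simp: card_gt_0_iff)
    have "(\<Sum>p\<in>?P. binary_entropy (?w p)) \<le> (\<Sum>A\<in>F. bern ?P ?w A * - log 2 (1 / real (card F)))"
      using w F zero' pos by (intro bern_entropy_gibbs) auto
    also have "\<dots> = log 2 (real (card F))"
      using one pos by (simp add: sum_distrib_right[symmetric] log_divide sum_negf)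
    finally show ?case by (simp add: case_prod_unfold)
  qed
  then have "(\<integral>x. (\<Sum>(u, v)\<in>?P. binary_entropy (Rep_graphon W (x u) (x v))) \<partial>?M) \<le> (\<integral>x. log 2 (real (card F)) \<partial>?M)"
    by (intro integral_mono_AE entropy_sum_upairs) auto
  then show ?thesis
    by (simp add: entropy_sum_upairs card_upairs P.prob_space)
qed

subsection \<open>Limits of dyadic block models\<close>

locale dyadic_masses =
  fixes \<mu> :: "nat \<Rightarrow> nat \<Rightarrow> real"
  assumes nonneg: "0 \<le> \<mu> s t"
    and root: "\<mu> 0 0 = 1"
    and split: "t < 2 ^ s \<Longrightarrow> \<mu> s t = \<mu> (Suc s) (2 * t) + \<mu> (Suc s) (2 * t + 1)"
begin

definition cum :: "nat \<Rightarrow> nat \<Rightarrow> real" where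
  "cum s t = (\<Sum>i<t. \<mu> s i)"

text \<open>
  The unit interval is cut into consecutive intervals of lengths \<open>\<mu> s 0, \<mu> s 1, \<dots>\<close>; \<open>ty s x\<close> is the
  index of the interval that contains \<open>x\<close>.
\<close>

definition ty :: "nat \<Rightarrow> real \<Rightarrow> nat" where
  "ty s x = Max {t. t < 2 ^ s \<and> cum s t \<le> x}"

lemma cum_0 [simp]: "cum s 0 = 0"
  and cum_Suc: "cum s (Suc t) = cum s t + \<mu> s t"
  by (simp_all add: cum_def)

lemma cum_mono: "t \<le> t' \<Longrightarrow> cum s t \<le> cum s t'"
  unfolding cum_def by (intro sum_mono2) (auto simp: nonneg)

lemma cum_double: "t \<le> 2 ^ s \<Longrightarrow> cum (Suc s) (2 * t) = cum s t"
proof (induction t)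
  case (Suc t)
  then show ?case using split[of t s] by (simp add: cum_Suc)
qed simp

lemma cum_total: "cum s (2 ^ s) = 1"
proof (induction s)
  case 0
  then show ?case using root by (simp add: cum_Suc[of 0 0, simplified])
next
  case (Suc s)
  then show ?case using cum_double[of "2 ^ s" s] by simp
qed

lemma sum_masses: "(\<Sum>t<2 ^ s. \<mu> s t) = 1"
  using cum_total by (simp add: cum_def)

lemma cum_le_1: "t \<le> 2 ^ s \<Longrightarrow> cum s t \<le> 1"
  using cum_mono[of t "2 ^ s" s] by (simp add: cum_total)

lemma cum_nonneg: "0 \<le> cum s t"
  unfolding cum_def by (intro sum_nonneg nonneg)

lemma
  assumes "0 \<le> x"
  shows ty_less: "ty s x < 2 ^ s" and cum_ty: "cum s (ty s x) \<le> x"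
    and ty_greatest: "t < 2 ^ s \<Longrightarrow> cum s t \<le> x \<Longrightarrow> t \<le> ty s x"
proof -
  let ?S = "{t. t < 2 ^ s \<and> cum s t \<le> x}"
  have fin: "finite ?S" by (rule finite_subset[of _ "{..<2 ^ s}"]) auto
  have "0 \<in> ?S" using assms by simp
  then have "?S \<noteq> {}" by (metis empty_iff)
  then have "ty s x \<in> ?S" unfolding ty_def by (rule Max_in[OF fin])
  then show "ty s x < 2 ^ s" "cum s (ty s x) \<le> x" by auto
  show "t < 2 ^ s \<Longrightarrow> cum s t \<le> x \<Longrightarrow> t \<le> ty s x"
    unfolding ty_def using fin by (intro Max_ge) auto
qed

lemma ty_eq_iff:
  assumes "0 \<le> x" "t < 2 ^ s"
  shows "ty s x = t \<longleftrightarrow> cum s t \<le> x \<and> (Suc t < 2 ^ s \<longrightarrow> x < cum s (Suc t))"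
proof
  assume "ty s x = t"
  then show "cum s t \<le> x \<and> (Suc t < 2 ^ s \<longrightarrow> x < cum s (Suc t))"
    using cum_ty[OF assms(1), of s] ty_greatest[OF assms(1), of "Suc t" s] by force
next
  assume *: "cum s t \<le> x \<and> (Suc t < 2 ^ s \<longrightarrow> x < cum s (Suc t))"
  have "\<not> t < ty s x"
  proof
    assume "t < ty s x"
    then have "Suc t \<le> ty s x" "Suc t < 2 ^ s"
      using ty_less[OF assms(1), of s] by auto
    then show False
      using * cum_mono[of "Suc t" "ty s x" s] cum_ty[OF assms(1), of s] by auto
  qed
  then show "ty s x = t" using ty_greatest[OF assms(1,2)] * by simp
qed

lemma ty_Suc_div: "0 \<le> x \<Longrightarrow> ty (Suc s) x div 2 = ty s x"
proof -
  assume x: "0 \<le> x"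
  let ?t = "ty (Suc s) x"
  have lt: "?t div 2 < 2 ^ s" using ty_less[OF x, of "Suc s"] by auto
  have "cum s (?t div 2) = cum (Suc s) (2 * (?t div 2))"
    using lt by (simp add: cum_double)
  also have "\<dots> \<le> cum (Suc s) ?t" by (rule cum_mono) simp
  also have "\<dots> \<le> x" by (rule cum_ty[OF x])
  finally have 1: "cum s (?t div 2) \<le> x" .
  have 2: "x < cum s (Suc (?t div 2))" if "Suc (?t div 2) < 2 ^ s"
  proof (rule ccontr)
    assume "\<not> ?thesis"
    then have "cum (Suc s) (2 * Suc (?t div 2)) \<le> x"
      using that by (subst cum_double) auto
    then have "2 * Suc (?t div 2) \<le> ?t"
      using that by (intro ty_greatest[OF x]) auto
    then show False by presburger
  qed
  show ?thesis using ty_eq_iff[OF x lt] 1 2 by simp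
qed

lemma ty_div: "0 \<le> x \<Longrightarrow> s \<le> s' \<Longrightarrow> ty s' x div 2 ^ (s' - s) = ty s x"
proof (induction "s' - s" arbitrary: s')
  case (Suc d)
  then obtain s'' where s'': "s' = Suc s''" "s \<le> s''" by (cases s') auto
  then have "ty s'' x div 2 ^ (s'' - s) = ty s x" using Suc by auto
  then show ?case
    using s'' Suc.prems ty_Suc_div[of x s''] by (simp add: Suc_diff_le div_mult2_eq)
qed simp

lemma ty_level_set:
  assumes "t < 2 ^ s"
  shows "{x \<in> {0..1}. ty s x = t} = (if Suc t < 2 ^ s then {cum s t..<cum s (Suc t)} else {cum s t..1})"
    (is "?L = ?R")
proof -
  have "x \<in> ?L \<longleftrightarrow> x \<in> ?R" for x
    using ty_eq_iff[of x t s] assms cum_nonneg[of s t] cum_le_1[of "Suc t" s]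
    by (cases "0 \<le> x") (auto split: if_splits)
  then show ?thesis by blast
qed

lemma measure_ty:
  assumes "t < 2 ^ s"
  shows "{x \<in> {0..1}. ty s x = t} \<in> sets unit_interval"
    and "measure unit_interval {x \<in> {0..1}. ty s x = t} = \<mu> s t"
proof -
  let ?A = "{x \<in> {0..1}. ty s x = t}"
  have b: "?A \<in> sets borel" unfolding ty_level_set[OF assms] by simp
  then show "?A \<in> sets unit_interval"
    unfolding sets_unit_interval by (auto simp: sets_restrict_space_iff)
  have le: "cum s t \<le> cum s (Suc t)" by (rule cum_mono) simp
  have "emeasure unit_interval ?A = emeasure lborel ?A"
    using b by (intro emeasure_unit_interval) auto
  also have "\<dots> = ennreal (\<mu> s t)"
  proof (cases "Suc t < 2 ^ s")
    case True
    then show ?thesis unfolding ty_level_set[OF assms] using le by (simp add: cum_Suc)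
  next
    case False
    then have "Suc t = 2 ^ s" using assms by simp
    then have "cum s (Suc t) = 1" by (simp add: cum_total)
    then have "1 - cum s t = \<mu> s t" "cum s t \<le> 1" using le by (simp_all add: cum_Suc)
    then show ?thesis unfolding ty_level_set[OF assms] using False by simp
  qed
  finally show "measure unit_interval ?A = \<mu> s t"
    by (simp add: measure_def nonneg)
qed

lemma measurable_ty: "ty s \<in> measurable unit_interval (count_space UNIV)"
proof (rule measurable_compose[of "ty s" _ "count_space {..<2 ^ s}"])
  show "ty s \<in> measurable unit_interval (count_space {..<2 ^ s})"
  proof (subst measurable_count_space_eq2, simp, intro conjI ballI)
    show "ty s \<in> space unit_interval \<rightarrow> {..<2 ^ s}" by (auto simp: ty_less)
    fix t :: nat assume "t \<in> {..<2 ^ s}"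
    moreover have "ty s -` {t} \<inter> space unit_interval = {x \<in> {0..1}. ty s x = t}" by auto
    ultimately show "ty s -` {t} \<inter> space unit_interval \<in> sets unit_interval"
      using measure_ty(1) by simp
  qed
qed simp

lemma integral_cube_ty:
  fixes F :: "(nat \<Rightarrow> nat) \<Rightarrow> real"
  assumes I: "finite I"
  shows "(\<integral>x. F (restrict (\<lambda>i. ty s (x i)) I) \<partial>cube I)
    = (\<Sum>\<tau>\<in>PiE I (\<lambda>_. {..<2 ^ s}). F \<tau> * (\<Prod>i\<in>I. \<mu> s (\<tau> i)))"
proof -
  let ?T = "PiE I (\<lambda>_. {..<(2::nat) ^ s})"
  let ?A = "\<lambda>t. {x \<in> {0..1}. ty s x = t}"
  have fin: "finite ?T" using I by (intro finite_PiE) auto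
  have mem: "\<tau> i < 2 ^ s" if "\<tau> \<in> ?T" "i \<in> I" for \<tau> i using that by auto
  have int1: "integrable unit_interval (indicat_real (?A (\<tau> i)))" if "\<tau> \<in> ?T" "i \<in> I" for \<tau> i
    using measure_ty(1)[OF mem[OF that]] unit_interval.emeasure_finite[of "?A (\<tau> i)"]
    by (intro integrable_real_indicator) (simp_all only: less_top infinity_ennreal_def)
  have "(\<integral>x. F (restrict (\<lambda>i. ty s (x i)) I) \<partial>cube I)
    = (\<integral>x. (\<Sum>\<tau>\<in>?T. F \<tau> * (\<Prod>i\<in>I. indicat_real (?A (\<tau> i)) (x i))) \<partial>cube I)"
  proof (rule Bochner_Integration.integral_cong[OF refl])
    fix x assume x: "x \<in> space (cube I)"
    define \<sigma> where "\<sigma> = restrict (\<lambda>i. ty s (x i)) I"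
    have x01: "x i \<in> {0..1}" if "i \<in> I" for i by (rule cube_coord[OF x that])
    have \<tau>: "\<sigma> \<in> ?T" using x01 by (auto simp: ty_less \<sigma>_def)
    have "(\<Prod>i\<in>I. indicat_real (?A (\<tau> i)) (x i)) = of_bool (\<tau> = \<sigma>)" if \<tau>': "\<tau> \<in> ?T" for \<tau>
    proof (cases "\<tau> = \<sigma>")
      case True
      have "(\<Prod>i\<in>I. indicat_real (?A (\<tau> i)) (x i)) = (\<Prod>i\<in>I. 1)"
        using x01 by (intro prod.cong refl) (auto simp: True \<sigma>_def indicator_def)
      then show ?thesis using True by simp
    next
      case False
      then obtain i where "i \<in> I" "\<tau> i \<noteq> ty s (x i)"
        using PiE_ext[OF \<tau>' \<tau>] by (auto simp: \<sigma>_def)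
      then show ?thesis using I False by (auto simp: prod_zero_iff indicator_def intro!: bexI[of _ i])
    qed
    then have "(\<Sum>\<tau>\<in>?T. F \<tau> * (\<Prod>i\<in>I. indicat_real (?A (\<tau> i)) (x i))) = (\<Sum>\<tau>\<in>?T. if \<tau> = \<sigma> then F \<tau> else 0)"
      by (intro sum.cong refl) simp
    also have "\<dots> = F \<sigma>" using fin \<tau> by simp
    finally show "F (restrict (\<lambda>i. ty s (x i)) I) = (\<Sum>\<tau>\<in>?T. F \<tau> * (\<Prod>i\<in>I. indicat_real (?A (\<tau> i)) (x i)))"
      by (simp only: \<sigma>_def)
  qed
  also have "\<dots> = (\<Sum>\<tau>\<in>?T. F \<tau> * (\<integral>x. (\<Prod>i\<in>I. indicat_real (?A (\<tau> i)) (x i)) \<partial>cube I))"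
    using I int1 by (subst Bochner_Integration.integral_sum)
      (auto intro!: integrable_mult_right unit_cube.product_integrable_prod simp: integral_mult_right_zero)
  also have "\<dots> = (\<Sum>\<tau>\<in>?T. F \<tau> * (\<Prod>i\<in>I. \<mu> s (\<tau> i)))"
  proof (rule sum.cong[OF refl])
    fix \<tau> assume \<tau>: "\<tau> \<in> ?T"
    have "(\<integral>x. (\<Prod>i\<in>I. indicat_real (?A (\<tau> i)) (x i)) \<partial>cube I)
       = (\<Prod>i\<in>I. \<integral>y. indicat_real (?A (\<tau> i)) y \<partial>unit_interval)"
      by (rule unit_cube.product_integral_prod[OF I int1[OF \<tau>]])
    also have "\<dots> = (\<Prod>i\<in>I. \<mu> s (\<tau> i))"
    proof (rule prod.cong[OF refl])
      fix i assume i: "i \<in> I"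
      have "?A (\<tau> i) \<inter> space unit_interval = ?A (\<tau> i)" by auto
      then show "(\<integral>y. indicat_real (?A (\<tau> i)) y \<partial>unit_interval) = \<mu> s (\<tau> i)"
        using measure_ty[OF mem[OF \<tau> i]] by simp
    qed
    finally show "F \<tau> * (\<integral>x. (\<Prod>i\<in>I. indicat_real (?A (\<tau> i)) (x i)) \<partial>cube I) = F \<tau> * (\<Prod>i\<in>I. \<mu> s (\<tau> i))"
      by simp
  qed
  finally show ?thesis .
qed

lemma integral_square_ty:
  fixes F :: "nat \<Rightarrow> nat \<Rightarrow> real"
  shows "(\<integral>p. F (ty s (fst p)) (ty s (snd p)) \<partial>square) = (\<Sum>t<2 ^ s. \<Sum>t'<2 ^ s. \<mu> s t * \<mu> s t' * F t t')"
proof -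
  let ?I = "{0, 1::nat}"
  have [measurable]: "ty s \<in> measurable unit_interval (count_space UNIV)" by (rule measurable_ty)
  have m: "(\<lambda>p. F (ty s (fst p)) (ty s (snd p))) \<in> borel_measurable square"
    by measurable
  have "(\<integral>p. F (ty s (fst p)) (ty s (snd p)) \<partial>square) = (\<integral>x. F (ty s (x 0)) (ty s (x 1)) \<partial>cube ?I)"
    using integral_cube_pair[of ?I 0 1, OF _ _ _ _ m] by simp
  also have "\<dots> = (\<integral>x. (\<lambda>\<tau>. F (\<tau> 0) (\<tau> 1)) (restrict (\<lambda>i. ty s (x i)) ?I) \<partial>cube ?I)"
    by simp
  also have "\<dots> = (\<Sum>\<tau>\<in>PiE ?I (\<lambda>_. {..<2 ^ s}). F (\<tau> 0) (\<tau> 1) * (\<Prod>i\<in>?I. \<mu> s (\<tau> i)))"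
    by (rule integral_cube_ty) simp
  also have "\<dots> = (\<Sum>t'<2 ^ s. \<Sum>t<2 ^ s. F t t' * (\<mu> s t * \<mu> s t'))"
    by (subst sum_PiE_insert, simp, subst sum_PiE_insert, simp) simp
  also have "\<dots> = (\<Sum>t<2 ^ s. \<Sum>t'<2 ^ s. \<mu> s t * \<mu> s t' * F t t')"
    by (subst sum.swap) (simp add: mult.commute)
  finally show ?thesis .
qed

end

subsection \<open>Finite graphs as block models\<close>

lemma bounded_family_subseq:
  fixes x :: "nat \<Rightarrow> 'a::countable \<Rightarrow> real"
  assumes "\<And>n i. x n i \<in> {0..1}"
  shows "\<exists>r. strict_mono r \<and> (\<forall>i. convergent (\<lambda>n. x (r n) i))"
proof -
  let ?P = "\<lambda>k (r::nat \<Rightarrow> nat). convergent (\<lambda>n. x (r n) (from_nat k))"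
  interpret subseqs ?P
  proof
    fix k :: nat and s :: "nat \<Rightarrow> nat"
    have "Bseq (\<lambda>n. x (s n) (from_nat k))"
      using assms by (intro BseqI'[of _ 1]) auto
    then have "bounded (range (\<lambda>n. x (s n) (from_nat k)))"
      by (simp add: Bseq_eq_bounded)
    from bounded_imp_convergent_subsequence[OF this]
    obtain l r where "strict_mono r" "((\<lambda>n. x (s n) (from_nat k)) \<circ> r) \<longlonglongrightarrow> l" by blast
    then show "\<exists>r'. strict_mono r' \<and> ?P k (s \<circ> r')"
      by (auto simp: convergent_def comp_def)
  qed
  have *: "?P k (diagseq \<circ> ((+) (Suc k)))" for k
  proof (rule diagseq_holds)
    fix r s :: "nat \<Rightarrow> nat" and k
    assume "strict_mono r" "?P k s"
    then show "?P k (s \<circ> r)"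
      using convergent_subseq_convergent[of "\<lambda>n. x (s n) (from_nat k)" r] by (simp add: comp_def)
  qed
  have "convergent (\<lambda>n. x (diagseq (n + Suc k)) (from_nat k))" for k
    using *[of k] by (simp only: comp_def add.commute[of "Suc k"])
  then have conv: "convergent (\<lambda>n. x (diagseq n) (from_nat k))" for k
    by (subst (asm) convergent_ignore_initial_segment)
  have "convergent (\<lambda>n. x (diagseq n) i)" for i
    using conv[of "to_nat i"] by (simp only: from_nat_to_nat)
  then show ?thesis using subseq_diagseq by blast
qed

definition mass :: "'v set \<Rightarrow> ('v \<Rightarrow> nat) \<Rightarrow> nat \<Rightarrow> real" where
  "mass V \<kappa> t = real (card (colour_class V \<kappa> t)) / real (card V)"

lemma mass_bounds:
  assumes "finite V" shows "0 \<le> mass V \<kappa> t" "mass V \<kappa> t \<le> 1"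
proof -
  have "card (colour_class V \<kappa> t) \<le> card V"
    using assms by (intro card_mono) (auto simp: colour_class_def)
  then show "mass V \<kappa> t \<le> 1"
    by (cases "card V = 0") (simp_all add: mass_def divide_le_eq_1)
qed (simp add: mass_def)

lemma sum_PiE_colours:
  fixes F :: "(nat \<Rightarrow> nat) \<Rightarrow> real"
  assumes I: "finite I" and V: "finite V" and \<kappa>: "\<kappa> \<in> V \<rightarrow> {..<m}"
  shows "(\<Sum>x\<in>PiE I (\<lambda>_. V). F (restrict (\<lambda>i. \<kappa> (x i)) I)) / real (card V) ^ card I
    = (\<Sum>\<tau>\<in>PiE I (\<lambda>_. {..<m}). F \<tau> * (\<Prod>i\<in>I. mass V \<kappa> (\<tau> i)))"
proof -
  let ?g = "\<lambda>x. restrict (\<lambda>i. \<kappa> (x i)) I"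
  have fib: "{x \<in> PiE I (\<lambda>_. V). ?g x = \<tau>} = PiE I (\<lambda>i. colour_class V \<kappa> (\<tau> i))"
    if "\<tau> \<in> PiE I (\<lambda>_. {..<m})" for \<tau>
  proof (intro equalityI subsetI)
    fix x assume "x \<in> PiE I (\<lambda>i. colour_class V \<kappa> (\<tau> i))"
    then show "x \<in> {x \<in> PiE I (\<lambda>_. V). ?g x = \<tau>}"
      using that by (auto simp: PiE_iff colour_class_def extensional_def fun_eq_iff)
  qed (auto simp: PiE_iff colour_class_def)
  have "(\<Sum>x\<in>PiE I (\<lambda>_. V). F (?g x)) = (\<Sum>\<tau>\<in>PiE I (\<lambda>_. {..<m}). \<Sum>x\<in>{x \<in> PiE I (\<lambda>_. V). ?g x = \<tau>}. F (?g x))"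
    using I V \<kappa> by (intro sum.group[symmetric] finite_PiE) auto
  also have "\<dots> = (\<Sum>\<tau>\<in>PiE I (\<lambda>_. {..<m}). F \<tau> * (\<Prod>i\<in>I. real (card (colour_class V \<kappa> (\<tau> i)))))"
  proof (rule sum.cong[OF refl])
    fix \<tau> assume \<tau>: "\<tau> \<in> PiE I (\<lambda>_. {..<m})"
    have "(\<Sum>x\<in>{x \<in> PiE I (\<lambda>_. V). ?g x = \<tau>}. F (?g x)) = (\<Sum>x\<in>{x \<in> PiE I (\<lambda>_. V). ?g x = \<tau>}. F \<tau>)"
      by (intro sum.cong) auto
    then show "(\<Sum>x\<in>{x \<in> PiE I (\<lambda>_. V). ?g x = \<tau>}. F (?g x)) = F \<tau> * (\<Prod>i\<in>I. real (card (colour_class V \<kappa> (\<tau> i))))"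
      unfolding fib[OF \<tau>] using I by (simp add: card_PiE mult.commute)
  qed
  finally show ?thesis
    by (simp add: mass_def prod_dividef sum_divide_distrib)
qed

lemma sum_square_colours:
  fixes F :: "nat \<Rightarrow> nat \<Rightarrow> real"
  assumes V: "finite V" and \<kappa>: "\<kappa> \<in> V \<rightarrow> {..<m}"
  shows "(\<Sum>v\<in>V. \<Sum>w\<in>V. F (\<kappa> v) (\<kappa> w)) / (real (card V))\<^sup>2
    = (\<Sum>t<m. \<Sum>t'<m. mass V \<kappa> t * mass V \<kappa> t' * F t t')"
proof -
  have *: "(\<Sum>v\<in>V. g (\<kappa> v)) = (\<Sum>t<m. real (card (colour_class V \<kappa> t)) * g t)" for g :: "nat \<Rightarrow> real"
  proof -
    have "(\<Sum>v\<in>V. g (\<kappa> v)) = (\<Sum>t<m. \<Sum>v\<in>{v \<in> V. \<kappa> v = t}. g (\<kappa> v))"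
      using V \<kappa> by (intro sum.group[symmetric]) auto
    then show ?thesis by (simp add: colour_class_def)
  qed
  have "(\<Sum>v\<in>V. \<Sum>w\<in>V. F (\<kappa> v) (\<kappa> w))
      = (\<Sum>t<m. real (card (colour_class V \<kappa> t)) * (\<Sum>t'<m. real (card (colour_class V \<kappa> t')) * F t t'))"
    unfolding * by (simp add: *[of "\<lambda>t. \<Sum>t'<m. real (card (colour_class V \<kappa> t')) * F t t'"])
  then show ?thesis
    by (simp add: mass_def sum_divide_distrib sum_distrib_left power2_eq_square mult_ac)
qed

lemma map_density_colours:
  assumes I: "finite I" and V: "finite V" and \<kappa>: "\<kappa> \<in> V \<rightarrow> {..<m}"
  shows "map_density I V (block_avg V E \<kappa>) B
    = (\<Sum>\<tau>\<in>PiE I (\<lambda>_. {..<m}). bern (upairs I) (\<lambda>(u, v). block_density V E \<kappa> (\<tau> u) (\<tau> v)) B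
        * (\<Prod>i\<in>I. mass V \<kappa> (\<tau> i)))"
proof -
  have "bern (upairs I) (\<lambda>(u, v). block_avg V E \<kappa> (x u) (x v)) B
    = bern (upairs I) (\<lambda>(u, v). block_density V E \<kappa> (restrict (\<lambda>i. \<kappa> (x i)) I u) (restrict (\<lambda>i. \<kappa> (x i)) I v)) B" for x
    unfolding bern_def by (intro prod.cong refl) (auto simp: upairs_def)
  then show ?thesis
    unfolding map_density_def by (simp add: sum_PiE_colours[OF I V \<kappa>, symmetric])
qed

lemma colouring_entropy_colours:
  assumes "finite V" "\<kappa> \<in> V \<rightarrow> {..<m}"
  shows "colouring_entropy V E \<kappa>
    = (\<Sum>t<m. \<Sum>t'<m. mass V \<kappa> t * mass V \<kappa> t' * binary_entropy (block_density V E \<kappa> t t'))"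
  unfolding colouring_entropy_def by (rule sum_square_colours[OF assms])

lemma energy_colours:
  assumes "finite V" "\<kappa> \<in> V \<rightarrow> {..<m}"
  shows "energy V E \<kappa> = (\<Sum>t<m. \<Sum>t'<m. mass V \<kappa> t * mass V \<kappa> t' * (block_density V E \<kappa> t t')\<^sup>2)"
  unfolding energy_def by (rule sum_square_colours[OF assms])

lemma energy_diff_colours:
  assumes V: "finite V" "V \<noteq> {}" and \<kappa>: "\<kappa>' \<in> V \<rightarrow> {..<m}" and g: "\<And>v. v \<in> V \<Longrightarrow> \<kappa> v = g (\<kappa>' v)"
  shows "energy V E \<kappa>' - energy V E \<kappa> = (\<Sum>t<m. \<Sum>t'<m. mass V \<kappa>' t * mass V \<kappa>' t' *
    (block_density V E \<kappa>' t t' - block_density V E \<kappa> (g t) (g t'))\<^sup>2)"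
proof -
  have ref: "refines V \<kappa>' \<kappa>" using g by (simp add: refines_def)
  have "energy V E \<kappa>' - energy V E \<kappa>
      = (\<Sum>v\<in>V. \<Sum>w\<in>V. (block_avg V E \<kappa>' v w - block_avg V E \<kappa> v w)\<^sup>2) / (real (card V))\<^sup>2"
    unfolding energy_diff[OF V(1) ref] using V by simp
  also have "\<dots> = (\<Sum>v\<in>V. \<Sum>w\<in>V. (\<lambda>t t'. (block_density V E \<kappa>' t t' - block_density V E \<kappa> (g t) (g t'))\<^sup>2) (\<kappa>' v) (\<kappa>' w))
      / (real (card V))\<^sup>2"
    by (simp add: g)
  also have "\<dots> = (\<Sum>t<m. \<Sum>t'<m. mass V \<kappa>' t * mass V \<kappa>' t' *
    (block_density V E \<kappa>' t t' - block_density V E \<kappa> (g t) (g t'))\<^sup>2)"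
    by (rule sum_square_colours[OF V(1) \<kappa>])
  finally show ?thesis .
qed

text \<open>
  The number of vertices that make a colouring regular with \<open>k = j\<close> and \<open>\<epsilon> = 1 / (j + 1)\<close> in every graph.
\<close>

fun blen :: "nat \<Rightarrow> nat" where
  "blen 0 = 1"
| "blen (Suc j) = blen j + Suc j * Suc (Suc j)"

lemma blen_greater: "j < blen j"
  by (induction j) auto

lemma blen_mono: "j \<le> j' \<Longrightarrow> blen j \<le> blen j'"
  by (induction rule: dec_induct) auto

abbreviation seqcode :: "('v \<Rightarrow> 'v \<Rightarrow> bool) \<Rightarrow> (nat \<Rightarrow> 'v) \<Rightarrow> nat \<Rightarrow> 'v \<Rightarrow> nat" where
  "seqcode E u s \<equiv> code E (map u [0..<s])"

lemma seqcode_less: "seqcode E u s v < 2 ^ s"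
  using code_less[of E "map u [0..<s]" v] by simp

lemma seqcode_div: "s \<le> s' \<Longrightarrow> seqcode E u s' v div 2 ^ (s' - s) = seqcode E u s v"
  using code_append_div[of E "map u [0..<s]" "map u [s..<s']" v] upt_add_eq_append[of 0 s "s' - s"]
  by simp

lemma ex_regular_sequence:
  assumes V: "finite V" "V \<noteq> {}"
  shows "\<exists>u. range u \<subseteq> V \<and> (\<forall>j. regular V E j (1 / real (Suc j)) (map u [0..<blen j]))"
proof -
  obtain v0 where v0: "v0 \<in> V" using V by blast
  let ?P = "\<lambda>j us. set us \<subseteq> V \<and> us \<noteq> [] \<and> length us = blen j \<and> regular V E j (1 / real (Suc j)) us"
  let ?Q = "\<lambda>(j::nat) us us'. \<exists>ws. us' = us @ ws"
  have "\<exists>f. \<forall>j. ?P j (f j) \<and> ?Q j (f j) (f (Suc j))"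
  proof (rule dependent_nat_choice)
    show "\<exists>us. ?P 0 us"
      using v0 by (intro exI[of _ "[v0]"]) (simp add: regular_def)
    fix us j assume us: "?P j us"
    then obtain us' where "set us' \<subseteq> V" "length us' = Suc j * Suc (Suc j)"
      "regular V E (Suc j) (1 / real (Suc (Suc j))) (us @ us')"
      using ex_regular[OF V, of us "Suc (Suc j)", where E = E and k = "Suc j"] by blast
    then have "?P (Suc j) (us @ us')" using us by simp
    then show "\<exists>us'. ?P (Suc j) us' \<and> ?Q j us us'" by blast
  qed
  then obtain f where f: "\<And>j. ?P j (f j)" "\<And>j. ?Q j (f j) (f (Suc j))" by blast
  have nth: "f j' ! i = f j ! i" if "j \<le> j'" "i < blen j" for i j j'
    using that(1)
  proof (induction rule: dec_induct)
    case (step k)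
    have "i < length (f k)" using that(2) f(1)[of k] blen_mono[OF step(1)] by simp
    moreover obtain ws where "f (Suc k) = f k @ ws" using f(2)[of k] by blast
    ultimately show ?case using step by (simp add: nth_append)
  qed simp
  define u where "u i = f i ! i" for i
  have map: "map u [0..<blen j] = f j" for j
  proof (rule nth_equalityI)
    show "length (map u [0..<blen j]) = length (f j)" using f(1)[of j] by simp
    fix i assume "i < length (map u [0..<blen j])"
    then have i: "i < blen j" by simp
    then have "u i = f j ! i"
      using nth[of i j i] nth[of j i i] blen_greater[of i] unfolding u_def
      by (cases "i \<le> j") auto
    then show "map u [0..<blen j] ! i = f j ! i" using i by simp
  qed
  have "u i \<in> V" for i
    using f(1)[of i] blen_greater[of i] nth_mem[of i "f i"] unfolding u_def by auto
  then show ?thesis using map f(1) by (intro exI[of _ u]) auto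
qed

lemma bern_of_bool:
  assumes "finite P"
  shows "bern P (\<lambda>p. of_bool (R p)) B = of_bool (\<forall>p\<in>P. R p \<longleftrightarrow> p \<in> B)"
proof (cases "\<forall>p\<in>P. R p \<longleftrightarrow> p \<in> B")
  case True
  then have "bern P (\<lambda>p. of_bool (R p)) B = (\<Prod>p\<in>P. 1)"
    unfolding bern_def by (intro prod.cong refl) auto
  then show ?thesis using True by simp
next
  case False
  then obtain p where "p \<in> P" "R p \<noteq> (p \<in> B)" by blast
  then have "bern P (\<lambda>p. of_bool (R p)) B = 0"
    unfolding bern_def using assms by (intro prod_zero bexI[of _ p]) auto
  then show ?thesis using False by simp
qed

lemma preserves_adjacency_iff:
  "preserves_adjacency H G x \<longleftrightarrow> (\<forall>p\<in>upairs (verts H). (case p of (u, v) \<Rightarrow> adj G (x u) (x v)) \<longleftrightarrow> p \<in> edge_pairs H)"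
proof
  assume "preserves_adjacency H G x"
  then show "\<forall>p\<in>upairs (verts H). (case p of (u, v) \<Rightarrow> adj G (x u) (x v)) \<longleftrightarrow> p \<in> edge_pairs H"
    by (auto simp: preserves_adjacency_def upairs_def edge_pairs_def)
next
  assume *: "\<forall>p\<in>upairs (verts H). (case p of (u, v) \<Rightarrow> adj G (x u) (x v)) \<longleftrightarrow> p \<in> edge_pairs H"
  show "preserves_adjacency H G x"
    unfolding preserves_adjacency_def
  proof (intro ballI impI)
    fix u v assume uv: "u \<in> verts H" "v \<in> verts H" "u \<noteq> v"
    show "adj H u v \<longleftrightarrow> adj G (x u) (x v)"
    proof (cases "u < v")
      case True
      then show ?thesis using *[rule_format, of "(u, v)"] uv by (simp add: upairs_def edge_pairs_def)
    next
      case False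
      then show ?thesis using *[rule_format, of "(v, u)"] uv
        by (simp add: upairs_def edge_pairs_def insert_commute)
    qed
  qed
qed

lemma induced_density_map_density:
  assumes "card (upairs (verts H)) < card (verts G)"
  shows "\<bar>induced_density H G - map_density (verts H) (verts G) (\<lambda>v w. of_bool (adj G v w)) (edge_pairs H)\<bar>
    \<le> real (card (upairs (verts H))) / real (card (verts G))"
proof -
  let ?I = "verts H" and ?V = "verts G"
  let ?T = "PiE ?I (\<lambda>_. ?V)" and ?J = "{\<phi> \<in> ?I \<rightarrow>\<^sub>E ?V. inj_on \<phi> ?I}" and ?R = "{\<phi>. preserves_adjacency H G \<phi>}"
  define N where "N = card ?V"
  define P where "P = card (upairs ?I)"
  have fin: "finite ?T" by (intro finite_PiE) auto
  then have finJ: "finite ?J" by auto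
  have N: "N > 0" by (simp add: N_def card_gt_0_iff)
  have k: "card ?I > 0" by (simp add: card_gt_0_iff)
  have T: "real (card ?T) = real N ^ card ?I" by (simp add: card_PiE N_def)
  have coll: "card {x \<in> ?T. x u = x v} \<le> N ^ (card ?I - 1)" if "(u, v) \<in> upairs ?I" for u v
  proof -
    have uv: "u \<in> ?I" "v \<in> ?I" "u \<noteq> v" using that by (auto simp: upairs_def)
    have "card {x \<in> ?T. x u = x v} \<le> card (PiE (?I - {v}) (\<lambda>_. ?V))"
    proof (rule card_inj_on_le[of "\<lambda>x. restrict x (?I - {v})"])
      show "inj_on (\<lambda>x. restrict x (?I - {v})) {x \<in> ?T. x u = x v}"
      proof (rule inj_onI)
        fix x y assume xy: "x \<in> {x \<in> ?T. x u = x v}" "y \<in> {x \<in> ?T. x u = x v}"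
          "restrict x (?I - {v}) = restrict y (?I - {v})"
        have eq: "x i = y i" if "i \<in> ?I - {v}" for i
          using fun_cong[OF xy(3), of i] that by simp
        then have "x v = y v" using xy(1,2) uv by (metis (mono_tags, lifting) DiffI mem_Collect_eq singletonD)
        then show "x = y" using eq xy(1,2) by (intro PiE_ext[of x ?I "\<lambda>_. ?V"]) auto
      qed
      show "finite (PiE (?I - {v}) (\<lambda>_. ?V))" by (intro finite_PiE) auto
    qed (auto simp: restrict_PiE_iff split: if_splits)
    then show ?thesis using uv by (simp add: card_PiE N_def)
  qed
  have "?T - ?J \<subseteq> (\<Union>(u, v)\<in>upairs ?I. {x \<in> ?T. x u = x v})"
  proof
    fix x assume x: "x \<in> ?T - ?J"
    then obtain u v where "u \<in> ?I" "v \<in> ?I" "x u = x v" "u \<noteq> v" by (auto simp: inj_on_def)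
    then have "(u, v) \<in> upairs ?I \<or> (v, u) \<in> upairs ?I" by (auto simp: upairs_def)
    then show "x \<in> (\<Union>(u, v)\<in>upairs ?I. {x \<in> ?T. x u = x v})"
    proof
      assume "(u, v) \<in> upairs ?I"
      then show ?thesis using x \<open>x u = x v\<close> by (intro UN_I[of "(u, v)"]) auto
    next
      assume "(v, u) \<in> upairs ?I"
      then show ?thesis using x \<open>x u = x v\<close> by (intro UN_I[of "(v, u)"]) auto
    qed
  qed
  then have "card (?T - ?J) \<le> card (\<Union>(u, v)\<in>upairs ?I. {x \<in> ?T. x u = x v})"
    using fin by (intro card_mono) auto
  also have "\<dots> \<le> (\<Sum>(u, v)\<in>upairs ?I. card {x \<in> ?T. x u = x v})"
    using card_UN_le[of "upairs ?I" "\<lambda>p. {x \<in> ?T. x (fst p) = x (snd p)}"] by (simp add: case_prod_unfold)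
  also have "\<dots> \<le> (\<Sum>(u, v)\<in>upairs ?I. N ^ (card ?I - 1))"
    using coll by (intro sum_mono) auto
  finally have nonJ: "card (?T - ?J) \<le> P * N ^ (card ?I - 1)" by (simp add: P_def case_prod_unfold)
  have TJ: "card ?T = card ?J + card (?T - ?J)"
  proof -
    have sub: "?J \<subseteq> ?T" by auto
    show ?thesis using card_Diff_subset[OF finJ sub] card_mono[OF fin sub] by linarith
  qed
  have "real (card (?T - ?J)) \<le> real P * real N ^ (card ?I - 1)"
    using nonJ of_nat_mono[OF nonJ, where 'a = real] by simp
  also have "\<dots> = real P / real N * real (card ?T)"
    using N k unfolding T by (cases "card ?I") auto
  finally have ratio: "real (card (?T - ?J)) / real (card ?T) \<le> real P / real N"
    using N by (simp add: T pos_divide_le_eq)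
  have Tpos: "real (card ?T) > 0" using N by (simp add: T)
  have "real P / real N < 1" using assms N by (simp add: P_def N_def)
  then have "real (card (?T - ?J)) / real (card ?T) < 1" using ratio by linarith
  then have Jpos: "real (card ?J) > 0" using TJ Tpos by (simp add: divide_less_eq)
  then have "?J \<noteq> {}" by (metis card.empty less_irrefl of_nat_0)
  then have ind: "induced_density H G = real (card (?J \<inter> ?R)) / real (card ?J)"
    unfolding induced_density_def by (rule measure_pmf_of_set[OF _ finJ])
  have "map_density ?I ?V (\<lambda>v w. of_bool (adj G v w)) (edge_pairs H)
    = (\<Sum>x\<in>?T. of_bool (preserves_adjacency H G x)) / real (card ?T)"
    unfolding map_density_def T N_def[symmetric] preserves_adjacency_iff
      bern_of_bool[OF finite_upairs[OF finite_verts], symmetric]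
    by (simp add: case_prod_unfold)
  also have "(\<Sum>x\<in>?T. of_bool (preserves_adjacency H G x)) = real (card (?T \<inter> ?R))"
    using fin by (simp add: sum_of_bool_eq)
  finally have md: "map_density ?I ?V (\<lambda>v w. of_bool (adj G v w)) (edge_pairs H) = real (card (?T \<inter> ?R)) / real (card ?T)" .
  define a b j d t where "a = real (card (?J \<inter> ?R))" and "b = real (card (?T \<inter> ?R))"
    and "j = real (card ?J)" and "d = real (card (?T - ?J))" and "t = real (card ?T)"
  have ab: "a \<le> b" unfolding a_def b_def using fin by (intro of_nat_mono card_mono) auto
  have aj: "a \<le> j" unfolding a_def j_def using finJ by (intro of_nat_mono card_mono) auto
  have "card (?T \<inter> ?R) \<le> card ((?J \<inter> ?R) \<union> (?T - ?J))"
    using fin by (intro card_mono) auto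
  also have "\<dots> \<le> card (?J \<inter> ?R) + card (?T - ?J)" by (rule card_Un_le)
  finally have bad: "b \<le> a + d" by (simp add: a_def b_def d_def)
  have tjd: "t = j + d" using TJ by (simp add: t_def j_def d_def)
  have pos: "j > 0" "t > 0" "a \<ge> 0" "d \<ge> 0" using Jpos Tpos by (simp_all add: j_def t_def a_def d_def)
  have "\<bar>a / j - b / t\<bar> \<le> d / t"
  proof -
    have "a / j - a / t = (a / j) * (d / t)"
      using pos by (simp add: field_simps tjd)
    also have "\<dots> \<le> 1 * (d / t)" using pos aj by (intro mult_right_mono) auto
    finally have 1: "a / j - a / t \<le> d / t" by simp
    have 2: "a / t \<le> b / t" using ab pos by (simp add: divide_right_mono)
    have 3: "b / t \<le> a / t + d / t" using bad pos by (simp add: add_divide_distrib[symmetric] divide_right_mono)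
    have 4: "a / t \<le> a / j" using pos tjd by (intro divide_left_mono) auto
    show ?thesis using 1 2 3 4 by linarith
  qed
  then show ?thesis
    unfolding ind md using ratio by (simp add: a_def b_def j_def d_def t_def P_def N_def)
qed

locale dyadic_graphon = dyadic_masses +
  fixes d :: "nat \<Rightarrow> nat \<Rightarrow> nat \<Rightarrow> real"
  assumes d_bounds: "d s t t' \<in> {0..1}"
    and d_sym: "d s t t' = d s t' t"
    and energy_increment: "s \<le> s' \<Longrightarrow>
      (\<Sum>t<2 ^ s'. \<Sum>t'<2 ^ s'. \<mu> s' t * \<mu> s' t' *
        (d s' t t' - d s (t div 2 ^ (s' - s)) (t' div 2 ^ (s' - s)))\<^sup>2)
      = (\<Sum>t<2 ^ s'. \<Sum>t'<2 ^ s'. \<mu> s' t * \<mu> s' t' * (d s' t t')\<^sup>2)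
        - (\<Sum>t<2 ^ s. \<Sum>t'<2 ^ s. \<mu> s t * \<mu> s t' * (d s t t')\<^sup>2)"
begin

definition step :: "nat \<Rightarrow> real \<times> real \<Rightarrow> real" where
  "step s p = d s (ty s (fst p)) (ty s (snd p))"

definition step_energy :: "nat \<Rightarrow> real" where
  "step_energy s = (\<Sum>t<2 ^ s. \<Sum>t'<2 ^ s. \<mu> s t * \<mu> s t' * (d s t t')\<^sup>2)"

lemma measurable_step [measurable]: "step s \<in> borel_measurable square"
proof -
  have [measurable]: "ty s \<in> measurable unit_interval (count_space UNIV)" by (rule measurable_ty)
  have "(\<lambda>p. d s (ty s (fst p)) (ty s (snd p))) \<in> borel_measurable square" by measurable
  then show ?thesis by (simp add: step_def[abs_def])
qed

lemma step_bounds: "0 \<le> step s p" "step s p \<le> 1"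
  using d_bounds by (auto simp: step_def)

lemma step_diff_bound: "\<bar>step s' p - step s p\<bar> \<le> 1"
  using step_bounds[of s p] step_bounds[of s' p] by linarith

lemma integrable_step_diff:
  "integrable square (\<lambda>p. \<bar>step s' p - step s p\<bar>)"
  "integrable square (\<lambda>p. (step s' p - step s p)\<^sup>2)"
proof -
  show "integrable square (\<lambda>p. \<bar>step s' p - step s p\<bar>)"
    using step_diff_bound by (intro unit_square.P.integrable_const_bound[of _ 1] AE_I2) auto
  show "integrable square (\<lambda>p. (step s' p - step s p)\<^sup>2)"
    using step_diff_bound[of s' _ s]
    by (intro unit_square.P.integrable_const_bound[of _ 1] AE_I2) (auto simp: abs_square_le_1)
qed

lemma integral_step_diff_square:
  assumes "s \<le> s'"
  shows "(\<integral>p. (step s' p - step s p)\<^sup>2 \<partial>square) = step_energy s' - step_energy s"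
proof -
  have "(\<integral>p. (step s' p - step s p)\<^sup>2 \<partial>square)
    = (\<integral>p. (\<lambda>t t'. (d s' t t' - d s (t div 2 ^ (s' - s)) (t' div 2 ^ (s' - s)))\<^sup>2)
          (ty s' (fst p)) (ty s' (snd p)) \<partial>square)"
    by (intro Bochner_Integration.integral_cong refl)
      (auto simp: step_def space_pair_measure ty_div[OF _ assms])
  also have "\<dots> = step_energy s' - step_energy s"
    unfolding integral_square_ty[of "\<lambda>t t'. (d s' t t' - d s (t div 2 ^ (s' - s)) (t' div 2 ^ (s' - s)))\<^sup>2" s']
      energy_increment[OF assms] step_energy_def ..
  finally show ?thesis .
qed

lemma step_energy_mono: "s \<le> s' \<Longrightarrow> step_energy s \<le> step_energy s'"
  using integral_step_diff_square[of s s'] integral_nonneg_AE[of "\<lambda>p. (step s' p - step s p)\<^sup>2" square]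
  by simp

lemma step_energy_le_1: "step_energy s \<le> 1"
proof -
  have "step_energy s \<le> (\<Sum>t<2 ^ s. \<Sum>t'<2 ^ s. \<mu> s t * \<mu> s t')"
    unfolding step_energy_def
  proof (intro sum_mono)
    fix t t'
    have "(d s t t')\<^sup>2 \<le> 1" using d_bounds[of s t t'] by (simp add: abs_square_le_1)
    then show "\<mu> s t * \<mu> s t' * (d s t t')\<^sup>2 \<le> \<mu> s t * \<mu> s t'"
      by (intro mult_left_le mult_nonneg_nonneg nonneg)
  qed
  also have "\<dots> = (\<Sum>t<2 ^ s. \<mu> s t) * (\<Sum>t<2 ^ s. \<mu> s t)"
    by (rule sum_product[symmetric])
  finally show ?thesis by (simp add: sum_masses)
qed

lemma integral_step_diff_le:
  assumes "s \<le> s'" "step_energy s' - step_energy s \<le> a\<^sup>2" "a > 0"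
  shows "(\<integral>p. \<bar>step s' p - step s p\<bar> \<partial>square) \<le> a"
proof -
  have le: "\<bar>y\<bar> \<le> a / 2 + y\<^sup>2 / (2 * a)" for y
  proof -
    have "0 \<le> (\<bar>y\<bar> - a)\<^sup>2" by simp
    then have "2 * a * \<bar>y\<bar> \<le> a\<^sup>2 + y\<^sup>2" by (simp add: power2_diff mult_ac)
    then have "\<bar>y\<bar> \<le> (a\<^sup>2 + y\<^sup>2) / (2 * a)"
      using assms(3) by (simp add: pos_le_divide_eq mult_ac)
    also have "\<dots> = a / 2 + y\<^sup>2 / (2 * a)"
      using assms(3) by (simp add: add_divide_distrib power2_eq_square)
    finally show ?thesis .
  qed
  have "(\<integral>p. \<bar>step s' p - step s p\<bar> \<partial>square) \<le> (\<integral>p. a / 2 + (step s' p - step s p)\<^sup>2 / (2 * a) \<partial>square)"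
    by (intro integral_mono le integrable_step_diff Bochner_Integration.integrable_add integrable_divide_zero)
      auto
  also have "\<dots> = a / 2 + (step_energy s' - step_energy s) / (2 * a)"
    using integrable_step_diff(2)[of s' s]
    by (simp add: integral_step_diff_square[OF assms(1)] unit_square.P.prob_space)
  also have "\<dots> \<le> a / 2 + a\<^sup>2 / (2 * a)"
    using assms(2,3) by (intro add_left_mono divide_right_mono) auto
  also have "\<dots> = a" using assms(3) by (simp add: power2_eq_square)
  finally show ?thesis .
qed

lemma ex_fast_levels:
  fixes L :: "nat \<Rightarrow> nat"
  assumes L: "strict_mono L"
  shows "\<exists>r. strict_mono r \<and> (\<forall>i. step_energy (L (r (Suc i))) - step_energy (L (r i)) \<le> ((1 / 2) ^ i)\<^sup>2)"
proof -
  have inc: "incseq step_energy" by (simp add: incseq_def step_energy_mono)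
  obtain q where q: "step_energy \<longlonglongrightarrow> q" "\<And>s. step_energy s \<le> q"
    using incseq_convergent[OF inc] step_energy_le_1 by metis
  have "\<exists>r. \<forall>i. q - step_energy (L (r i)) \<le> ((1 / 2) ^ i)\<^sup>2 \<and> r i < r (Suc i)"
  proof (rule dependent_nat_choice)
    have *: "\<exists>y>x. q - step_energy (L y) \<le> ((1 / 2) ^ i)\<^sup>2" for x i :: nat
    proof -
      have "(\<lambda>y. step_energy (L y)) \<longlonglongrightarrow> q"
        using LIMSEQ_subseq_LIMSEQ[OF q(1) L] by (simp add: comp_def)
      then have "\<forall>\<^sub>F y in sequentially. q - ((1 / 2) ^ i)\<^sup>2 < step_energy (L y)"
        by (intro order_tendstoD(1)) auto
      then have "\<forall>\<^sub>F y in sequentially. q - ((1 / 2) ^ i)\<^sup>2 < step_energy (L y) \<and> x < y"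
        using eventually_gt_at_top by (rule eventually_conj)
      then obtain y where "q - ((1 / 2) ^ i)\<^sup>2 < step_energy (L y)" "x < y"
        by (auto dest: eventually_happens)
      then show ?thesis by (intro exI[of _ y]) simp
    qed
    show "\<exists>x. q - step_energy (L x) \<le> ((1 / 2) ^ 0)\<^sup>2" using *[of 0 0] by blast
    show "\<exists>y. q - step_energy (L y) \<le> ((1 / 2) ^ Suc i)\<^sup>2 \<and> x < y" for x i
      using *[of x "Suc i"] by blast
  qed
  then obtain r where r: "\<And>i. q - step_energy (L (r i)) \<le> ((1 / 2) ^ i)\<^sup>2" "\<And>i. r i < r (Suc i)"
    by blast
  have "step_energy (L (r (Suc i))) - step_energy (L (r i)) \<le> ((1 / 2) ^ i)\<^sup>2" for i
    using r(1)[of i] q(2)[of "L (r (Suc i))"] by linarith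
  then show ?thesis using r(2) by (auto intro!: exI[of _ r] strict_mono_Suc_iff[THEN iffD2])
qed

lemma ex_limit_graphon:
  fixes L :: "nat \<Rightarrow> nat"
  assumes L: "strict_mono L"
  shows "\<exists>r W. strict_mono r \<and>
    (AE p in square. (\<lambda>i. step (L (r i)) p) \<longlonglongrightarrow> Rep_graphon W (fst p) (snd p))"
proof -
  obtain r where r: "strict_mono r"
    "\<And>i. step_energy (L (r (Suc i))) - step_energy (L (r i)) \<le> ((1 / 2) ^ i)\<^sup>2"
    using ex_fast_levels[OF L] by blast
  define f where "f i p = step (L (r (Suc i))) p - step (L (r i)) p" for i p
  have [measurable]: "f i \<in> borel_measurable square" for i
    unfolding f_def[abs_def] by measurable
  have mono: "L (r i) \<le> L (r (Suc i))" for i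
    by (intro monoD[OF strict_mono_mono[OF L]] monoD[OF strict_mono_mono[OF r(1)]]) simp
  have int: "(\<integral>p. \<bar>f i p\<bar> \<partial>square) \<le> (1 / 2) ^ i" for i
    unfolding f_def by (rule integral_step_diff_le[OF mono r(2)]) simp
  have "(\<integral>\<^sup>+p. (\<Sum>i. ennreal \<bar>f i p\<bar>) \<partial>square) = (\<Sum>i. \<integral>\<^sup>+p. ennreal \<bar>f i p\<bar> \<partial>square)"
    by (rule nn_integral_suminf) measurable
  also have "\<dots> \<le> (\<Sum>i. ennreal ((1 / 2) ^ i))"
  proof (rule suminf_le)
    fix i
    have "(\<integral>\<^sup>+p. ennreal \<bar>f i p\<bar> \<partial>square) = ennreal (\<integral>p. \<bar>f i p\<bar> \<partial>square)"
      by (rule nn_integral_eq_integral) (use integrable_step_diff in \<open>auto simp: f_def\<close>)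
    then show "(\<integral>\<^sup>+p. ennreal \<bar>f i p\<bar> \<partial>square) \<le> ennreal ((1 / 2) ^ i)"
      using int[of i] by (simp add: ennreal_leI)
  qed auto
  also have "\<dots> = ennreal (\<Sum>i. (1 / 2) ^ i)"
    by (rule suminf_ennreal2) (auto intro: summable_geometric)
  also have "\<dots> < \<infinity>" by simp
  finally have fin: "(\<integral>\<^sup>+p. (\<Sum>i. ennreal \<bar>f i p\<bar>) \<partial>square) \<noteq> \<infinity>" by simp
  have "AE p in square. (\<Sum>i. ennreal \<bar>f i p\<bar>) \<noteq> \<infinity>"
    by (rule nn_integral_PInf_AE[OF _ fin]) measurable
  then have conv: "AE p in square. convergent (\<lambda>i. step (L (r i)) p)"
  proof eventually_elim
    case (elim p)
    have "summable (\<lambda>i. \<bar>f i p\<bar>)"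
      using elim by (intro summable_suminf_not_top) auto
    then have "summable (\<lambda>i. f i p)" by (rule summable_rabs_cancel)
    then have "convergent (\<lambda>n. \<Sum>i<n. f i p)" by (simp add: summable_iff_convergent)
    moreover have "(\<Sum>i<n. f i p) = step (L (r n)) p - step (L (r 0)) p" for n
      unfolding f_def by (rule sum_lessThan_telescope)
    ultimately have "convergent (\<lambda>n. step (L (r n)) p - step (L (r 0)) p)" by simp
    from convergent_add[OF this convergent_const[of "step (L (r 0)) p"]] show ?case by simp
  qed
  define w where "w p = max 0 (min 1 (lim (\<lambda>i. step (L (r i)) p)))" for p
  have [measurable]: "w \<in> borel_measurable square"
    unfolding w_def[abs_def] by measurable
  have "step s (x, y) = step s (y, x)" for s x y
    by (simp add: step_def d_sym)
  then have "w (x, y) = w (y, x)" for x y by (simp add: w_def)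
  then have "Rep_graphon (Abs_graphon (\<lambda>x y. w (x, y))) = (\<lambda>x y. w (x, y))"
    by (intro Abs_graphon_inverse) (auto simp: w_def)
  moreover have "AE p in square. (\<lambda>i. step (L (r i)) p) \<longlonglongrightarrow> w p"
    using conv
  proof eventually_elim
    case (elim p)
    then have lim: "(\<lambda>i. step (L (r i)) p) \<longlonglongrightarrow> lim (\<lambda>i. step (L (r i)) p)"
      by (simp add: convergent_LIMSEQ_iff)
    have "0 \<le> lim (\<lambda>i. step (L (r i)) p)"
      by (rule LIMSEQ_le_const[OF lim]) (simp add: step_bounds)
    moreover have "lim (\<lambda>i. step (L (r i)) p) \<le> 1"
      by (rule LIMSEQ_le_const2[OF lim]) (simp add: step_bounds)
    ultimately show ?case using lim by (simp add: w_def)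
  qed
  ultimately show ?thesis
    using r(1) by (intro exI[of _ r] exI[of _ "Abs_graphon (\<lambda>x y. w (x, y))"]) simp
qed

lemma step_density_tendsto:
  assumes I: "finite I"
    and W: "AE p in square. (\<lambda>i. step (K i) p) \<longlonglongrightarrow> Rep_graphon W (fst p) (snd p)"
  shows "(\<lambda>i. \<Sum>\<tau>\<in>PiE I (\<lambda>_. {..<2 ^ K i}). bern (upairs I) (\<lambda>(u, v). d (K i) (\<tau> u) (\<tau> v)) B
      * (\<Prod>j\<in>I. \<mu> (K i) (\<tau> j))) \<longlonglongrightarrow> (\<integral>x. graphon_bern I W B x \<partial>cube I)"
proof -
  interpret P: prob_space "cube I" by (rule prob_space_cube)
  let ?g = "\<lambda>i x. bern (upairs I) (\<lambda>(u, v). step (K i) (x u, x v)) B"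
  have eq: "(\<Sum>\<tau>\<in>PiE I (\<lambda>_. {..<2 ^ K i}). bern (upairs I) (\<lambda>(u, v). d (K i) (\<tau> u) (\<tau> v)) B
      * (\<Prod>j\<in>I. \<mu> (K i) (\<tau> j))) = (\<integral>x. ?g i x \<partial>cube I)" for i
  proof -
    have "?g i x = bern (upairs I) (\<lambda>(u, v). d (K i) (restrict (\<lambda>j. ty (K i) (x j)) I u) (restrict (\<lambda>j. ty (K i) (x j)) I v)) B" for x
      unfolding bern_def by (intro prod.cong refl) (auto simp: upairs_def step_def)
    then show ?thesis
      unfolding integral_cube_ty[OF I, symmetric] by simp
  qed
  have meas: "?g i \<in> borel_measurable (cube I)" for i
    unfolding bern_def
  proof (intro borel_measurable_prod)
    fix p assume "p \<in> upairs I"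
    then have p: "fst p \<in> I" "snd p \<in> I" by (auto simp: upairs_def)
    have [measurable]: "(\<lambda>x. step (K i) (x (fst p), x (snd p))) \<in> borel_measurable (cube I)"
      using measurable_compose[OF measurable_cube_pair[OF p] measurable_step[of "K i"]] by simp
    show "(\<lambda>x. if p \<in> B then case p of (u, v) \<Rightarrow> step (K i) (x u, x v)
      else 1 - (case p of (u, v) \<Rightarrow> step (K i) (x u, x v))) \<in> borel_measurable (cube I)"
      unfolding case_prod_unfold by (cases "p \<in> B") simp_all
  qed
  have "AE x in cube I. (\<lambda>i. step (K i) (x u, x v)) \<longlonglongrightarrow> Rep_graphon W (x u) (x v)"
    if "(u, v) \<in> upairs I" for u v
    using AE_cube_pair[OF I _ _ _ W, of u v] that by (auto simp: upairs_def)
  then have "AE x in cube I. \<forall>p\<in>upairs I. (\<lambda>i. step (K i) (x (fst p), x (snd p))) \<longlonglongrightarrow> Rep_graphon W (x (fst p)) (x (snd p))"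
    using I by (intro AE_finite_allI) auto
  then have lim: "AE x in cube I. (\<lambda>i. ?g i x) \<longlonglongrightarrow> graphon_bern I W B x"
  proof eventually_elim
    case (elim x)
    show ?case
      unfolding bern_def graphon_bern_def case_prod_unfold
    proof (intro tendsto_prod)
      fix p assume "p \<in> upairs I"
      then show "(\<lambda>i. if p \<in> B then step (K i) (x (fst p), x (snd p)) else 1 - step (K i) (x (fst p), x (snd p)))
        \<longlonglongrightarrow> (if p \<in> B then Rep_graphon W (x (fst p)) (x (snd p)) else 1 - Rep_graphon W (x (fst p)) (x (snd p)))"
        using elim by (cases "p \<in> B") (auto intro!: tendsto_intros)
    qed
  qed
  have bd: "\<bar>?g i x\<bar> \<le> 1" for i x
  proof -
    have "(case p of (u, v) \<Rightarrow> step (K i) (x u, x v)) \<in> {0..1}" for p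
      using step_bounds by (simp add: case_prod_unfold)
    then have "0 \<le> ?g i x" "?g i x \<le> 1" by (intro bern_nonneg bern_le_1; blast)+
    then show ?thesis by simp
  qed
  show ?thesis
    unfolding eq
    by (rule integral_dominated_convergence[OF measurable_graphon_bern meas _ lim, of "\<lambda>_. 1"])
      (auto simp: bd)
qed

lemma step_entropy_tendsto:
  assumes W: "AE p in square. (\<lambda>i. step (K i) p) \<longlonglongrightarrow> Rep_graphon W (fst p) (snd p)"
  shows "(\<lambda>i. \<Sum>t<2 ^ K i. \<Sum>t'<2 ^ K i. \<mu> (K i) t * \<mu> (K i) t' * binary_entropy (d (K i) t t'))
    \<longlonglongrightarrow> graphon_entropy W"
proof -
  have eq: "(\<Sum>t<2 ^ K i. \<Sum>t'<2 ^ K i. \<mu> (K i) t * \<mu> (K i) t' * binary_entropy (d (K i) t t'))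
    = (\<integral>p. binary_entropy (step (K i) p) \<partial>square)" for i
    unfolding step_def integral_square_ty[of "\<lambda>t t'. binary_entropy (d (K i) t t')"] ..
  have lim: "AE p in square. (\<lambda>i. binary_entropy (step (K i) p)) \<longlonglongrightarrow> binary_entropy (Rep_graphon W (fst p) (snd p))"
    using W AE_space
  proof eventually_elim
    case (elim p)
    have "Rep_graphon W (fst p) (snd p) \<in> {0..1}"
      using elim(2) by (intro graphon_bounds) (auto simp: space_pair_measure)
    then show ?case
      using elim(1) step_bounds
      by (intro continuous_on_tendsto_compose[OF continuous_on_binary_entropy]) (auto intro!: always_eventually)
  qed
  show ?thesis
    unfolding eq graphon_entropy_eq
    by (rule integral_dominated_convergence[OF measurable_entropy_graphon _ _ lim, of "\<lambda>_. 1 / ln 2"])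
      (auto simp: binary_entropy_bounds step_bounds)
qed

end

subsection \<open>Existence of a limit graphon\<close>

lemma tendsto_double_limit:
  fixes e :: "nat \<Rightarrow> real"
  assumes close: "\<And>i n. i \<ge> i0 \<Longrightarrow> \<bar>e n - a n i\<bar> \<le> \<delta> i" and \<delta>: "\<delta> \<longlonglongrightarrow> 0"
    and a: "\<And>i. (\<lambda>n. a n i) \<longlonglongrightarrow> b i" and b: "b \<longlonglongrightarrow> l"
  shows "e \<longlonglongrightarrow> l"
proof (rule LIMSEQ_I)
  fix \<epsilon> :: real assume "\<epsilon> > 0"
  then have "\<forall>\<^sub>F i in sequentially. \<delta> i < \<epsilon> / 3" "\<forall>\<^sub>F i in sequentially. dist (b i) l < \<epsilon> / 3"
    using order_tendstoD(2)[OF \<delta>, of "\<epsilon> / 3"] tendstoD[OF b, of "\<epsilon> / 3"] by auto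
  then have "\<forall>\<^sub>F i in sequentially. i \<ge> i0 \<and> \<delta> i < \<epsilon> / 3 \<and> dist (b i) l < \<epsilon> / 3"
    using eventually_ge_at_top[of i0] by eventually_elim auto
  then obtain i where i: "i \<ge> i0" "\<delta> i < \<epsilon> / 3" "dist (b i) l < \<epsilon> / 3"
    by (auto dest: eventually_happens)
  obtain N where N: "\<And>n. n \<ge> N \<Longrightarrow> norm (a n i - b i) < \<epsilon> / 3"
    using LIMSEQ_D[OF a[of i], of "\<epsilon> / 3"] \<open>\<epsilon> > 0\<close> by auto
  have "norm (e n - l) < \<epsilon>" if "n \<ge> N" for n
    using close[OF i(1), of n] i(2,3) N[OF that]
    unfolding dist_real_def real_norm_def abs_less_iff abs_le_iff by linarith
  then show "\<exists>N. \<forall>n\<ge>N. norm (e n - l) < \<epsilon>" by blast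
qed

lemma seqcode_Pi: "seqcode E u s \<in> V \<rightarrow> {..<2 ^ s}"
  using seqcode_less by auto

lemma mass_seqcode_split:
  assumes "finite V"
  shows "mass V (seqcode E u s) t
    = mass V (seqcode E u (Suc s)) (2 * t) + mass V (seqcode E u (Suc s)) (2 * t + 1)"
proof -
  have "seqcode E u s v = seqcode E u (Suc s) v div 2" for v
    using seqcode_div[of s "Suc s" E u v] by simp
  then have "colour_class V (seqcode E u s) t
    = colour_class V (seqcode E u (Suc s)) (2 * t) \<union> colour_class V (seqcode E u (Suc s)) (2 * t + 1)"
    unfolding colour_class_def by (auto simp only: mem_Collect_eq Un_iff)
  moreover have "colour_class V (seqcode E u (Suc s)) (2 * t) \<inter> colour_class V (seqcode E u (Suc s)) (2 * t + 1) = {}"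
    by (auto simp: colour_class_def)
  ultimately show ?thesis
    using assms by (simp add: mass_def card_Un_disjoint add_divide_distrib)
qed

lemma tendsto_bern:
  assumes "\<And>p. p \<in> P \<Longrightarrow> ((\<lambda>n. w n p) \<longlongrightarrow> w' p) F"
  shows "((\<lambda>n. bern P (w n) B) \<longlongrightarrow> bern P w' B) F"
  unfolding bern_def
proof (rule tendsto_prod)
  fix p assume "p \<in> P"
  then show "((\<lambda>n. if p \<in> B then w n p else 1 - w n p) \<longlongrightarrow> (if p \<in> B then w' p else 1 - w' p)) F"
    using assms by (cases "p \<in> B") (auto intro!: tendsto_intros)
qed

theorem graph_limit_exists:
  fixes G :: "nat \<Rightarrow> simple_graph"
  assumes card: "filterlim (\<lambda>n. card (verts (G n))) at_top sequentially"
    and rich: "\<And>m \<epsilon>. \<epsilon> > 0 \<Longrightarrow> \<forall>\<^sub>F n in sequentially. entropy_rich m (c - \<epsilon>) (G n)"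
  shows "\<exists>r W. strict_mono r \<and> (\<forall>H. (\<lambda>n. induced_density H (G (r n))) \<longlonglongrightarrow> graphon_density H W) \<and>
    c \<le> graphon_entropy W"
proof -
  have "\<forall>n. \<exists>u. range u \<subseteq> verts (G n) \<and>
      (\<forall>j. regular (verts (G n)) (adj (G n)) j (1 / real (Suc j)) (map u [0..<blen j]))"
    by (intro allI ex_regular_sequence) auto
  then obtain u where u: "\<And>n j. regular (verts (G n)) (adj (G n)) j (1 / real (Suc j)) (map (u n) [0..<blen j])"
    by metis
  define M where "M n s t = mass (verts (G n)) (seqcode (adj (G n)) (u n) s) t" for n s t
  define D where "D n s t t' = block_density (verts (G n)) (adj (G n)) (seqcode (adj (G n)) (u n) s) t t'" for n s t t'
  define x where "x n = (\<lambda>(s, t, t', b). if b then M n s t else D n s t t')" for n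
  have "x n i \<in> {0..1}" for n i
    by (auto simp: x_def M_def D_def mass_bounds block_density_bounds split: prod.split)
  from bounded_family_subseq[of x, OF this] obtain r
    where r: "strict_mono r" "\<And>i. convergent (\<lambda>n. x (r n) i)" by blast
  define \<mu> where "\<mu> s t = lim (\<lambda>n. M (r n) s t)" for s t
  define d where "d s t t' = lim (\<lambda>n. D (r n) s t t')" for s t t'
  have M: "(\<lambda>n. M (r n) s t) \<longlonglongrightarrow> \<mu> s t" for s t
    using r(2)[of "(s, t, 0, True)"] by (simp add: x_def \<mu>_def convergent_LIMSEQ_iff)
  have D: "(\<lambda>n. D (r n) s t t') \<longlonglongrightarrow> d s t t'" for s t t'
    using r(2)[of "(s, t, t', False)"] by (simp add: x_def d_def convergent_LIMSEQ_iff)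
  interpret dyadic_graphon \<mu> d
  proof
    fix s t t' :: nat
    show "0 \<le> \<mu> s t"
      by (rule LIMSEQ_le_const[OF M]) (simp add: M_def mass_bounds)
    have "0 \<le> d s t t'" "d s t t' \<le> 1"
      by (rule LIMSEQ_le_const[OF D] LIMSEQ_le_const2[OF D], simp add: D_def block_density_bounds)+
    then show "d s t t' \<in> {0..1}" by simp
    have "D n s t t' = D n s t' t" for n
      unfolding D_def by (rule block_density_sym) (rule adj_sym)
    then show "d s t t' = d s t' t" by (simp add: d_def)
    have "M n 0 0 = 1" for n
      by (simp add: M_def mass_def colour_class_def card_gt_0_iff)
    then show "\<mu> 0 0 = 1" by (simp add: \<mu>_def)
    have "M n s t = M n (Suc s) (2 * t) + M n (Suc s) (2 * t + 1)" for n
      unfolding M_def by (rule mass_seqcode_split) simp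
    then have "(\<lambda>n. M (r n) s t) \<longlonglongrightarrow> \<mu> (Suc s) (2 * t) + \<mu> (Suc s) (2 * t + 1)"
      by (simp only:) (intro tendsto_add M)
    then show "\<mu> s t = \<mu> (Suc s) (2 * t) + \<mu> (Suc s) (2 * t + 1)"
      by (rule LIMSEQ_unique[OF M])
  next
    fix s s' :: nat assume ss': "s \<le> s'"
    let ?g = "\<lambda>t. t div 2 ^ (s' - s)"
    have "(\<Sum>t<2 ^ s'. \<Sum>t'<2 ^ s'. M n s' t * M n s' t' * (D n s' t t' - D n s (?g t) (?g t'))\<^sup>2)
      = (\<Sum>t<2 ^ s'. \<Sum>t'<2 ^ s'. M n s' t * M n s' t' * (D n s' t t')\<^sup>2)
        - (\<Sum>t<2 ^ s. \<Sum>t'<2 ^ s. M n s t * M n s t' * (D n s t t')\<^sup>2)" for n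
      unfolding M_def D_def energy_colours[OF finite_verts seqcode_Pi, symmetric]
      by (rule energy_diff_colours[OF finite_verts verts_nonempty seqcode_Pi, symmetric])
        (simp add: seqcode_div[OF ss'])
    then have "(\<lambda>n. \<Sum>t<2 ^ s'. \<Sum>t'<2 ^ s'. M (r n) s' t * M (r n) s' t' * (D (r n) s' t t' - D (r n) s (?g t) (?g t'))\<^sup>2)
      \<longlonglongrightarrow> (\<Sum>t<2 ^ s'. \<Sum>t'<2 ^ s'. \<mu> s' t * \<mu> s' t' * (d s' t t')\<^sup>2)
        - (\<Sum>t<2 ^ s. \<Sum>t'<2 ^ s. \<mu> s t * \<mu> s t' * (d s t t')\<^sup>2)"
      by (simp only:) (intro tendsto_diff tendsto_sum tendsto_mult tendsto_power M D)
    moreover have "(\<lambda>n. \<Sum>t<2 ^ s'. \<Sum>t'<2 ^ s'. M (r n) s' t * M (r n) s' t' * (D (r n) s' t t' - D (r n) s (?g t) (?g t'))\<^sup>2)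
      \<longlonglongrightarrow> (\<Sum>t<2 ^ s'. \<Sum>t'<2 ^ s'. \<mu> s' t * \<mu> s' t' * (d s' t t' - d s (?g t) (?g t'))\<^sup>2)"
      by (intro tendsto_diff tendsto_sum tendsto_mult tendsto_power M D)
    ultimately show "(\<Sum>t<2 ^ s'. \<Sum>t'<2 ^ s'. \<mu> s' t * \<mu> s' t' * (d s' t t' - d s (?g t) (?g t'))\<^sup>2)
      = (\<Sum>t<2 ^ s'. \<Sum>t'<2 ^ s'. \<mu> s' t * \<mu> s' t' * (d s' t t')\<^sup>2)
        - (\<Sum>t<2 ^ s. \<Sum>t'<2 ^ s. \<mu> s t * \<mu> s t' * (d s t t')\<^sup>2)"
      by (intro LIMSEQ_unique)
  qed
  have "strict_mono blen" by (simp add: strict_mono_Suc_iff)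
  from ex_limit_graphon[OF this] obtain l W where l: "strict_mono l"
    and W: "AE p in square. (\<lambda>i. step (blen (l i)) p) \<longlonglongrightarrow> Rep_graphon W (fst p) (snd p)" by blast
  let ?K = "\<lambda>i. blen (l i)"
  have "(\<lambda>n. induced_density H (G (r n))) \<longlonglongrightarrow> graphon_density H W" for H
  proof -
    let ?I = "verts H" and ?B = "edge_pairs H"
    define e where "e n = map_density ?I (verts (G (r n))) (\<lambda>v w. of_bool (adj (G (r n)) v w)) ?B" for n
    define a where "a n i = map_density ?I (verts (G (r n)))
      (block_avg (verts (G (r n))) (adj (G (r n))) (seqcode (adj (G (r n))) (u (r n)) (?K i))) ?B" for n i
    have "e \<longlonglongrightarrow> graphon_density H W"
    proof (rule tendsto_double_limit)
      fix i n assume i: "card ?I \<le> i"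
      have "card ?I \<le> l i" using i seq_suble[OF l, of i] by linarith
      then have "\<bar>e n - a n i\<bar> \<le> real (card (upairs ?I)) * sqrt (1 / real (Suc (l i)))"
        unfolding e_def a_def by (intro counting_lemma[OF finite_verts verts_nonempty _ finite_verts _ u]) (auto simp: insert_commute)
      also have "\<dots> \<le> real (card (upairs ?I)) * sqrt (1 / real (Suc i))"
        using seq_suble[OF l, of i] by (intro mult_left_mono real_sqrt_le_mono divide_left_mono) auto
      finally show "\<bar>e n - a n i\<bar> \<le> real (card (upairs ?I)) * sqrt (1 / real (Suc i))" .
    next
      have "(\<lambda>i. sqrt (1 / real (Suc i))) \<longlonglongrightarrow> 0" by real_asymp
      then show "(\<lambda>i. real (card (upairs ?I)) * sqrt (1 / real (Suc i))) \<longlonglongrightarrow> 0"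
        by (rule tendsto_mult_right_zero)
    next
      fix i
      have "a n i = (\<Sum>\<tau>\<in>PiE ?I (\<lambda>_. {..<2 ^ ?K i}). bern (upairs ?I) (\<lambda>(u, v). D (r n) (?K i) (\<tau> u) (\<tau> v)) ?B
          * (\<Prod>j\<in>?I. M (r n) (?K i) (\<tau> j)))" for n
        unfolding a_def M_def D_def by (rule map_density_colours[OF finite_verts finite_verts seqcode_Pi])
      then show "(\<lambda>n. a n i) \<longlonglongrightarrow> (\<Sum>\<tau>\<in>PiE ?I (\<lambda>_. {..<2 ^ ?K i}). bern (upairs ?I) (\<lambda>(u, v). d (?K i) (\<tau> u) (\<tau> v)) ?B
          * (\<Prod>j\<in>?I. \<mu> (?K i) (\<tau> j)))"
        by (simp only:) (auto intro!: tendsto_sum tendsto_mult tendsto_bern tendsto_prod M D)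
    next
      show "(\<lambda>i. \<Sum>\<tau>\<in>PiE ?I (\<lambda>_. {..<2 ^ ?K i}). bern (upairs ?I) (\<lambda>(u, v). d (?K i) (\<tau> u) (\<tau> v)) ?B
          * (\<Prod>j\<in>?I. \<mu> (?K i) (\<tau> j))) \<longlonglongrightarrow> graphon_density H W"
        unfolding graphon_density_eq by (rule step_density_tendsto[OF finite_verts W])
    qed
    moreover have "(\<lambda>n. induced_density H (G (r n)) - e n) \<longlonglongrightarrow> 0"
    proof (rule Lim_null_comparison)
      have lim: "filterlim (\<lambda>n. card (verts (G (r n)))) at_top sequentially"
        using filterlim_compose[OF card filterlim_subseq[OF r(1)]] by simp
      then have "\<forall>\<^sub>F n in sequentially. card (upairs ?I) < card (verts (G (r n)))"
        using lim[unfolded filterlim_at_top, rule_format, of "Suc (card (upairs ?I))"]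
        by (simp only: Suc_le_eq)
      then show "\<forall>\<^sub>F n in sequentially. norm (induced_density H (G (r n)) - e n)
          \<le> real (card (upairs ?I)) / real (card (verts (G (r n))))"
        by eventually_elim (simp add: e_def induced_density_map_density)
      show "(\<lambda>n. real (card (upairs ?I)) / real (card (verts (G (r n))))) \<longlonglongrightarrow> 0"
        by (intro real_tendsto_divide_at_top[OF tendsto_const] filterlim_compose[OF filterlim_real_sequentially lim])
    qed
    ultimately show ?thesis using tendsto_add[of e _ sequentially "\<lambda>n. induced_density H (G (r n)) - e n" 0] by simp
  qed
  moreover have "c \<le> graphon_entropy W"
  proof (rule LIMSEQ_le_const[OF step_entropy_tendsto[OF W]], intro exI[of _ 0] allI impI)
    fix i
    let ?s = "?K i"
    have lim: "(\<lambda>n. \<Sum>t<2 ^ ?s. \<Sum>t'<2 ^ ?s. M (r n) ?s t * M (r n) ?s t' * binary_entropy (D (r n) ?s t t'))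
      \<longlonglongrightarrow> (\<Sum>t<2 ^ ?s. \<Sum>t'<2 ^ ?s. \<mu> ?s t * \<mu> ?s t' * binary_entropy (d ?s t t'))"
    proof (intro tendsto_sum tendsto_mult M)
      fix t t'
      show "(\<lambda>n. binary_entropy (D (r n) ?s t t')) \<longlonglongrightarrow> binary_entropy (d ?s t t')"
        using d_bounds by (intro continuous_on_tendsto_compose[OF continuous_on_binary_entropy D])
          (auto simp: D_def block_density_bounds)
    qed
    show "c \<le> (\<Sum>t<2 ^ ?s. \<Sum>t'<2 ^ ?s. \<mu> ?s t * \<mu> ?s t' * binary_entropy (d ?s t t'))"
    proof (rule field_le_epsilon)
      fix \<epsilon> :: real assume "\<epsilon> > 0"
      have "\<forall>\<^sub>F n in sequentially. entropy_rich (2 ^ ?s) (c - \<epsilon>) (G (r n))"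
        using eventually_subseq[OF r(1) rich[OF \<open>\<epsilon> > 0\<close>]] .
      then have "\<forall>\<^sub>F n in sequentially. c - \<epsilon> \<le>
        (\<Sum>t<2 ^ ?s. \<Sum>t'<2 ^ ?s. M (r n) ?s t * M (r n) ?s t' * binary_entropy (D (r n) ?s t t'))"
      proof eventually_elim
        case (elim n)
        have "c - \<epsilon> \<le> colouring_entropy (verts (G (r n))) (adj (G (r n))) (seqcode (adj (G (r n))) (u (r n)) ?s)"
          by (rule elim[unfolded entropy_rich_def, rule_format, OF seqcode_Pi])
        also have "\<dots> = (\<Sum>t<2 ^ ?s. \<Sum>t'<2 ^ ?s. M (r n) ?s t * M (r n) ?s t' * binary_entropy (D (r n) ?s t t'))"
          unfolding M_def D_def by (rule colouring_entropy_colours[OF finite_verts seqcode_Pi])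
        finally show ?case .
      qed
      then have "c - \<epsilon> \<le> (\<Sum>t<2 ^ ?s. \<Sum>t'<2 ^ ?s. \<mu> ?s t * \<mu> ?s t' * binary_entropy (d ?s t t'))"
        by (intro tendsto_lowerbound[OF lim]) auto
      then show "c \<le> (\<Sum>t<2 ^ ?s. \<Sum>t'<2 ^ ?s. \<mu> ?s t * \<mu> ?s t' * binary_entropy (d ?s t t')) + \<epsilon>"
        by simp
    qed
  qed
  ultimately show ?thesis using r(1) by blast
qed

subsection \<open>Equivalent graphons have the same entropy\<close>

definition step_form :: "(real \<Rightarrow> nat) \<Rightarrow> (nat \<Rightarrow> nat \<Rightarrow> real) \<Rightarrow> real \<times> real \<Rightarrow> real" where
  "step_form M u p = u (M (fst p)) (M (snd p))"

definition finite_partition :: "(real \<Rightarrow> nat) \<Rightarrow> nat \<Rightarrow> bool" where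
  "finite_partition M m \<longleftrightarrow> M \<in> measurable unit_interval (count_space UNIV) \<and> (\<forall>x. M x < m)"

definition step_approximable :: "(real \<times> real \<Rightarrow> real) \<Rightarrow> bool" where
  "step_approximable f \<longleftrightarrow> integrable square f \<and>
    (\<forall>\<eta>>0. \<exists>M m u. finite_partition M m \<and> (\<integral>p. \<bar>f p - step_form M u p\<bar> \<partial>square) \<le> \<eta>)"

lemma step_form_bound:
  assumes "finite_partition M m"
  shows "\<bar>step_form M u p\<bar> \<le> (\<Sum>t<m. \<Sum>t'<m. \<bar>u t t'\<bar>)"
proof -
  have lt: "M (fst p) < m" "M (snd p) < m" using assms by (auto simp: finite_partition_def)
  have "\<bar>u (M (fst p)) (M (snd p))\<bar> \<le> (\<Sum>t'<m. \<bar>u (M (fst p)) t'\<bar>)"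
    using lt by (intro member_le_sum) auto
  also have "\<dots> \<le> (\<Sum>t<m. \<Sum>t'<m. \<bar>u t t'\<bar>)"
    using lt by (intro member_le_sum[of _ _ "\<lambda>t. \<Sum>t'<m. \<bar>u t t'\<bar>"] sum_nonneg) auto
  finally show ?thesis by (simp add: step_form_def)
qed

lemma measurable_step_form:
  assumes "finite_partition M m"
  shows "step_form M u \<in> borel_measurable square"
proof -
  have [measurable]: "M \<in> measurable unit_interval (count_space UNIV)"
    using assms by (simp add: finite_partition_def)
  have "(\<lambda>p. u (M (fst p)) (M (snd p))) \<in> borel_measurable square" by measurable
  then show ?thesis by (simp add: step_form_def[abs_def])
qed

lemma integrable_step_form:
  assumes "finite_partition M m"
  shows "integrable square (step_form M u)"
  using step_form_bound[OF assms, of u] measurable_step_form[OF assms, of u]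
  by (intro unit_square.P.integrable_const_bound[of _ "\<Sum>t<m. \<Sum>t'<m. \<bar>u t t'\<bar>"] AE_I2) auto

lemma step_approximable_add:
  assumes "step_approximable f" "step_approximable g"
  shows "step_approximable (\<lambda>p. f p + g p)"
  unfolding step_approximable_def
proof (intro conjI allI impI)
  have int: "integrable square f" "integrable square g"
    using assms by (auto simp: step_approximable_def)
  then show "integrable square (\<lambda>p. f p + g p)" by simp
  fix \<eta> :: real assume "\<eta> > 0"
  then have "\<eta> / 2 > 0" by simp
  then obtain M1 m1 u1 M2 m2 u2 where
    1: "finite_partition M1 m1" "(\<integral>p. \<bar>f p - step_form M1 u1 p\<bar> \<partial>square) \<le> \<eta> / 2" and
    2: "finite_partition M2 m2" "(\<integral>p. \<bar>g p - step_form M2 u2 p\<bar> \<partial>square) \<le> \<eta> / 2"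
    using assms unfolding step_approximable_def by meson
  define M where "M x = M1 x + m1 * M2 x" for x
  define u where "u t t' = u1 (t mod m1) (t' mod m1) + u2 (t div m1) (t' div m1)" for t t'
  have lt: "M1 x < m1" "M2 x < m2" for x using 1 2 by (auto simp: finite_partition_def)
  have [measurable]: "M1 \<in> measurable unit_interval (count_space UNIV)"
    "M2 \<in> measurable unit_interval (count_space UNIV)"
    using 1 2 by (auto simp: finite_partition_def)
  have "M \<in> measurable unit_interval (count_space UNIV)"
    unfolding M_def[abs_def] by measurable
  moreover have "M x < m1 * m2" for x
  proof -
    have "M x < m1 + m1 * M2 x" using lt by (simp add: M_def)
    also have "\<dots> = m1 * Suc (M2 x)" by simp
    also have "\<dots> \<le> m1 * m2" using lt by (intro mult_le_mono) (auto simp: Suc_le_eq)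
    finally show ?thesis .
  qed
  ultimately have M: "finite_partition M (m1 * m2)" by (simp add: finite_partition_def)
  have "M x mod m1 = M1 x" "M x div m1 = M2 x" for x
    using lt[of x] by (simp_all add: M_def)
  then have eq: "step_form M u p = step_form M1 u1 p + step_form M2 u2 p" for p
    by (simp add: step_form_def u_def)
  have "(\<integral>p. \<bar>f p + g p - step_form M u p\<bar> \<partial>square)
     \<le> (\<integral>p. \<bar>f p - step_form M1 u1 p\<bar> + \<bar>g p - step_form M2 u2 p\<bar> \<partial>square)"
    using int integrable_step_form[OF 1(1), of u1] integrable_step_form[OF 2(1), of u2]
      integrable_step_form[OF M, of u]
    by (intro integral_mono) (auto simp: eq)
  also have "\<dots> = (\<integral>p. \<bar>f p - step_form M1 u1 p\<bar> \<partial>square) + (\<integral>p. \<bar>g p - step_form M2 u2 p\<bar> \<partial>square)"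
    using int integrable_step_form[OF 1(1), of u1] integrable_step_form[OF 2(1), of u2] by simp
  also have "\<dots> \<le> \<eta>" using 1(2) 2(2) by simp
  finally show "\<exists>M m u. finite_partition M m \<and> (\<integral>p. \<bar>f p + g p - step_form M u p\<bar> \<partial>square) \<le> \<eta>"
    using M by blast
qed

lemma step_approximable_scale:
  assumes "step_approximable f"
  shows "step_approximable (\<lambda>p. c * f p)"
  unfolding step_approximable_def
proof (intro conjI allI impI)
  show "integrable square (\<lambda>p. c * f p)" using assms by (simp add: step_approximable_def)
  fix \<eta> :: real assume \<eta>: "\<eta> > 0"
  then have "\<eta> / (\<bar>c\<bar> + 1) > 0" by simp
  then obtain M m u where M: "finite_partition M m" "(\<integral>p. \<bar>f p - step_form M u p\<bar> \<partial>square) \<le> \<eta> / (\<bar>c\<bar> + 1)"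
    using assms unfolding step_approximable_def by meson
  have "\<bar>c * f p - step_form M (\<lambda>t t'. c * u t t') p\<bar> = \<bar>c\<bar> * \<bar>f p - step_form M u p\<bar>" for p
    by (simp add: step_form_def abs_mult[symmetric] right_diff_distrib)
  then have "(\<integral>p. \<bar>c * f p - step_form M (\<lambda>t t'. c * u t t') p\<bar> \<partial>square) = \<bar>c\<bar> * (\<integral>p. \<bar>f p - step_form M u p\<bar> \<partial>square)"
    by simp
  also have "\<dots> \<le> \<bar>c\<bar> * (\<eta> / (\<bar>c\<bar> + 1))" by (intro mult_left_mono M) auto
  also have "\<dots> \<le> \<eta>" using \<eta> by (simp add: field_simps)
  finally show "\<exists>M m u. finite_partition M m \<and> (\<integral>p. \<bar>c * f p - step_form M u p\<bar> \<partial>square) \<le> \<eta>"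
    using M(1) by blast
qed

lemma step_approximable_lim:
  assumes s: "\<And>i::nat. step_approximable (s i)" and f: "integrable square f"
    and lim: "\<And>p. p \<in> space square \<Longrightarrow> (\<lambda>i. s i p) \<longlonglongrightarrow> f p"
    and dom: "\<And>i p. p \<in> space square \<Longrightarrow> \<bar>s i p\<bar> \<le> 2 * \<bar>f p\<bar>"
  shows "step_approximable f"
  unfolding step_approximable_def
proof (intro conjI allI impI f)
  fix \<eta> :: real assume \<eta>: "\<eta> > 0"
  have ints: "integrable square (s i)" for i using s by (simp add: step_approximable_def)
  have "(\<lambda>i. \<integral>p. \<bar>f p - s i p\<bar> \<partial>square) \<longlonglongrightarrow> (\<integral>p. 0 \<partial>square)"
  proof (rule integral_dominated_convergence)
    show "integrable square (\<lambda>p. 3 * \<bar>f p\<bar>)" using f by simp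
    show "AE p in square. (\<lambda>i. \<bar>f p - s i p\<bar>) \<longlonglongrightarrow> 0"
    proof (rule AE_I2)
      fix p assume "p \<in> space square"
      then have "(\<lambda>i. \<bar>f p - s i p\<bar>) \<longlonglongrightarrow> \<bar>f p - f p\<bar>"
        by (intro tendsto_intros lim)
      then show "(\<lambda>i. \<bar>f p - s i p\<bar>) \<longlonglongrightarrow> 0" by simp
    qed
    show "AE p in square. norm \<bar>f p - s i p\<bar> \<le> 3 * \<bar>f p\<bar>" for i
    proof (rule AE_I2)
      fix p assume "p \<in> space square"
      from dom[OF this, of i] show "norm \<bar>f p - s i p\<bar> \<le> 3 * \<bar>f p\<bar>" by simp
    qed
  qed (use f ints in auto)
  then have "\<forall>\<^sub>F i in sequentially. (\<integral>p. \<bar>f p - s i p\<bar> \<partial>square) < \<eta> / 2"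
    using \<eta> by (intro order_tendstoD(2)) auto
  then obtain i where i: "(\<integral>p. \<bar>f p - s i p\<bar> \<partial>square) < \<eta> / 2"
    by (auto dest: eventually_happens)
  have "\<eta> / 2 > 0" using \<eta> by simp
  then obtain M m u where M: "finite_partition M m" "(\<integral>p. \<bar>s i p - step_form M u p\<bar> \<partial>square) \<le> \<eta> / 2"
    using s[of i] unfolding step_approximable_def by meson
  have "(\<integral>p. \<bar>f p - step_form M u p\<bar> \<partial>square) \<le> (\<integral>p. \<bar>f p - s i p\<bar> + \<bar>s i p - step_form M u p\<bar> \<partial>square)"
    using f ints integrable_step_form[OF M(1), of u] by (intro integral_mono) auto
  also have "\<dots> = (\<integral>p. \<bar>f p - s i p\<bar> \<partial>square) + (\<integral>p. \<bar>s i p - step_form M u p\<bar> \<partial>square)"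
    using f ints integrable_step_form[OF M(1), of u] by simp
  also have "\<dots> \<le> \<eta>" using i M(2) by simp
  finally show "\<exists>M m u. finite_partition M m \<and> (\<integral>p. \<bar>f p - step_form M u p\<bar> \<partial>square) \<le> \<eta>"
    using M(1) by blast
qed

lemma step_approximable_step_form:
  assumes "finite_partition M m"
  shows "step_approximable (step_form M u)"
  unfolding step_approximable_def using integrable_step_form[OF assms] assms
  by (auto intro!: exI[of _ M] exI[of _ m] exI[of _ u])

lemma step_approximable_cong:
  assumes "step_approximable f" "\<And>p. p \<in> space square \<Longrightarrow> f p = g p"
  shows "step_approximable g"
proof -
  have "integrable square f = integrable square g"
    by (rule Bochner_Integration.integrable_cong) (auto simp: assms(2))
  moreover have "(\<integral>p. \<bar>f p - h p\<bar> \<partial>square) = (\<integral>p. \<bar>g p - h p\<bar> \<partial>square)" for h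
    by (rule Bochner_Integration.integral_cong) (auto simp: assms(2))
  ultimately show ?thesis using assms(1) unfolding step_approximable_def by simp
qed

lemma step_approximable_indicator:
  assumes "A \<in> sets square"
  shows "step_approximable (indicat_real A)"
proof -
  let ?G = "{a \<times> b |a b. a \<in> sets unit_interval \<and> b \<in> sets unit_interval}"
  let ?\<Omega> = "space unit_interval \<times> space unit_interval"
  have one: "step_approximable (\<lambda>p. 1)"
    using step_approximable_step_form[of "\<lambda>_. 0" 1 "\<lambda>_ _. 1"]
    by (simp add: finite_partition_def step_form_def[abs_def])
  have "A \<in> sigma_sets ?\<Omega> ?G" using assms by (simp add: sets_pair_measure)
  then show ?thesis
  proof (induction A rule: sigma_sets_induct_disjoint[OF Int_stable_pair_measure_generator pair_measure_closed, consumes 1, case_names basic empty compl union])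
    case (basic A)
    then obtain a b where A: "A = a \<times> b" "a \<in> sets unit_interval" "b \<in> sets unit_interval" by blast
    let ?M = "\<lambda>x. of_bool (x \<in> a) + 2 * of_bool (x \<in> b) :: nat"
    have [measurable]: "a \<in> sets unit_interval" "b \<in> sets unit_interval" using A by auto
    have "finite_partition ?M 4"
      unfolding finite_partition_def of_bool_def by (intro conjI allI; (measurable | simp))
    from step_approximable_step_form[OF this, of "\<lambda>t t'. of_bool (odd t \<and> t' \<ge> 2)"]
    show ?case
      by (rule step_approximable_cong) (auto simp: A step_form_def indicator_def)
  next
    case empty
    show ?case using step_approximable_scale[OF one, of 0] by simp
  next
    case (compl A)
    have "step_approximable (\<lambda>p. 1 + (- 1) * indicat_real A p)"
      by (intro step_approximable_add one step_approximable_scale compl)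
    then show ?case
      by (rule step_approximable_cong) (auto simp: indicator_def space_pair_measure)
  next
    case (union A)
    have fin: "step_approximable (\<lambda>p. \<Sum>i<n. indicat_real (A i) p)" for n
    proof (induction n)
      case 0
      show ?case using step_approximable_scale[OF one, of 0] by simp
    next
      case (Suc n)
      then show ?case using step_approximable_add[OF Suc union(3)[of n]] by simp
    qed
    have sets: "A i \<in> sets square" for i
      using union(2) by (auto simp: sets_pair_measure)
    show ?case
    proof (rule step_approximable_lim[of "\<lambda>n p. \<Sum>i<n. indicat_real (A i) p"])
      show "integrable square (indicat_real (\<Union> (range A)))"
        using sets by (intro unit_square.P.integrable_const_bound[of _ 1] AE_I2)
          (auto simp: indicator_def)
      fix p
      have sums: "(\<lambda>i. indicat_real (A i) p) sums indicat_real (\<Union> (range A)) p"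
        using disjoint_family_onD[OF union(1)] by (intro indicator_sums) auto
      then show "(\<lambda>n. \<Sum>i<n. indicat_real (A i) p) \<longlonglongrightarrow> indicat_real (\<Union> (range A)) p"
        by (simp add: sums_def)
      have "(\<Sum>i<n. indicat_real (A i) p) \<le> indicat_real (\<Union> (range A)) p" for n
        unfolding sums_unique[OF sums] using sums by (intro sum_le_suminf) (auto dest: sums_summable)
      moreover have "0 \<le> (\<Sum>i<n. indicat_real (A i) p)" for n by (intro sum_nonneg) auto
      ultimately show "\<bar>\<Sum>i<n. indicat_real (A i) p\<bar> \<le> 2 * \<bar>indicat_real (\<Union> (range A)) p\<bar>" for n
        by (smt (verit))
    qed (rule fin)
  qed
qed

lemma step_approximable_integrable:
  fixes f :: "real \<times> real \<Rightarrow> real"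
  assumes "integrable square f"
  shows "step_approximable f"
  using assms
proof (induction rule: integrable_induct)
  case (base A c)
  have "step_approximable (\<lambda>p. c * indicat_real A p)"
    by (intro step_approximable_scale step_approximable_indicator base)
  then show ?case by (simp add: mult.commute)
next
  case (add f g)
  then show ?case by (intro step_approximable_add)
next
  case (lim f s)
  show ?case by (rule step_approximable_lim[of s f]) (use lim in auto)
qed

definition cross_entropy :: "real \<Rightarrow> real \<Rightarrow> real" where
  "cross_entropy w v = - w * log 2 v - (1 - w) * log 2 (1 - v)"

definition clip :: "real \<Rightarrow> real \<Rightarrow> real" where
  "clip \<delta> v = max \<delta> (min (1 - \<delta>) v)"

lemma clip_bounds: "\<delta> < 1 / 2 \<Longrightarrow> clip \<delta> v \<in> {\<delta>..1 - \<delta>}"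
  by (auto simp: clip_def)

lemma clip_contracts: "\<bar>clip \<delta> v - clip \<delta> v'\<bar> \<le> \<bar>v - v'\<bar>"
  unfolding clip_def by (simp add: max_def min_def)

lemma clip_idem: "\<delta> < 1 / 2 \<Longrightarrow> clip \<delta> (clip \<delta> v) = clip \<delta> v"
  by (auto simp: clip_def)

lemma cross_entropy_clip_le:
  assumes \<delta>: "0 < \<delta>" "\<delta> < 1 / 2" and w: "0 \<le> w" "w \<le> 1"
  shows "cross_entropy w (clip \<delta> w) \<le> binary_entropy w - log 2 (1 - \<delta>)"
proof -
  have one: "log 2 (1 - \<delta>) \<le> 0" using \<delta> by simp
  have key: "cross_entropy v \<delta> \<le> binary_entropy v - log 2 (1 - \<delta>)" if "0 \<le> v" "v < \<delta>" for v
  proof -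
    have "v * log 2 v \<le> v * log 2 \<delta>"
      using that \<delta> by (cases "v = 0") (auto intro!: mult_left_mono)
    moreover have "(1 - v) * log 2 (1 - v) \<le> 0"
      using that \<delta> by (intro mult_nonneg_nonpos) auto
    moreover have "- ((1 - v) * log 2 (1 - \<delta>)) \<le> - log 2 (1 - \<delta>)"
      using one that mult_nonneg_nonpos[of v "log 2 (1 - \<delta>)"] by (simp add: algebra_simps)
    ultimately show ?thesis
      unfolding cross_entropy_def binary_entropy_def by simp
  qed
  have sym: "cross_entropy w (1 - \<delta>) = cross_entropy (1 - w) \<delta>" "binary_entropy w = binary_entropy (1 - w)"
    by (simp_all add: cross_entropy_def binary_entropy_def algebra_simps)
  consider "w < \<delta>" | "\<delta> \<le> w" "w \<le> 1 - \<delta>" | "1 - \<delta> < w" by linarith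
  then show ?thesis
  proof cases
    case 1
    then have "clip \<delta> w = \<delta>" using \<delta> by (simp add: clip_def)
    then show ?thesis using key[of w] 1 w by simp
  next
    case 2
    then have "clip \<delta> w = w" by (simp add: clip_def)
    then show ?thesis using one by (simp add: cross_entropy_def binary_entropy_def)
  next
    case 3
    then have "clip \<delta> w = 1 - \<delta>" using \<delta> by (simp add: clip_def)
    then show ?thesis using key[of "1 - w"] 3 w sym by simp
  qed
qed

lemma log_diff_le:
  assumes \<delta>: "0 < \<delta>" and v: "\<delta> \<le> v" "\<delta> \<le> v'"
  shows "log 2 v - log 2 v' \<le> \<bar>v - v'\<bar> / (\<delta> * ln 2)"
proof -
  have "ln (v / v') \<le> v / v' - 1" using v \<delta> by (intro ln_le_minus_one) simp
  then have "ln v - ln v' \<le> (v - v') / v'" using v \<delta> by (simp add: ln_div diff_divide_distrib)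
  also have "\<dots> \<le> \<bar>v - v'\<bar> / v'" using v \<delta> by (intro divide_right_mono) auto
  also have "\<dots> \<le> \<bar>v - v'\<bar> / \<delta>" using v \<delta> by (intro divide_left_mono) auto
  finally have "(ln v - ln v') / ln 2 \<le> \<bar>v - v'\<bar> / \<delta> / ln 2" by (intro divide_right_mono) auto
  then show ?thesis by (simp add: log_def diff_divide_distrib)
qed

lemma cross_entropy_le:
  assumes \<delta>: "0 < \<delta>" "\<delta> < 1 / 2" and w: "0 \<le> w" "w \<le> 1"
  shows "cross_entropy w (clip \<delta> v) \<le> binary_entropy w - log 2 (1 - \<delta>) + 1 / (\<delta> * ln 2) * \<bar>clip \<delta> w - v\<bar>"
proof -
  let ?g = "clip \<delta> w" and ?v = "clip \<delta> v"
  have b: "?g \<in> {\<delta>..1 - \<delta>}" "?v \<in> {\<delta>..1 - \<delta>}" using clip_bounds[OF \<delta>(2)] by auto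
  define e where "e = \<bar>?g - ?v\<bar> / (\<delta> * ln 2)"
  have 1: "log 2 ?g - log 2 ?v \<le> e" "log 2 (1 - ?g) - log 2 (1 - ?v) \<le> e"
    using log_diff_le[OF \<delta>(1), of ?g ?v] log_diff_le[OF \<delta>(1), of "1 - ?g" "1 - ?v"] b
    by (auto simp: e_def abs_minus_commute)
  have "cross_entropy w ?v - cross_entropy w ?g = w * (log 2 ?g - log 2 ?v) + (1 - w) * (log 2 (1 - ?g) - log 2 (1 - ?v))"
    by (simp add: cross_entropy_def algebra_simps)
  also have "\<dots> \<le> w * e + (1 - w) * e"
    using 1 w by (intro add_mono mult_left_mono) auto
  also have "\<dots> = e" by (simp add: algebra_simps)
  also have "e \<le> \<bar>?g - v\<bar> / (\<delta> * ln 2)"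
    unfolding e_def using clip_contracts[of \<delta> ?g v] clip_idem[OF \<delta>(2), of w] \<delta>
    by (intro divide_right_mono) auto
  finally show ?thesis
    using cross_entropy_clip_le[OF \<delta> w] by simp
qed

text \<open>
  \<open>q\<close> is the distribution of the block model \<open>u\<close> with independent uniform colours.  Gibbs' inequality
  compares it with the conditional distribution of the \<open>W\<close>-random graph, and the densities of \<open>W\<close> may
  then be replaced by those of \<open>W'\<close>.  Bounding \<open>q\<close> from below by its term for the colours of the sampled
  points costs \<open>k log m\<close>.
\<close>

lemma graphon_entropy_le_cross_entropy:
  assumes equiv: "graphon_equiv W W'" and k: "k > 0" and M: "finite_partition M m"
    and \<delta>: "0 < \<delta>" "\<delta> < 1 / 2" and u: "\<And>t t'. u t t' \<in> {\<delta>..1 - \<delta>}"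
  shows "real (k choose 2) * graphon_entropy W \<le> real k * log 2 (real m) +
    real (k choose 2) * (\<integral>p. cross_entropy (Rep_graphon W' (fst p) (snd p)) (step_form M u p) \<partial>square)"
proof -
  let ?I = "{..<k}"
  let ?P = "upairs ?I"
  let ?T = "PiE ?I (\<lambda>_. {..<m})"
  interpret P: prob_space "cube ?I" by (rule prob_space_cube)
  define b where "b \<tau> A = bern ?P (\<lambda>(i, j). u (\<tau> i) (\<tau> j)) A" for \<tau> A
  define q where "q A = (\<Sum>\<tau>\<in>?T. b \<tau> A) / real m ^ k" for A
  have Mlt: "M x < m" for x using M by (simp add: finite_partition_def)
  then have m: "m > 0" by (metis gr_implies_not0 not_gr0)
  have finT: "finite ?T" by (intro finite_PiE) auto
  have bpos: "0 < b \<tau> A" for \<tau> A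
    unfolding b_def bern_def
  proof (rule prod_pos, clarify)
    fix i j
    show "0 < (if (i, j) \<in> A then u (\<tau> i) (\<tau> j) else 1 - u (\<tau> i) (\<tau> j))"
      using u[of "\<tau> i" "\<tau> j"] \<delta> by auto
  qed
  have Tne: "?T \<noteq> {}" using m by (auto simp: PiE_eq_empty_iff)
  have qpos: "0 < q A" for A
    unfolding q_def using finT Tne bpos m by (intro divide_pos_pos sum_pos) auto
  have "(\<Sum>A\<in>Pow ?P. q A) = (\<Sum>\<tau>\<in>?T. \<Sum>A\<in>Pow ?P. b \<tau> A) / real m ^ k"
    unfolding q_def sum_divide_distrib[symmetric] by (subst sum.swap) simp
  also have "\<dots> = real (card ?T) / real m ^ k"
    unfolding b_def by (simp add: sum_bern)
  also have "\<dots> = 1" using m by (simp add: card_PiE)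
  finally have q1: "(\<Sum>A\<in>Pow ?P. q A) = 1" .
  have dens: "(\<integral>x. graphon_bern ?I W A x \<partial>cube ?I) = (\<integral>x. graphon_bern ?I W' A x \<partial>cube ?I)" if "A \<in> Pow ?P" for A
    using equiv that k unfolding graphon_equiv_def by (simp add: graphon_density_labelled[symmetric])
  let ?ce = "\<lambda>p. cross_entropy (Rep_graphon W' (fst p) (snd p)) (step_form M u p)"
  have ce_meas: "?ce \<in> borel_measurable square"
  proof -
    note [measurable] = measurable_graphon[of W'] measurable_step_form[OF M, of u]
    show ?thesis unfolding cross_entropy_def log_def by measurable
  qed
  have ce_bound: "\<bar>?ce p\<bar> \<le> - 2 * log 2 \<delta>" if "p \<in> space square" for p
  proof -
    let ?w = "Rep_graphon W' (fst p) (snd p)" and ?v = "step_form M u p"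
    have w: "0 \<le> ?w" "?w \<le> 1" using that graphon_bounds[of "fst p" "snd p" W'] by (auto simp: space_pair_measure)
    have v: "\<delta> \<le> ?v" "\<delta> \<le> 1 - ?v" "?v \<le> 1" using u[of "M (fst p)" "M (snd p)"] \<delta> by (auto simp: step_form_def)
    have l: "0 \<le> - log 2 y \<and> - log 2 y \<le> - log 2 \<delta>" if "\<delta> \<le> y" "y \<le> 1" for y using that \<delta> by simp
    have scale: "a * y \<le> 0 \<and> y \<le> a * y" if "0 \<le> a" "a \<le> 1" "y \<le> 0" for a y :: real
      using that mult_right_mono_neg[of a 1 y] by (simp add: mult_nonneg_nonpos)
    have "?w * log 2 ?v \<le> 0 \<and> log 2 \<delta> \<le> ?w * log 2 ?v"
      using l[of ?v] v w scale[of ?w "log 2 ?v"] by linarith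
    moreover have "(1 - ?w) * log 2 (1 - ?v) \<le> 0 \<and> log 2 \<delta> \<le> (1 - ?w) * log 2 (1 - ?v)"
      using l[of "1 - ?v"] v \<delta> w scale[of "1 - ?w" "log 2 (1 - ?v)"] by linarith
    ultimately show ?thesis unfolding cross_entropy_def by linarith
  qed
  note ce_int = sum_upairs_integral[OF _ ce_meas ce_bound, of ?I]
  have int: "integrable (cube ?I) (\<lambda>x. \<Sum>A\<in>Pow ?P. graphon_bern ?I V A x * - log 2 (q A))" for V
    by (intro Bochner_Integration.integrable_sum integrable_mult_left integrable_graphon_bern)
  have int_eq: "(\<integral>x. (\<Sum>A\<in>Pow ?P. graphon_bern ?I V A x * - log 2 (q A)) \<partial>cube ?I)
     = (\<Sum>A\<in>Pow ?P. (\<integral>x. graphon_bern ?I V A x \<partial>cube ?I) * - log 2 (q A))" for V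
    using integrable_graphon_bern by (subst Bochner_Integration.integral_sum) auto
  have "real (k choose 2) * graphon_entropy W
    = (\<integral>x. (\<Sum>(i, j)\<in>?P. binary_entropy (Rep_graphon W (x i) (x j))) \<partial>cube ?I)"
    by (simp add: entropy_sum_upairs card_upairs)
  also have "\<dots> \<le> (\<integral>x. (\<Sum>A\<in>Pow ?P. graphon_bern ?I W A x * - log 2 (q A)) \<partial>cube ?I)"
  proof (rule integral_mono[OF entropy_sum_upairs(1) int])
    fix x assume x: "x \<in> space (cube ?I)"
    have "(\<Sum>p\<in>?P. binary_entropy (case p of (i, j) \<Rightarrow> Rep_graphon W (x i) (x j)))
        \<le> (\<Sum>A\<in>Pow ?P. graphon_bern ?I W A x * - log 2 (q A))"
      unfolding graphon_bern_def
      using graphon_pair_bounds[OF x] qpos q1 by (intro bern_entropy_gibbs) auto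
    then show "(\<Sum>(i, j)\<in>?P. binary_entropy (Rep_graphon W (x i) (x j)))
        \<le> (\<Sum>A\<in>Pow ?P. graphon_bern ?I W A x * - log 2 (q A))"
      by (simp add: case_prod_unfold)
  qed simp
  also have "\<dots> = (\<integral>x. (\<Sum>A\<in>Pow ?P. graphon_bern ?I W' A x * - log 2 (q A)) \<partial>cube ?I)"
    unfolding int_eq by (intro sum.cong refl) (simp add: dens)
  also have "\<dots> \<le> (\<integral>x. real k * log 2 (real m) + (\<Sum>(i, j)\<in>?P. ?ce (x i, x j)) \<partial>cube ?I)"
  proof (rule integral_mono[OF int])
    show "integrable (cube ?I) (\<lambda>x. real k * log 2 (real m) + (\<Sum>(i, j)\<in>?P. ?ce (x i, x j)))"
      using ce_int(1) by simp
    fix x assume x: "x \<in> space (cube ?I)"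
    define \<tau> where "\<tau> = restrict (\<lambda>i. M (x i)) ?I"
    have \<tau>: "\<tau> \<in> ?T" using Mlt by (auto simp: \<tau>_def)
    let ?w = "\<lambda>(i, j). Rep_graphon W' (x i) (x j)"
    let ?v = "\<lambda>(i, j). u (\<tau> i) (\<tau> j)"
    have w: "?w p \<in> {0..1}" if "p \<in> ?P" for p by (rule graphon_pair_bounds[OF x that])
    have v: "?v p \<in> {0..1}" for p
    proof (cases p)
      case (Pair i j)
      then show ?thesis using u[of "\<tau> i" "\<tau> j"] \<delta> by auto
    qed
    have logq: "- log 2 (q A) \<le> real k * log 2 (real m) - log 2 (b \<tau> A)" for A
    proof -
      have "b \<tau> A \<le> (\<Sum>\<tau>\<in>?T. b \<tau> A)"
        using finT \<tau> bpos by (intro member_le_sum) (auto intro: less_imp_le)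
      then have "log 2 (b \<tau> A / real m ^ k) \<le> log 2 (q A)"
        using bpos qpos m unfolding q_def by (subst log_le_cancel_iff) (auto intro: divide_right_mono)
      then show ?thesis using bpos[of \<tau> A] m by (simp add: log_divide log_nat_power)
    qed
    have logb: "log 2 (b \<tau> A) = (\<Sum>p\<in>?P. if p \<in> A then log 2 (?v p) else log 2 (1 - ?v p))" for A
      unfolding b_def by (rule log_bern) (use bpos[of \<tau> A] v in \<open>auto simp: b_def\<close>)
    have "(\<Sum>A\<in>Pow ?P. graphon_bern ?I W' A x * - log 2 (q A))
      \<le> (\<Sum>A\<in>Pow ?P. graphon_bern ?I W' A x * (real k * log 2 (real m) - log 2 (b \<tau> A)))"
      using graphon_bern_bounds[OF x] logq by (intro sum_mono mult_left_mono) auto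
    also have "\<dots> = real k * log 2 (real m) * (\<Sum>A\<in>Pow ?P. bern ?P ?w A)
        - (\<Sum>A\<in>Pow ?P. bern ?P ?w A * log 2 (b \<tau> A))"
      by (simp add: graphon_bern_def right_diff_distrib sum_subtractf sum_distrib_left mult.commute)
    also have "\<dots> = real k * log 2 (real m) - (\<Sum>p\<in>?P. ?w p * log 2 (?v p) + (1 - ?w p) * log 2 (1 - ?v p))"
      unfolding logb by (simp add: sum_bern sum_bern_additive)
    also have "\<dots> = real k * log 2 (real m) + (\<Sum>(i, j)\<in>?P. ?ce (x i, x j))"
    proof -
      have "- (?w p * log 2 (?v p) + (1 - ?w p) * log 2 (1 - ?v p)) = (case p of (i, j) \<Rightarrow> ?ce (x i, x j))" if "p \<in> ?P" for p
        using that by (auto simp: upairs_def cross_entropy_def step_form_def \<tau>_def)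
      then have "(\<Sum>(i, j)\<in>?P. ?ce (x i, x j)) = (\<Sum>p\<in>?P. - (?w p * log 2 (?v p) + (1 - ?w p) * log 2 (1 - ?v p)))"
        by (intro sum.cong refl) simp
      then show ?thesis by (simp only: sum_negf)
    qed
    finally show "(\<Sum>A\<in>Pow ?P. graphon_bern ?I W' A x * - log 2 (q A))
      \<le> real k * log 2 (real m) + (\<Sum>(i, j)\<in>?P. ?ce (x i, x j))" .
  qed
  also have "\<dots> = real k * log 2 (real m) + real (k choose 2) * (\<integral>p. ?ce p \<partial>square)"
    using ce_int by (simp add: card_upairs P.prob_space)
  finally show ?thesis .
qed

lemma integrable_entropy_graphon:
  "integrable square (\<lambda>p. binary_entropy (Rep_graphon W (fst p) (snd p)))"
  using entropy_graphon_bound measurable_entropy_graphon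
  by (intro unit_square.P.integrable_const_bound[of _ "1 / ln 2"] AE_I2) auto

lemma graphon_equiv_entropy_le:
  assumes equiv: "graphon_equiv W W'"
  shows "graphon_entropy W \<le> graphon_entropy W'"
proof -
  have main: "graphon_entropy W \<le> graphon_entropy W' - log 2 (1 - \<delta>)" if \<delta>: "0 < \<delta>" "\<delta> < 1 / 2" for \<delta>
  proof (rule field_le_epsilon)
    fix \<epsilon> :: real assume \<epsilon>: "\<epsilon> > 0"
    define \<eta> where "\<eta> = \<epsilon> * (\<delta> * ln 2)"
    have \<eta>: "\<eta> > 0" using \<epsilon> \<delta> by (simp add: \<eta>_def)
    let ?w = "\<lambda>p. Rep_graphon W' (fst p) (snd p)"
    have [measurable]: "?w \<in> borel_measurable square" by (rule measurable_graphon)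
    have g_int: "integrable square (\<lambda>p. clip \<delta> (?w p))"
    proof (rule unit_square.P.integrable_const_bound[of _ 1], rule AE_I2)
      fix p show "norm (clip \<delta> (?w p)) \<le> 1"
        using clip_bounds[OF \<delta>(2), of "?w p"] \<delta> by auto
      show "(\<lambda>p. clip \<delta> (?w p)) \<in> borel_measurable square"
        unfolding clip_def by measurable
    qed
    from step_approximable_integrable[OF this] \<eta> obtain M m u0
      where M: "finite_partition M m" and u0: "(\<integral>p. \<bar>clip \<delta> (?w p) - step_form M u0 p\<bar> \<partial>square) \<le> \<eta>"
      unfolding step_approximable_def by meson
    define u where "u t t' = clip \<delta> (u0 t t')" for t t'
    have u: "u t t' \<in> {\<delta>..1 - \<delta>}" for t t' unfolding u_def by (rule clip_bounds[OF \<delta>(2)])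
    let ?ce = "\<lambda>p. cross_entropy (?w p) (step_form M u p)"
    have d_int: "integrable square (\<lambda>p. \<bar>clip \<delta> (?w p) - step_form M u0 p\<bar>)"
      using g_int integrable_step_form[OF M, of u0] by simp
    have "(\<integral>p. ?ce p \<partial>square) \<le> (\<integral>p. binary_entropy (?w p) - log 2 (1 - \<delta>)
        + 1 / (\<delta> * ln 2) * \<bar>clip \<delta> (?w p) - step_form M u0 p\<bar> \<partial>square)"
    proof (rule integral_mono_AE')
      show "integrable square (\<lambda>p. binary_entropy (?w p) - log 2 (1 - \<delta>)
        + 1 / (\<delta> * ln 2) * \<bar>clip \<delta> (?w p) - step_form M u0 p\<bar>)"
        using integrable_entropy_graphon[of W'] d_int by simp
      have 1: "?ce p \<le> binary_entropy (?w p) - log 2 (1 - \<delta>)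
        + 1 / (\<delta> * ln 2) * \<bar>clip \<delta> (?w p) - step_form M u0 p\<bar>" if "p \<in> space square" for p
      proof -
        have "?w p \<in> {0..1}" using that by (intro graphon_bounds) (auto simp: space_pair_measure)
        moreover have "step_form M u p = clip \<delta> (step_form M u0 p)" by (simp add: step_form_def u_def)
        ultimately show ?thesis using cross_entropy_le[OF \<delta>, of "?w p"] by simp
      qed
      have 2: "0 \<le> ?ce p" if "p \<in> space square" for p
      proof -
        have w: "?w p \<in> {0..1}" using that by (intro graphon_bounds) (auto simp: space_pair_measure)
        have v: "\<delta> \<le> step_form M u p" "step_form M u p \<le> 1 - \<delta>"
          using u[of "M (fst p)" "M (snd p)"] by (auto simp: step_form_def)
        have "log 2 (step_form M u p) \<le> 0" "log 2 (1 - step_form M u p) \<le> 0"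
          using v \<delta> by simp_all
        then have "?w p * log 2 (step_form M u p) \<le> 0" "(1 - ?w p) * log 2 (1 - step_form M u p) \<le> 0"
          using w by (auto intro!: mult_nonneg_nonpos)
        then show ?thesis by (simp add: cross_entropy_def)
      qed
      show "AE p in square. ?ce p \<le> binary_entropy (?w p) - log 2 (1 - \<delta>)
        + 1 / (\<delta> * ln 2) * \<bar>clip \<delta> (?w p) - step_form M u0 p\<bar>"
        using 1 by (rule AE_I2)
      show "AE p in square. 0 \<le> binary_entropy (?w p) - log 2 (1 - \<delta>)
        + 1 / (\<delta> * ln 2) * \<bar>clip \<delta> (?w p) - step_form M u0 p\<bar>"
        using order_trans[OF 2 1] by (intro AE_I2) blast
    qed
    also have "\<dots> = graphon_entropy W' - log 2 (1 - \<delta>)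
        + 1 / (\<delta> * ln 2) * (\<integral>p. \<bar>clip \<delta> (?w p) - step_form M u0 p\<bar> \<partial>square)"
      using integrable_entropy_graphon[of W'] d_int
      by (simp add: graphon_entropy_eq unit_square.P.prob_space)
    also have "\<dots> \<le> graphon_entropy W' - log 2 (1 - \<delta>) + 1 / (\<delta> * ln 2) * \<eta>"
      using u0 \<delta> by (intro add_left_mono mult_left_mono) auto
    also have "\<dots> = graphon_entropy W' - log 2 (1 - \<delta>) + \<epsilon>"
      using \<delta> by (simp add: \<eta>_def)
    finally have ce: "(\<integral>p. ?ce p \<partial>square) \<le> graphon_entropy W' - log 2 (1 - \<delta>) + \<epsilon>" .
    have "(\<lambda>k. 2 * log 2 (real m) * (1 / (real k - 1)) + (\<integral>p. ?ce p \<partial>square))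
        \<longlonglongrightarrow> 2 * log 2 (real m) * 0 + (\<integral>p. ?ce p \<partial>square)"
      by (intro tendsto_intros; real_asymp)
    moreover have "\<forall>\<^sub>F k in sequentially. graphon_entropy W
        \<le> 2 * log 2 (real m) * (1 / (real k - 1)) + (\<integral>p. ?ce p \<partial>square)"
      using eventually_ge_at_top[of 2]
    proof eventually_elim
      case (elim k)
      have pos: "real k * (real k - 1) / 2 > 0" using elim by simp
      have "real k * (real k - 1) / 2 * graphon_entropy W
          \<le> real k * log 2 (real m) + real k * (real k - 1) / 2 * (\<integral>p. ?ce p \<partial>square)"
        using graphon_entropy_le_cross_entropy[OF equiv _ M \<delta> u, of k] elim
        by (simp add: real_choose_two)
      also have "\<dots> = real k * (real k - 1) / 2 * (2 * log 2 (real m) * (1 / (real k - 1)) + (\<integral>p. ?ce p \<partial>square))"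
        using elim by (simp add: distrib_left)
      finally show ?case using pos by (rule mult_left_le_imp_le)
    qed
    ultimately have "graphon_entropy W \<le> 2 * log 2 (real m) * 0 + (\<integral>p. ?ce p \<partial>square)"
      by (intro tendsto_lowerbound) auto
    then show "graphon_entropy W \<le> graphon_entropy W' - log 2 (1 - \<delta>) + \<epsilon>" using ce by simp
  qed
  have "((\<lambda>\<delta>. graphon_entropy W' - log 2 (1 - \<delta>)) \<longlongrightarrow> graphon_entropy W' - log 2 (1 - 0)) (at_right 0)"
    by (intro tendsto_intros) auto
  moreover have "\<forall>\<^sub>F \<delta> in at_right 0. graphon_entropy W \<le> graphon_entropy W' - log 2 (1 - \<delta>)"
    using eventually_at_right_real[of 0 "1 / 2 :: real"] by (rule eventually_mono) (use main in auto)
  ultimately show ?thesis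
    by (auto dest: tendsto_lowerbound)
qed

subsection \<open>The growth rate\<close>

lemma induced_density_nonzero_embedding:
  assumes "card (verts H) \<le> card (verts G)" "induced_density H G \<noteq> 0"
  shows "\<exists>f. inj_on f (verts H) \<and> f ` verts H \<subseteq> verts G \<and> preserves_adjacency H G f"
proof -
  let ?J = "{\<phi> \<in> verts H \<rightarrow>\<^sub>E verts G. inj_on \<phi> (verts H)}"
  have fin: "finite ?J" by (rule finite_subset[of _ "verts H \<rightarrow>\<^sub>E verts G"]) (auto intro: finite_PiE)
  obtain f where f: "f ` verts H \<subseteq> verts G" "inj_on f (verts H)"
    using card_le_inj[OF finite_verts finite_verts assms(1)] by blast
  then have "restrict f (verts H) \<in> ?J"
    by (auto simp: inj_on_restrict_eq)
  then have "?J \<noteq> {}" by blast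
  then have eq: "induced_density H G = real (card (?J \<inter> {\<phi>. preserves_adjacency H G \<phi>})) / real (card ?J)"
    unfolding induced_density_def using fin by (rule measure_pmf_of_set)
  have "?J \<inter> {\<phi>. preserves_adjacency H G \<phi>} \<noteq> {}"
  proof
    assume "?J \<inter> {\<phi>. preserves_adjacency H G \<phi>} = {}"
    then have "induced_density H G = 0" unfolding eq by (simp only: card.empty of_nat_0 div_0)
    then show False using assms(2) by simp
  qed
  then obtain g where "g \<in> ?J" "preserves_adjacency H G g" by blast
  then show ?thesis by (intro exI[of _ g]) (auto simp: PiE_iff)
qed

lemma class_limit_support:
  assumes Q: "hereditary Q" and \<Gamma>: "\<Gamma> \<in> class_limits Q" and n: "n > 0"
    and A: "A \<subseteq> upairs {..<n}" "limit_density (labelled_graph n A) \<Gamma> \<noteq> 0"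
  shows "A \<in> labelled Q n"
proof -
  let ?H = "labelled_graph n A"
  obtain G where G: "\<And>i. abs_unlabelled_graph (G i) \<in> Q"
    and c: "filterlim (\<lambda>i. card (verts (G i))) at_top sequentially"
    and d: "(\<lambda>i. induced_density ?H (G i)) \<longlonglongrightarrow> limit_density ?H \<Gamma>"
    using \<Gamma> unfolding class_limits_def converges_to_limit_def by blast
  have "\<forall>\<^sub>F i in sequentially. induced_density ?H (G i) \<noteq> 0"
    using d A(2) by (rule tendsto_imp_eventually_ne)
  moreover have "\<forall>\<^sub>F i in sequentially. card (verts ?H) \<le> card (verts (G i))"
    using c unfolding filterlim_at_top by blast
  ultimately have "\<forall>\<^sub>F i in sequentially. induced_density ?H (G i) \<noteq> 0 \<and> card (verts ?H) \<le> card (verts (G i))"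
    by (rule eventually_conj)
  then obtain i where i: "induced_density ?H (G i) \<noteq> 0" "card (verts ?H) \<le> card (verts (G i))"
    by (auto dest: eventually_happens)
  from induced_density_nonzero_embedding[OF i(2,1)] obtain f where f: "inj_on f {..<n}" "f ` {..<n} \<subseteq> verts (G i)"
    "preserves_adjacency ?H (G i) f"
    unfolding verts_labelled[OF n A(1)] by blast
  have "(u, v) \<in> A \<longleftrightarrow> adj (G i) (f u) (f v)" if uv: "(u, v) \<in> upairs {..<n}" for u v
  proof -
    have "(u, v) \<in> A \<longleftrightarrow> adj ?H u v"
      using uv adj_labelled[OF n A(1)] by (simp add: upairs_def)
    also have "\<dots> \<longleftrightarrow> adj (G i) (f u) (f v)"
      using f(3) uv unfolding preserves_adjacency_def verts_labelled[OF n A(1)]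
      by (auto simp: upairs_def)
    finally show ?thesis .
  qed
  then have "pullback n (G i) f = A"
    using A(1) by (auto simp: pullback_def)
  then have "abs_unlabelled_graph ?H \<in> Q"
    using pullback_mem[OF Q G n f(1,2)] by simp
  then show ?thesis using A(1) by (simp add: labelled_def)
qed

lemma limit_density_rep: "limit_density H \<Gamma> = graphon_density H (rep_graph_limit \<Gamma>)"
  by (metis limit_density.abs_eq Quotient_graph_limit Quotient_abs_rep)

lemma class_limit_entropy_le:
  assumes Q: "hereditary Q" and \<Gamma>: "\<Gamma> \<in> class_limits Q" and n: "n > 0"
  shows "real (n choose 2) * graph_limit_entropy \<Gamma> \<le> log 2 (real (card (labelled Q n)))"
  unfolding graph_limit_entropy_def
proof (rule graphon_entropy_le_log_support[OF n])
  show "labelled Q n \<subseteq> Pow (upairs {..<n})" by (auto simp: labelled_def)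
  fix A assume "A \<in> Pow (upairs {..<n}) - labelled Q n"
  then show "graphon_density (labelled_graph n A) (rep_graph_limit \<Gamma>) = 0"
    using class_limit_support[OF Q \<Gamma> n, of A] by (auto simp: limit_density_rep)
qed

lemma log_fact_le: "log 2 (fact n) \<le> real n * log 2 (real n)"
proof (cases "n = 0")
  case False
  have "fact n \<le> real n ^ n"
    using fact_le_power[of n, where 'a = real] by simp
  then have "log 2 (fact n) \<le> log 2 (real n ^ n)"
    using False by (subst log_le_cancel_iff) auto
  then show ?thesis using False by (simp add: log_nat_power)
qed simp

definition growth :: "unlabelled_graph set \<Rightarrow> nat \<Rightarrow> real" where
  "growth Q n = log 2 (real (card (of_order Q n))) / real (n choose 2)"

lemma growth_ge:
  assumes Q: "infinite Q" "hereditary Q" and \<Gamma>: "\<Gamma> \<in> class_limits Q" and n: "n \<ge> 2"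
  shows "graph_limit_entropy \<Gamma> - 2 * log 2 (real n) / (real n - 1) \<le> growth Q n"
proof -
  have n0: "n > 0" using n by simp
  have pos: "real (card (of_order Q n)) > 0"
    using of_order_nonempty[OF Q n0] finite_of_order[OF n0] by (simp add: card_gt_0_iff)
  have c: "real (n choose 2) = real n * (real n - 1) / 2" by (rule real_choose_two)
  have cpos: "real (n choose 2) > 0" using n by (simp add: binomial_eq_0_iff)
  have "0 < card (of_order Q n)" using pos by (simp only: of_nat_0_less_iff)
  then have lpos: "0 < card (labelled Q n)"
    using card_of_order_le[OF n0, of Q] by linarith
  have "real (card (labelled Q n)) \<le> fact n * real (card (of_order Q n))"
    using of_nat_mono[OF card_labelled_le[OF n0, of Q], where 'a = real]
    by (simp only: of_nat_mult of_nat_fact)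
  then have "log 2 (real (card (labelled Q n))) \<le> log 2 (fact n * real (card (of_order Q n)))"
    using lpos pos by (subst log_le_cancel_iff) simp_all
  also have "\<dots> = log 2 (fact n) + log 2 (real (card (of_order Q n)))"
    using pos by (simp add: log_mult)
  also have "\<dots> \<le> real n * log 2 (real n) + log 2 (real (card (of_order Q n)))"
    using log_fact_le by simp
  finally have "real (n choose 2) * graph_limit_entropy \<Gamma> \<le> real n * log 2 (real n) + log 2 (real (card (of_order Q n)))"
    using class_limit_entropy_le[OF Q(2) \<Gamma> n0] by linarith
  then have "graph_limit_entropy \<Gamma> \<le> (real n * log 2 (real n) + log 2 (real (card (of_order Q n)))) / real (n choose 2)"
    using cpos by (simp add: pos_le_divide_eq mult.commute)
  also have "\<dots> = real n * log 2 (real n) / real (n choose 2) + growth Q n"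
    by (simp add: add_divide_distrib growth_def)
  also have "real n * log 2 (real n) / real (n choose 2) = 2 * log 2 (real n) / (real n - 1)"
    unfolding c using n by (simp add: field_simps)
  finally show ?thesis by simp
qed

lemma growth_bounds:
  assumes "infinite Q" "hereditary Q" "n \<ge> 2"
  shows "0 \<le> growth Q n" "growth Q n \<le> 1"
proof -
  have n0: "n > 0" using assms by simp
  have pos: "real (card (of_order Q n)) \<ge> 1"
    using of_order_nonempty[OF assms(1,2) n0] finite_of_order[OF n0]
    by (simp add: Suc_le_eq card_gt_0_iff)
  then show "0 \<le> growth Q n" unfolding growth_def by simp
  have "card (of_order Q n) \<le> card (Pow (upairs {..<n}))"
    using card_of_order_le[OF n0, of Q] card_mono[of "Pow (upairs {..<n})" "labelled Q n"]
    by (force simp: labelled_def)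
  also have "\<dots> = 2 ^ (n choose 2)" by (simp add: card_Pow card_upairs)
  finally have "real (card (of_order Q n)) \<le> 2 ^ (n choose 2)"
    by (metis of_nat_le_iff of_nat_numeral of_nat_power)
  then have "log 2 (real (card (of_order Q n))) \<le> log 2 (2 ^ (n choose 2))"
    using pos by (subst log_le_cancel_iff) auto
  then have "log 2 (real (card (of_order Q n))) \<le> real (n choose 2)"
    by (simp add: log_nat_power)
  then show "growth Q n \<le> 1"
    using assms(3) unfolding growth_def by (subst divide_le_eq_1_pos) (auto simp: binomial_eq_0_iff)
qed

lemma ex_class_limit_ge:
  assumes Q: "infinite Q" "hereditary Q"
    and c: "\<And>\<epsilon>. \<epsilon> > 0 \<Longrightarrow> \<exists>\<^sub>F n in sequentially. c - \<epsilon> \<le> growth Q n"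
  shows "\<exists>\<Gamma>\<in>class_limits Q. c \<le> graph_limit_entropy \<Gamma>"
proof -
  have "\<exists>G. abs_unlabelled_graph G \<in> Q \<and> k \<le> card (verts G) \<and> entropy_rich (Suc k) (c - 2 / real (Suc k)) G" for k
  proof -
    have "\<forall>\<^sub>F n in sequentially. of_order Q n \<noteq> {} \<longrightarrow> c - 1 / real (Suc k) \<le> growth Q n \<longrightarrow>
      (\<exists>A\<in>labelled Q n. entropy_rich (Suc k) (c - 2 * (1 / real (Suc k))) (labelled_graph n A))"
      unfolding growth_def by (rule eventually_ex_entropy_rich) auto
    then have "\<forall>\<^sub>F n in sequentially. n \<ge> Suc k \<and> (of_order Q n \<noteq> {} \<longrightarrow> c - 1 / real (Suc k) \<le> growth Q n \<longrightarrow>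
      (\<exists>A\<in>labelled Q n. entropy_rich (Suc k) (c - 2 * (1 / real (Suc k))) (labelled_graph n A)))"
      using eventually_ge_at_top by (intro eventually_conj)
    then have "\<exists>\<^sub>F n in sequentially. (n \<ge> Suc k \<and> (of_order Q n \<noteq> {} \<longrightarrow> c - 1 / real (Suc k) \<le> growth Q n \<longrightarrow>
      (\<exists>A\<in>labelled Q n. entropy_rich (Suc k) (c - 2 * (1 / real (Suc k))) (labelled_graph n A)))) \<and>
      c - 1 / real (Suc k) \<le> growth Q n"
      by (intro frequently_eventually_conj c) auto
    from frequently_ex[OF this]
    obtain n where n: "n \<ge> Suc k" "c - 1 / real (Suc k) \<le> growth Q n"
      "of_order Q n \<noteq> {} \<longrightarrow> c - 1 / real (Suc k) \<le> growth Q n \<longrightarrow>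
      (\<exists>A\<in>labelled Q n. entropy_rich (Suc k) (c - 2 * (1 / real (Suc k))) (labelled_graph n A))"
      by blast
    have n0: "n > 0" using n(1) by simp
    obtain A where A: "A \<in> labelled Q n" "entropy_rich (Suc k) (c - 2 * (1 / real (Suc k))) (labelled_graph n A)"
      using n of_order_nonempty[OF Q n0] by blast
    then have "A \<subseteq> upairs {..<n}" "abs_unlabelled_graph (labelled_graph n A) \<in> Q"
      by (auto simp: labelled_def)
    then show ?thesis using A(2) n(1) n0
      by (intro exI[of _ "labelled_graph n A"]) (simp add: verts_labelled)
  qed
  then obtain G where G: "\<And>k. abs_unlabelled_graph (G k) \<in> Q" "\<And>k. k \<le> card (verts (G k))"
    "\<And>k. entropy_rich (Suc k) (c - 2 / real (Suc k)) (G k)" by metis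
  have card: "filterlim (\<lambda>k. card (verts (G k))) at_top sequentially"
    by (rule filterlim_at_top_mono[OF filterlim_ident]) (simp add: G(2))
  have "\<forall>\<^sub>F k in sequentially. entropy_rich m (c - \<epsilon>) (G k)" if "\<epsilon> > 0" for m \<epsilon>
  proof -
    have "(\<lambda>k. 2 / real (Suc k)) \<longlonglongrightarrow> 0" by real_asymp
    then have "\<forall>\<^sub>F k in sequentially. 2 / real (Suc k) < \<epsilon>"
      using that by (rule order_tendstoD(2))
    then show ?thesis using eventually_ge_at_top[of m]
    proof eventually_elim
      case (elim k)
      show ?case
        unfolding entropy_rich_def
      proof
        fix \<kappa> assume \<kappa>: "\<kappa> \<in> verts (G k) \<rightarrow> {..<m}"
        have "\<kappa> \<in> verts (G k) \<rightarrow> {..<Suc k}"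
        proof (rule Pi_I)
          fix v assume "v \<in> verts (G k)"
          then show "\<kappa> v \<in> {..<Suc k}" using Pi_mem[OF \<kappa>] elim(2) by fastforce
        qed
        then have "c - 2 / real (Suc k) \<le> colouring_entropy (verts (G k)) (adj (G k)) \<kappa>"
          using G(3)[of k] unfolding entropy_rich_def by blast
        then show "c - \<epsilon> \<le> colouring_entropy (verts (G k)) (adj (G k)) \<kappa>" using elim by linarith
      qed
    qed
  qed
  from graph_limit_exists[OF card this] obtain r W where r: "strict_mono r"
    and W: "\<And>H. (\<lambda>n. induced_density H (G (r n))) \<longlonglongrightarrow> graphon_density H W" "c \<le> graphon_entropy W"
    by blast
  let ?\<Gamma> = "abs_graph_limit W"
  have "filterlim (\<lambda>n. card (verts (G (r n)))) at_top sequentially"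
    using filterlim_compose[OF card filterlim_subseq[OF r]] .
  then have "converges_to_limit (\<lambda>n. G (r n)) ?\<Gamma>"
    using W(1) by (simp add: converges_to_limit_def limit_density.abs_eq)
  then have "?\<Gamma> \<in> class_limits Q"
    unfolding class_limits_def mem_Collect_eq using G(1) by (intro exI[of _ "\<lambda>n. G (r n)"]) simp
  moreover have "graphon_equiv W (rep_graph_limit ?\<Gamma>)"
    unfolding graphon_equiv_def limit_density_rep[symmetric] by (simp add: limit_density.abs_eq)
  then have "c \<le> graph_limit_entropy ?\<Gamma>"
    unfolding graph_limit_entropy_def by (rule order_trans[OF W(2) graphon_equiv_entropy_le])
  ultimately show ?thesis by blast
qed

theorem theorem1p5:
  fixes Q :: "unlabelled_graph set"
  assumes "infinite Q" and "hereditary Q"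
  shows "\<exists>\<Gamma>\<in>class_limits Q.
           (\<forall>\<Gamma>'\<in>class_limits Q. graph_limit_entropy \<Gamma>' \<le> graph_limit_entropy \<Gamma>) \<and>
           (\<lambda>n. log 2 (real (card (of_order Q n))) / real (n choose 2))
             \<longlonglongrightarrow> graph_limit_entropy \<Gamma>"
proof -
  define X where "X = {x. \<forall>\<^sub>F n in sequentially. growth Q n \<le> x}"
  define c where "c = Inf X"
  have "1 \<in> X"
    unfolding X_def mem_Collect_eq using eventually_ge_at_top[of 2]
    by (rule eventually_mono) (rule growth_bounds(2)[OF assms])
  have X0: "0 \<le> x" if "x \<in> X" for x
  proof -
    have "\<forall>\<^sub>F n in sequentially. growth Q n \<le> x \<and> n \<ge> 2"
      using that eventually_ge_at_top[of 2] by (auto simp: X_def intro: eventually_conj)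
    then obtain n where "growth Q n \<le> x" "n \<ge> 2" by (auto dest: eventually_happens)
    then show ?thesis using growth_bounds(1)[OF assms, of n] by linarith
  qed
  then have bdd: "bdd_below X" by (rule bdd_belowI)
  have upper: "\<forall>\<^sub>F n in sequentially. growth Q n < y" if "c < y" for y
  proof -
    have "X \<noteq> {}" using \<open>1 \<in> X\<close> by (metis empty_iff)
    from cInf_lessD[OF this that[unfolded c_def]] obtain x where x: "x \<in> X" "x < y" ..
    have "\<forall>\<^sub>F n in sequentially. growth Q n \<le> x" using x(1) by (simp add: X_def)
    then show ?thesis by (rule eventually_mono) (use x(2) in linarith)
  qed
  have "\<exists>\<^sub>F n in sequentially. c - \<epsilon> \<le> growth Q n" if "\<epsilon> > 0" for \<epsilon>
  proof (rule ccontr)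
    assume "\<not> ?thesis"
    then have "\<forall>\<^sub>F n in sequentially. growth Q n \<le> c - \<epsilon>"
      unfolding not_frequently by (rule eventually_mono) simp
    then have "c - \<epsilon> \<in> X" by (simp add: X_def)
    then have "c \<le> c - \<epsilon>" unfolding c_def using bdd by (rule cInf_lower)
    then show False using that by simp
  qed
  from ex_class_limit_ge[OF assms this] obtain \<Gamma> where
    \<Gamma>: "\<Gamma> \<in> class_limits Q" "c \<le> graph_limit_entropy \<Gamma>" by blast
  have lower: "\<forall>\<^sub>F n in sequentially. y < growth Q n" if "y < graph_limit_entropy \<Gamma>'" "\<Gamma>' \<in> class_limits Q" for y \<Gamma>'
  proof -
    have "(\<lambda>n. 2 * log 2 (real n) / (real n - 1)) \<longlonglongrightarrow> 0" by real_asymp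
    from order_tendstoD(2)[OF this, of "graph_limit_entropy \<Gamma>' - y"]
    have "\<forall>\<^sub>F n in sequentially. 2 * log 2 (real n) / (real n - 1) < graph_limit_entropy \<Gamma>' - y"
      using that by simp
    then show ?thesis using eventually_ge_at_top[of 2]
    proof eventually_elim
      case (elim n)
      then show ?case using growth_ge[OF assms that(2), of n] by linarith
    qed
  qed
  have le: "graph_limit_entropy \<Gamma>' \<le> c" if "\<Gamma>' \<in> class_limits Q" for \<Gamma>'
  proof (rule ccontr)
    assume "\<not> ?thesis"
    then obtain y where y: "c < y" "y < graph_limit_entropy \<Gamma>'" using dense not_le by metis
    have "\<forall>\<^sub>F n in sequentially. growth Q n < y \<and> y < growth Q n"
      using upper[OF y(1)] lower[OF y(2) that] by (rule eventually_conj)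
    then show False by (auto dest: eventually_happens)
  qed
  then have eq: "graph_limit_entropy \<Gamma> = c" using \<Gamma> by (simp add: antisym)
  have "growth Q \<longlonglongrightarrow> graph_limit_entropy \<Gamma>"
    using upper lower[OF _ \<Gamma>(1)] by (intro order_tendstoI) (auto simp: eq)
  then show ?thesis
    using \<Gamma>(1) le eq by (intro bexI[of _ \<Gamma>]) (auto simp: growth_def[abs_def])
qed

end
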